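(* $\mathsf{AVG}_\tau\text{-}\mathsf{LCL}[O(1)]\mathsf{P}=\mathsf{AVG}_\tau\text{-}\mathsf{LCL}[O(1)]\cap\mathsf{P}$.
   Context: A catalytic-type machine has a read-only input tape, a write-only output tape, a read-write work tape and a read-write catalytic tape initially holding an arbitrary string $\tau$. Let $d$ denote Hamming distance. $\mathsf{AVG}_\tau\text{-}\mathsf{LCL}[O(1)]$ is the class of languages $L$ for which there are constants $k,e$ and a deterministic such machine with $k\log n$ work bits and $n^k$ catalytic bits that, on every input $x$ and every initial catalytic content $\tau\in\{0,1\}^{n^k}$, outputs $L(x)$, and whose final catalytic content $\tau'$ satisfies $\mathbb{E}_\tau[d(\tau,\tau')]\le e$ for $\tau$ uniform (for every $x$). $\mathsf{AVG}_\tau\text{-}\mathsf{LCL}[O(1)]\mathsf{P}$ is the same class with the additional requirement that the machine always halts within $n^k$ steps. *)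

theory Defs
  imports Complex_Main "HOL-Library.Log_Nat"
begin

text \<open>Tapes are binary strings delimited by endmarkers: a tape with content xs has
cells 0 .. length xs + 1, where cell p (1 \<le> p \<le> length xs) holds xs!(p-1) and cells
0 and length xs + 1 are endmarkers (read as None).  Heads cannot leave this range.
The input tape is read-only.  The write-only output tape of a decision procedure is
modelled by halting with an output bit.\<close>

datatype dir = Lft | Stay | Rgt

datatype act =
    Halt bool
  | Step nat bool bool dir dir dir
    \<comment> \<open>new state, bit written on work tape, bit written on catalytic tape,
        moves of input head, work head, catalytic head\<close>

type_synonym delta = "nat \<Rightarrow> bool option \<Rightarrow> bool option \<Rightarrow> bool option \<Rightarrow> act"

record cfg =
  st :: nat
  ih :: nat
  wh :: nat
  wt :: "bool list"
  ch :: nat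
  ct :: "bool list"
  result :: "bool option"

definition rd :: "bool list \<Rightarrow> nat \<Rightarrow> bool option" where
  "rd xs p = (if 1 \<le> p \<and> p \<le> length xs then Some (xs ! (p - 1)) else None)"

definition mv :: "nat \<Rightarrow> nat \<Rightarrow> dir \<Rightarrow> nat" where
  "mv len p d = (case d of Lft \<Rightarrow> p - 1 | Stay \<Rightarrow> p | Rgt \<Rightarrow> min (p + 1) (len + 1))"

definition wr :: "bool list \<Rightarrow> nat \<Rightarrow> bool \<Rightarrow> bool list" where
  "wr xs p b = (if 1 \<le> p \<and> p \<le> length xs then xs[p - 1 := b] else xs)"

definition step :: "delta \<Rightarrow> bool list \<Rightarrow> cfg \<Rightarrow> cfg" where
  "step \<delta> x c =
    (if result c \<noteq> None then c else
     (case \<delta> (st c) (rd x (ih c)) (rd (wt c) (wh c)) (rd (ct c) (ch c)) of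
        Halt b \<Rightarrow> c\<lparr>result := Some b\<rparr>
      | Step q a b di dw dc \<Rightarrow>
          c\<lparr>st := q,
            ih := mv (length x) (ih c) di,
            wt := wr (wt c) (wh c) a,
            wh := mv (length (wt c)) (wh c) dw,
            ct := wr (ct c) (ch c) b,
            ch := mv (length (ct c)) (ch c) dc\<rparr>))"

definition run :: "delta \<Rightarrow> bool list \<Rightarrow> cfg \<Rightarrow> nat \<Rightarrow> cfg" where
  "run \<delta> x c t = (step \<delta> x ^^ t) c"

definition init :: "nat \<Rightarrow> bool list \<Rightarrow> cfg" where
  "init s \<tau> = \<lparr>st = 0, ih = 0, wh = 0, wt = replicate s False, ch = 0, ct = \<tau>, result = None\<rparr>"

definition valid :: "nat \<Rightarrow> delta \<Rightarrow> bool" where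
  "valid Q \<delta> \<longleftrightarrow> 0 < Q \<and>
     (\<forall>q<Q. \<forall>a b c q' u v di dw dc. \<delta> q a b c = Step q' u v di dw dc \<longrightarrow> q' < Q)"

definition halting_time :: "delta \<Rightarrow> bool list \<Rightarrow> cfg \<Rightarrow> nat" where
  "halting_time \<delta> x c = (LEAST t. result (run \<delta> x c t) \<noteq> None)"

definition final :: "delta \<Rightarrow> bool list \<Rightarrow> cfg \<Rightarrow> cfg" where
  "final \<delta> x c = run \<delta> x c (halting_time \<delta> x c)"

definition hamming :: "bool list \<Rightarrow> bool list \<Rightarrow> nat" where
  "hamming xs ys = card {i. i < length xs \<and> xs ! i \<noteq> ys ! i}"

text \<open>Work space k log n bits (log n rendered as the bit length floorlog 2 n of n),
catalytic space n^k bits.\<close>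
definition work_bits :: "nat \<Rightarrow> nat \<Rightarrow> nat" where
  "work_bits k n = k * floorlog 2 n"

definition exp_dist :: "delta \<Rightarrow> bool list \<Rightarrow> nat \<Rightarrow> nat \<Rightarrow> real" where
  "exp_dist \<delta> x s m =
     (\<Sum>\<tau>\<in>{\<tau>. length \<tau> = m}. real (hamming \<tau> (ct (final \<delta> x (init s \<tau>))))) / 2 ^ m"

definition AVG_LCL :: "bool list set set" where
  "AVG_LCL = {L. \<exists>k (e::real) Q \<delta>. valid Q \<delta> \<and>
     (\<forall>x. let n = length x; s = work_bits k n; m = n ^ k in
        (\<forall>\<tau>. length \<tau> = m \<longrightarrow> (\<exists>t. result (run \<delta> x (init s \<tau>) t) = Some (x \<in> L))) \<and>
        exp_dist \<delta> x s m \<le> e)}"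

definition AVG_LCL_P :: "bool list set set" where
  "AVG_LCL_P = {L. \<exists>k (e::real) Q \<delta>. valid Q \<delta> \<and>
     (\<forall>x. let n = length x; s = work_bits k n; m = n ^ k in
        (\<forall>\<tau>. length \<tau> = m \<longrightarrow> (\<exists>t \<le> n ^ k + k. result (run \<delta> x (init s \<tau>) t) = Some (x \<in> L))) \<and>
        exp_dist \<delta> x s m \<le> e)}"

text \<open>P: decided by a machine of the same kind (no catalytic tape, polynomial-size
work tape, which is no restriction given the time bound) within a polynomial number
of steps.\<close>
definition P_class :: "bool list set set" where
  "P_class = {L. \<exists>k Q \<delta>. valid Q \<delta> \<and>
     (\<forall>x. let n = length x in
        (\<exists>t \<le> n ^ k + k. result (run \<delta> x (init (n ^ k + k) []) t) = Some (x \<in> L)))}"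

end

theory Submission
  imports Defs
begin

text \<open>
  A polynomial-time machine can be run on a single zero-initialised work tape, which gives one
  inclusion.  For the other one, let M be a machine with O(1) expected errors on a catalytic tape of
  length m.  The configurations from which M halts form trees rooted at the halting configurations.
  A depth-first tour of such a tree is reversible and each of its steps is local, so it can be
  performed for T steps and then undone exactly.  By Markov's inequality most initial contents are
  within bounded Hamming distance of their final content, so only polynomially many of them share a
  tree; as all trees together have poly(n) 2^m nodes, for at least half of the contents the tree is
  so small that a polynomial T suffices to see the root, hence the answer.  On n independent blocks
  of the catalytic tape all tours fail with probability at most 2^-n; only then the tape is
  overwritten by a run of the polynomial-time machine, which costs poly(n) / 2^n = O(1) expected
  errors.
\<close>

section \<open>Structured programs for the machine model\<close>

text \<open>A plain run on a block could be neither cut off nor erased: the machine forgets what it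
  overwrites, and a single run may leave errors of constant expectation, so that n attempts could
  leave about n. The tour leaves no errors at all, whether or not it sees the root, hence it may be
  repeated on fresh blocks. One block is not enough: overwriting the tape with probability 1/2 would
  cost polynomially many expected errors. The half arises as a quarter for contents more than D bits
  away from their final content, where D + 1 is at least 4e, and a quarter for contents in trees
  that are too large. The tour fits into logarithmic space because a configuration has boundedly
  many possible predecessors, one for each value of what a step forgets; the work tape stores only
  head positions, the simulated work tape and counters up to T. All of this is done by explicit
  machines: structured programs are compiled to transition functions, and numbers are kept in
  registers whose bits are interleaved in columns of the work tape, so that each basic register
  operation is one sweep of a two-state transducer.\<close>

type_synonym sym = "bool option"

datatype 'f com =
    Act "'f \<Rightarrow> sym \<Rightarrow> sym \<Rightarrow> sym \<Rightarrow> 'f \<times> bool \<times> bool \<times> dir \<times> dir \<times> dir"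
  | Seq "'f com" "'f com" (infixr ";;" 60)
  | Cond "'f \<Rightarrow> sym \<Rightarrow> sym \<Rightarrow> sym \<Rightarrow> bool" "'f com" "'f com"
  | Loop "'f \<Rightarrow> sym \<Rightarrow> sym \<Rightarrow> sym \<Rightarrow> bool" "'f com"

text \<open>The bit that leaves a cell unchanged when it is written back. Writing has no effect at
  an endmarker, so the value \<open>False\<close> there is harmless.\<close>

definition keep :: "sym \<Rightarrow> bool" where
  "keep a = (a = Some True)"

definition upd :: "bool list \<Rightarrow> cfg \<Rightarrow> bool \<Rightarrow> bool \<Rightarrow> dir \<Rightarrow> dir \<Rightarrow> dir \<Rightarrow> cfg" where
  "upd x c a b di dw dc =
     c\<lparr>ih := mv (length x) (ih c) di,
       wt := wr (wt c) (wh c) a,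
       wh := mv (length (wt c)) (wh c) dw,
       ct := wr (ct c) (ch c) b,
       ch := mv (length (ct c)) (ch c) dc\<rparr>"

text \<open>The control state consists of the stack of pending programs and the flag. Unfolding a
  construct or deciding a test takes one machine step that rewrites the scanned cells
  unchanged.\<close>

fun pdelta :: "('f \<Rightarrow> bool) \<Rightarrow> 'f com list \<times> 'f \<Rightarrow> sym \<Rightarrow> sym \<Rightarrow> sym \<Rightarrow>
    bool + (('f com list \<times> 'f) \<times> bool \<times> bool \<times> dir \<times> dir \<times> dir)" where
  "pdelta out ([], f) a b c = Inl (out f)"
| "pdelta out (Act g # K, f) a b c =
     (case g f a b c of (f', r) \<Rightarrow> Inr ((K, f'), r))"
| "pdelta out (Seq p q # K, f) a b c = Inr ((p # q # K, f), keep b, keep c, Stay, Stay, Stay)"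
| "pdelta out (Cond t p q # K, f) a b c =
     Inr (((if t f a b c then p else q) # K, f), keep b, keep c, Stay, Stay, Stay)"
| "pdelta out (Loop t p # K, f) a b c =
     Inr ((if t f a b c then p # Loop t p # K else K, f), keep b, keep c, Stay, Stay, Stay)"

fun sstep :: "bool list \<Rightarrow> 'f com list \<times> 'f \<times> cfg \<Rightarrow> 'f com list \<times> 'f \<times> cfg" where
  "sstep x ([], s) = ([], s)"
| "sstep x (Act g # K, f, c) =
     (case g f (rd x (ih c)) (rd (wt c) (wh c)) (rd (ct c) (ch c)) of
       (f', a, b, di, dw, dc) \<Rightarrow> (K, f', upd x c a b di dw dc))"
| "sstep x (Seq p q # K, s) = (p # q # K, s)"
| "sstep x (Cond t p q # K, f, c) =
     ((if t f (rd x (ih c)) (rd (wt c) (wh c)) (rd (ct c) (ch c)) then p else q) # K, f, c)"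
| "sstep x (Loop t p # K, f, c) =
     (if t f (rd x (ih c)) (rd (wt c) (wh c)) (rd (ct c) (ch c)) then p # Loop t p # K else K, f, c)"

primrec closed_flags :: "'f set \<Rightarrow> 'f com \<Rightarrow> bool" where
  "closed_flags F (Act g) = (\<forall>f\<in>F. \<forall>a b c. fst (g f a b c) \<in> F)"
| "closed_flags F (Seq p q) = (closed_flags F p \<and> closed_flags F q)"
| "closed_flags F (Cond t p q) = (closed_flags F p \<and> closed_flags F q)"
| "closed_flags F (Loop t p) = closed_flags F p"

text \<open>The continuation stacks that occur while \<open>p\<close> runs on top of
  \<open>K\<close>. There is no recursion and the body of a loop always has this loop as its
  continuation, so each program point determines its stack and finitely many control states
  suffice.\<close>

primrec stacks :: "'f com \<Rightarrow> 'f com list \<Rightarrow> 'f com list set" where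
  "stacks (Act g) K = {Act g # K}"
| "stacks (Seq p q) K = {Seq p q # K} \<union> stacks p (q # K) \<union> stacks q K"
| "stacks (Cond t p q) K = {Cond t p q # K} \<union> stacks p K \<union> stacks q K"
| "stacks (Loop t p) K = {Loop t p # K} \<union> stacks p (Loop t p # K)"

lemma finite_stacks: "finite (stacks p K)"
  by (induction p arbitrary: K) auto

lemma stacks_start: "p # K \<in> stacks p K"
  by (cases p) auto

text \<open>A subprogram ends at its continuation, which begins with the next subprogram and is
  therefore listed again; only the end of the whole program leads out, to \<open>K\<close>.\<close>

lemma stacks_step:
  assumes "closed_flags F p" "L \<in> stacks p K" "f \<in> F"
    and "pdelta out (L, f) a b c = Inr ((L', f'), r)"
  shows "f' \<in> F \<and> L' \<in> insert K (stacks p K)"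
  using assms
proof (induction p arbitrary: K)
  case (Act g)
  then show ?case by (auto split: prod.splits) (metis fst_conv)
next
  case (Seq p q)
  consider "L = Seq p q # K" | "L \<in> stacks p (q # K)" | "L \<in> stacks q K"
    using Seq.prems by auto
  then show ?case
  proof cases
    case 1
    then show ?thesis using Seq.prems by (auto intro: stacks_start)
  next
    case 2
    then show ?thesis using Seq.IH(1)[of "q # K"] Seq.prems by (auto intro: stacks_start)
  next
    case 3
    then show ?thesis using Seq.IH(2)[of K] Seq.prems by auto
  qed
next
  case (Cond t p q)
  consider "L = Cond t p q # K" | "L \<in> stacks p K" | "L \<in> stacks q K"
    using Cond.prems by auto
  then show ?case
  proof cases
    case 1
    then show ?thesis using Cond.prems by (auto intro: stacks_start split: if_splits)
  next
    case 2
    then show ?thesis using Cond.IH(1)[of K] Cond.prems by auto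
  next
    case 3
    then show ?thesis using Cond.IH(2)[of K] Cond.prems by auto
  qed
next
  case (Loop t p)
  consider "L = Loop t p # K" | "L \<in> stacks p (Loop t p # K)"
    using Loop.prems by auto
  then show ?case
  proof cases
    case 1
    then show ?thesis using Loop.prems by (auto intro: stacks_start split: if_splits)
  next
    case 2
    then show ?thesis using Loop.IH[of "Loop t p # K"] Loop.prems by auto
  qed
qed

lemma wr_keep [simp]: "wr xs p (keep (rd xs p)) = xs"
  by (auto simp: wr_def rd_def keep_def)

lemma mv_Stay [simp]: "mv n p Stay = p"
  by (simp add: mv_def)

lemma upd_keep [simp]:
  "upd x c (keep (rd (wt c) (wh c))) (keep (rd (ct c) (ch c))) Stay Stay Stay = c"
  by (simp add: upd_def)

lemma upd_frame [simp]:
  "st (upd x c a b di dw dc) = st c" "result (upd x c a b di dw dc) = result c"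
  by (simp_all add: upd_def)

lemma sstep_pdelta_Inr:
  assumes "L \<noteq> []"
  shows "\<exists>L' f' a b di dw dc.
    pdelta out (L, f) (rd x (ih c)) (rd (wt c) (wh c)) (rd (ct c) (ch c)) = Inr ((L', f'), a, b, di, dw, dc)
    \<and> sstep x (L, f, c) = (L', f', upd x c a b di dw dc)"
proof (cases L)
  case Nil
  then show ?thesis using assms by simp
next
  case (Cons p K)
  then show ?thesis by (cases p) (auto split: prod.splits)
qed

lemma run_Suc: "run \<delta> x c (Suc t) = step \<delta> x (run \<delta> x c t)"
  by (simp add: run_def)

lemma run_0 [simp]: "run \<delta> x c 0 = c"
  by (simp add: run_def)

text \<open>Control states are numbered so that the program starts in state 0, as
  \<open>init\<close> demands. The empty stack is the state that halts, whence the additional step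
  in \<open>Suc t\<close>.\<close>

theorem com_realizable:
  fixes p :: "'f com"
  assumes finF: "finite F" and f0: "f0 \<in> F" and cl: "closed_flags F p"
  obtains Q \<delta> where "valid Q \<delta>"
    "\<And>x c t f' c'. st c = 0 \<Longrightarrow> result c = None \<Longrightarrow> (sstep x ^^ t) ([p], f0, c) = ([], f', c') \<Longrightarrow>
       result (run \<delta> x c (Suc t)) = Some (out f') \<and> ct (run \<delta> x c (Suc t)) = ct c'"
proof -
  define S where "S = insert [] (stacks p []) \<times> F"
  have finS: "finite S" using finF finite_stacks unfolding S_def by (intro finite_cartesian_product) auto
  have s0S: "([p], f0) \<in> S" using f0 stacks_start by (auto simp: S_def)
  obtain e0 where e0: "bij_betw e0 S {0..<card S}" using ex_bij_betw_finite_nat[OF finS] by blast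
  \<comment> \<open>An arbitrary numbering \<open>e0\<close> is composed with the transposition that
    sends the start state to 0.\<close>
  define e where "e s = (if e0 s = 0 then e0 ([p], f0) else if e0 s = e0 ([p], f0) then 0 else e0 s)" for s
  have cpos: "0 < card S" using s0S finS card_gt_0_iff by blast
  have inj: "inj_on e S"
    using e0 s0S unfolding bij_betw_def inj_on_def e_def by (auto split: if_splits)
  have e_less: "e s < card S" if "s \<in> S" for s
    using e0 s0S that cpos unfolding bij_betw_def e_def by (auto split: if_splits)
  have e_start: "e ([p], f0) = 0" by (simp add: e_def)
  define \<delta> where "\<delta> q a b c =
     (if q \<in> e ` S then
       (case pdelta out (the_inv_into S e q) a b c of Inl r \<Rightarrow> Halt r
        | Inr (s, u, v, di, dw, dc) \<Rightarrow> Step (e s) u v di dw dc)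
      else Halt False)" for q a b c
  have closedS: "s' \<in> S" if "s \<in> S" "pdelta out s a b c = Inr (s', r)" for s s' a b c r
  proof -
    obtain L f L' f' where s: "s = (L, f)" "s' = (L', f')" by (cases s, cases s') auto
    show ?thesis
    proof (cases "L = []")
      case True
      then show ?thesis using that s by simp
    next
      case False
      then show ?thesis using stacks_step[OF cl, of L "[]" f out a b c L' f' r] that s
        by (auto simp: S_def)
    qed
  qed
  have \<delta>_e: "\<delta> (e s) a b c = (case pdelta out s a b c of Inl r \<Rightarrow> Halt r
        | Inr (s, u, v, di, dw, dc) \<Rightarrow> Step (e s) u v di dw dc)" if "s \<in> S" for s a b c
    using that by (simp add: \<delta>_def the_inv_into_f_f[OF inj])
  have valid: "valid (card S) \<delta>"
    unfolding valid_def
  proof (intro conjI cpos allI impI)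
    fix q a b c q' u v di dw dc
    assume h: "\<delta> q a b c = Step q' u v di dw dc"
    then have "q \<in> e ` S" by (auto simp: \<delta>_def split: if_splits)
    then obtain s where s: "s \<in> S" "q = e s" by blast
    then obtain s' where "pdelta out s a b c = Inr (s', u, v, di, dw, dc)" "q' = e s'"
      using h by (auto simp: \<delta>_e split: sum.splits prod.splits)
    then show "q' < card S" using closedS s e_less by blast
  qed
  \<comment> \<open>The second disjunct covers the time after halting: \<open>sstep\<close> stutters
    on the empty stack while the machine is frozen.\<close>
  have sim: "run \<delta> x c t = c'\<lparr>st := e (L, f')\<rparr> \<and> (L, f') \<in> S \<and> result c' = None \<or> result (run \<delta> x c t) \<noteq> None \<and>
      L = [] \<and> result (run \<delta> x c t) = Some (out f') \<and> ct (run \<delta> x c t) = ct c'"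
    if "st c = 0" "result c = None" "(sstep x ^^ t) ([p], f0, c) = (L, f', c')" for x c t f' c' L
    using that(3)
  proof (induction t arbitrary: L f' c')
    case 0
    then show ?case using that(1,2) e_start s0S by auto
  next
    case (Suc t)
    obtain L0 f1 c1 where 1: "(sstep x ^^ t) ([p], f0, c) = (L0, f1, c1)" by (metis prod_cases3)
    then have 2: "sstep x (L0, f1, c1) = (L, f', c')" using Suc.prems by simp
    from Suc.IH[OF 1] show ?case
    proof (elim disjE conjE)
      assume r: "run \<delta> x c t = c1\<lparr>st := e (L0, f1)\<rparr>" "(L0, f1) \<in> S" "result c1 = None"
      show ?thesis
      proof (cases "L0 = []")
        case True
        then show ?thesis using r 2 \<delta>_e by (simp add: run_Suc step_def)
      next
        case False
        obtain L' f'' a b di dw dc where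
          pd: "pdelta out (L0, f1) (rd x (ih c1)) (rd (wt c1) (wh c1)) (rd (ct c1) (ch c1)) = Inr ((L', f''), a, b, di, dw, dc)"
          and ss: "sstep x (L0, f1, c1) = (L', f'', upd x c1 a b di dw dc)"
          using sstep_pdelta_Inr[OF False] by blast
        have "(L', f'') \<in> S" using closedS[OF r(2) pd] .
        moreover have "run \<delta> x c (Suc t) = (upd x c1 a b di dw dc)\<lparr>st := e (L', f'')\<rparr>"
          using r pd by (simp add: run_Suc step_def \<delta>_e upd_def)
        ultimately show ?thesis using ss 2 r(3) by auto
      qed
    next
      assume r: "result (run \<delta> x c t) \<noteq> None" "L0 = []" "result (run \<delta> x c t) = Some (out f1)"
        "ct (run \<delta> x c t) = ct c1"
      then show ?thesis using 2 by (simp add: run_Suc step_def)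
    qed
  qed
  show ?thesis
  proof (rule that[OF valid])
    fix x c t f' c'
    assume h: "st c = 0" "result c = None" "(sstep x ^^ t) ([p], f0, c) = ([], f', c')"
    from sim[OF this] show "result (run \<delta> x c (Suc t)) = Some (out f') \<and> ct (run \<delta> x c (Suc t)) = ct c'"
      by (auto simp: run_Suc step_def \<delta>_e)
  qed
qed

lemma run_halted:
  assumes "result (run \<delta> x c t) \<noteq> None"
  shows "run \<delta> x c (t + j) = run \<delta> x c t"
  using assms by (induction j) (simp_all add: run_Suc step_def)

text \<open>A halted configuration never changes, so any halting time yields the same configuration
  as the least one.\<close>

lemma final_eq_run:
  assumes "result (run \<delta> x c t) \<noteq> None"
  shows "final \<delta> x c = run \<delta> x c t"
proof -
  let ?h = "halting_time \<delta> x c"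
  have "result (run \<delta> x c ?h) \<noteq> None" "?h \<le> t"
    unfolding halting_time_def using assms LeastI Least_le by (metis (mono_tags, lifting))+
  then show ?thesis using run_halted[of \<delta> x c ?h "t - ?h"] by (simp add: final_def)
qed

section \<open>Registers on the work tape\<close>

text \<open>The number of steps is chosen before the continuation \<open>K\<close>, so that
  statements about subprograms compose without mentioning the program around them.\<close>

definition reach :: "bool list \<Rightarrow> 'f com \<Rightarrow> 'f \<times> cfg \<Rightarrow> nat \<Rightarrow> 'f \<times> cfg \<Rightarrow> bool" where
  "reach x p s T s' \<longleftrightarrow> (\<exists>t\<le>T. \<forall>K. (sstep x ^^ t) (p # K, s) = (K, s'))"

fun tst :: "bool list \<Rightarrow> ('f \<Rightarrow> sym \<Rightarrow> sym \<Rightarrow> sym \<Rightarrow> bool) \<Rightarrow> 'f \<times> cfg \<Rightarrow> bool" where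
  "tst x t (f, c) = t f (rd x (ih c)) (rd (wt c) (wh c)) (rd (ct c) (ch c))"

lemma reach_mono: "reach x p s T s' \<Longrightarrow> T \<le> T' \<Longrightarrow> reach x p s T' s'"
  unfolding reach_def using order_trans by blast

lemma sstep_pow_trans:
  "(sstep x ^^ t1) a = b \<Longrightarrow> (sstep x ^^ t2) b = c \<Longrightarrow> (sstep x ^^ (t2 + t1)) a = c"
  by (simp add: funpow_add)

lemma reach_Act:
  assumes "g f (rd x (ih c)) (rd (wt c) (wh c)) (rd (ct c) (ch c)) = (f', a, b, di, dw, dc)"
    and "c' = upd x c a b di dw dc"
  shows "reach x (Act g) (f, c) 1 (f', c')"
  unfolding reach_def by (rule exI[of _ 1]) (simp add: assms)

lemma reach_Seq:
  assumes "reach x p s T1 s1" "reach x q s1 T2 s2"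
  shows "reach x (p ;; q) s (T1 + T2 + 1) s2"
proof -
  obtain t1 t2 where 1: "t1 \<le> T1" "\<And>K. (sstep x ^^ t1) (p # K, s) = (K, s1)"
    and 2: "t2 \<le> T2" "\<And>K. (sstep x ^^ t2) (q # K, s1) = (K, s2)"
    using assms unfolding reach_def by blast
  have "(sstep x ^^ ((t2 + t1) + 1)) ((p ;; q) # K, s) = (K, s2)" for K
    by (rule sstep_pow_trans[of 1 _ _ "(p # q # K, s)"]) (simp_all add: funpow_add 1 2)
  then show ?thesis unfolding reach_def using 1 2 by (intro exI[of _ "(t2 + t1) + 1"]) auto
qed

lemma reach_Cond:
  assumes "reach x (if tst x t s then p else q) s T s'"
  shows "reach x (Cond t p q) s (T + 1) s'"
proof -
  obtain t1 where 1: "t1 \<le> T" "\<And>K. (sstep x ^^ t1) ((if tst x t s then p else q) # K, s) = (K, s')"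
    using assms unfolding reach_def by blast
  have "(sstep x ^^ (t1 + 1)) (Cond t p q # K, s) = (K, s')" for K
    using 1(2)[of K] sstep_pow_trans[of 1 x "(Cond t p q # K, s)" "((if tst x t s then p else q) # K, s)"]
    by (cases s) simp
  then show ?thesis unfolding reach_def using 1 by (intro exI[of _ "t1 + 1"]) auto
qed

lemma reach_Loop_False:
  assumes "\<not> tst x t s"
  shows "reach x (Loop t p) s 1 s"
  unfolding reach_def by (rule exI[of _ 1]) (use assms in \<open>cases s; simp\<close>)

lemma reach_Loop_True:
  assumes "tst x t s" "reach x p s T1 s1" "reach x (Loop t p) s1 T2 s2"
  shows "reach x (Loop t p) s (T1 + T2 + 1) s2"
proof -
  obtain t1 t2 where 1: "t1 \<le> T1" "\<And>K. (sstep x ^^ t1) (p # K, s) = (K, s1)"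
    and 2: "t2 \<le> T2" "\<And>K. (sstep x ^^ t2) (Loop t p # K, s1) = (K, s2)"
    using assms unfolding reach_def by blast
  have "(sstep x ^^ ((t2 + t1) + 1)) (Loop t p # K, s) = (K, s2)" for K
  proof (rule sstep_pow_trans[of 1 _ _ "(p # Loop t p # K, s)"])
    show "(sstep x ^^ 1) (Loop t p # K, s) = (p # Loop t p # K, s)" using assms(1) by (cases s) simp
    show "(sstep x ^^ (t2 + t1)) (p # Loop t p # K, s) = (K, s2)" by (simp add: funpow_add 1 2)
  qed
  then show ?thesis unfolding reach_def using 1 2 by (intro exI[of _ "(t2 + t1) + 1"]) auto
qed

definition Skip :: "'f com" where
  "Skip = Act (\<lambda>f a b c. (f, keep b, keep c, Stay, Stay, Stay))"

lemma reach_Skip: "reach x Skip (f, c) 1 (f, c)"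
  unfolding Skip_def by (rule reach_Act) auto

primrec repc :: "nat \<Rightarrow> 'f com \<Rightarrow> 'f com" where
  "repc 0 p = Skip"
| "repc (Suc n) p = p ;; repc n p"

lemma closed_Skip [simp]: "closed_flags F Skip"
  by (simp add: Skip_def)

lemma closed_repc [simp]: "closed_flags F p \<Longrightarrow> closed_flags F (repc n p)"
  by (induction n) simp_all

text \<open>The components are the stop flag of a sweep, a buffer for one column, the transducer
  state and the control of the application program.\<close>

type_synonym 'u sf = "bool \<times> bool list \<times> nat \<times> 'u"

definition nregs :: nat where "nregs = 24"
definition clen :: nat where "clen = Suc nregs"

lemma wh_idem: "wh c = n \<Longrightarrow> c\<lparr>wh := n\<rparr> = c"
  by (cases c) simp

lemma wt_wh_idem: "wt c = v \<Longrightarrow> wh c = n \<Longrightarrow> c\<lparr>wt := v, wh := n\<rparr> = c"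
  by (cases c) simp

lemma wr_append [simp]: "wr (pre @ y # post) (Suc (length pre)) b = pre @ b # post"
  by (simp add: wr_def)

lemma rd_append [simp]: "rd (pre @ y # post) (Suc (length pre)) = Some y"
  by (simp add: rd_def)

lemma keep_Some [simp]: "keep (Some b) = b"
  by (simp add: keep_def)

section \<open>Sweeps of a finite transducer over the columns of the work tape\<close>

definition read_bit :: "'u sf com" where
  "read_bit = Act (\<lambda>(s, buf, h, u) a b c. ((s, take clen (buf @ [keep b]), h, u), keep b, keep c, Stay, Rgt, Stay))"

definition step_left :: "'u sf com" where
  "step_left = Act (\<lambda>f a b c. (f, keep b, keep c, Stay, Lft, Stay))"

definition write_bit :: "'u sf com" where
  "write_bit = Act (\<lambda>(s, buf, h, u) a b c. ((s, tl buf, h, u), hd buf, keep c, Stay, Rgt, Stay))"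

type_synonym transducer = "nat \<Rightarrow> (nat \<Rightarrow> bool) \<Rightarrow> nat \<times> (nat \<Rightarrow> bool)"

fun comp_col :: "transducer \<Rightarrow> (nat \<Rightarrow> bool) \<Rightarrow> 'u sf \<Rightarrow> 'u sf" where
  "comp_col h qz (s, buf, k, u) =
     (if hd buf \<or> \<not> qz k then
        (case h k (\<lambda>j. j < nregs \<and> buf ! Suc j) of (k', w) \<Rightarrow> (False, True # map w [0..<nregs], k', u))
      else (True, buf, k, u))"

definition eval_column :: "transducer \<Rightarrow> (nat \<Rightarrow> bool) \<Rightarrow> 'u sf com" where
  "eval_column h qz = Act (\<lambda>f a b c. (comp_col h qz f, keep b, keep c, Stay, Stay, Stay))"

definition column :: "transducer \<Rightarrow> (nat \<Rightarrow> bool) \<Rightarrow> 'u sf com" where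
  "column h qz = repc clen read_bit ;; repc clen step_left ;; eval_column h qz ;; repc clen write_bit"

text \<open>Columns are taken into use on demand: a sweep ends at the first unused column at which the
  transducer is quiescent (\<open>qz\<close>).  Its cost thus depends on the register contents and not on the
  length of the tape, which in \<^const>\<open>P_class\<close> already exhausts the time bound.\<close>

definition sweep :: "transducer \<Rightarrow> (nat \<Rightarrow> bool) \<Rightarrow> nat \<Rightarrow> 'u sf com" where
  "sweep h qz s0 =
     Act (\<lambda>(s, buf, k, u) a b c. ((False, [], s0, u), keep b, keep c, Stay, Rgt, Stay)) ;;
     Loop (\<lambda>(s, _) a b c. \<not> s) (column h qz) ;;
     step_left ;; Loop (\<lambda>f a b c. b \<noteq> None) step_left"

lemma reach_read_bit:
  assumes "wt c = pre @ bs @ post" "wh c = length pre + 1" "length buf + length bs \<le> clen"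
  shows "reach x (repc (length bs) read_bit) ((s, buf, h, u), c) (2 * length bs + 1)
           ((s, buf @ bs, h, u), c\<lparr>wh := length pre + length bs + 1\<rparr>)"
  using assms
proof (induction bs arbitrary: pre buf c)
  case Nil
  then show ?case using reach_Skip[of x _ c] by (simp add: wh_idem)
next
  case (Cons b bs)
  let ?c = "c\<lparr>wh := length pre + 2\<rparr>"
  have 1: "reach x read_bit ((s, buf, h, u), c) 1 ((s, buf @ [b], h, u), ?c)"
    unfolding read_bit_def
    by (rule reach_Act, use Cons.prems in \<open>simp\<close>)
      (use Cons.prems in \<open>cases c; auto simp: upd_def mv_def\<close>)
  have 2: "reach x (repc (length bs) read_bit) ((s, buf @ [b], h, u), ?c) (2 * length bs + 1)
     ((s, (buf @ [b]) @ bs, h, u), ?c\<lparr>wh := length (pre @ [b]) + length bs + 1\<rparr>)"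
    by (rule Cons.IH) (use Cons.prems in auto)
  show ?case using reach_Seq[OF 1 2] by simp
qed

lemma reach_write_bit:
  assumes "wt c = pre @ old @ post" "wh c = length pre + 1" "length old = length bs"
  shows "reach x (repc (length bs) write_bit) ((s, bs, h, u), c) (2 * length bs + 1)
           ((s, [], h, u), c\<lparr>wt := pre @ bs @ post, wh := length pre + length bs + 1\<rparr>)"
  using assms
proof (induction bs arbitrary: pre old c)
  case Nil
  then have "c\<lparr>wt := pre @ [] @ post, wh := length pre + length [] + 1\<rparr> = c" by (simp add: wt_wh_idem)
  then show ?case using reach_Skip[of x _ c] by simp
next
  case (Cons b bs)
  obtain o1 old' where o: "old = o1 # old'" "length old' = length bs" using Cons.prems by (cases old) auto
  let ?c = "c\<lparr>wt := (pre @ [b]) @ old' @ post, wh := length pre + 2\<rparr>"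
  have 1: "reach x write_bit ((s, b # bs, h, u), c) 1 ((s, bs, h, u), ?c)"
    unfolding write_bit_def
    by (rule reach_Act) (use Cons.prems o in \<open>auto simp: upd_def mv_def\<close>)
  have 2: "reach x (repc (length bs) write_bit) ((s, bs, h, u), ?c) (2 * length bs + 1)
     ((s, [], h, u), ?c\<lparr>wt := (pre @ [b]) @ bs @ post, wh := length (pre @ [b]) + length bs + 1\<rparr>)"
    by (rule Cons.IH[of _ "pre @ [b]" old']) (use Cons.prems o in auto)
  show ?case using reach_Seq[OF 1 2] by simp
qed

lemma reach_BK1: "reach x step_left (f, c) 1 (f, c\<lparr>wh := wh c - 1\<rparr>)"
  unfolding step_left_def by (rule reach_Act) (auto simp: upd_def mv_def)

lemma reach_step_left: "reach x (repc n step_left) (f, c) (2 * n + 1) (f, c\<lparr>wh := wh c - n\<rparr>)"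
proof (induction n arbitrary: c)
  case 0
  then show ?case using reach_Skip[of x f c] by (simp add: wh_idem)
next
  case (Suc n)
  show ?case using reach_Seq[OF reach_BK1 Suc.IH[of "c\<lparr>wh := wh c - 1\<rparr>"]] by simp
qed

lemma reach_rewind:
  assumes "wh c \<le> length (wt c)"
  shows "reach x (Loop (\<lambda>f a b c. b \<noteq> None) step_left) (f, c) (2 * wh c + 1) (f, c\<lparr>wh := 0\<rparr>)"
  using assms
proof (induction "wh c" arbitrary: c)
  case 0
  then show ?case using reach_Loop_False[of x "\<lambda>f a b c. b \<noteq> None" "(f, c)" step_left]
    by (simp add: rd_def wh_idem)
next
  case (Suc n)
  let ?c = "c\<lparr>wh := wh c - 1\<rparr>"
  have "reach x (Loop (\<lambda>f a b c. b \<noteq> None) step_left) (f, ?c) (2 * wh ?c + 1) (f, ?c\<lparr>wh := 0\<rparr>)"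
    by (rule Suc.hyps(1)) (use Suc in auto)
  moreover have "tst x (\<lambda>f a b c. b \<noteq> None) (f, c)" using Suc by (auto simp: rd_def)
  ultimately have "reach x (Loop (\<lambda>f a b c. b \<noteq> None) step_left) (f, c) (1 + (2 * wh ?c + 1) + 1) (f, ?c\<lparr>wh := 0\<rparr>)"
    by (intro reach_Loop_True[OF _ reach_BK1])
  moreover have "1 + (2 * wh ?c + 1) + 1 \<le> 2 * wh c + 1" using Suc.hyps(2) by simp
  ultimately have "reach x (Loop (\<lambda>f a b c. b \<noteq> None) step_left) (f, c) (2 * wh c + 1) (f, ?c\<lparr>wh := 0\<rparr>)"
    by (rule reach_mono)
  then show ?case by simp
qed

text \<open>Registers are stored bit-serially, least significant bits first: a column holds a flag
  telling that the column is in use, followed by one bit of each register.\<close>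

definition bits_col :: "(nat \<Rightarrow> nat) \<Rightarrow> bool list" where
  "bits_col \<rho> = True # map (\<lambda>j. odd (\<rho> j)) [0..<nregs]"

primrec encode :: "nat \<Rightarrow> (nat \<Rightarrow> nat) \<Rightarrow> bool list" where
  "encode 0 \<rho> = []"
| "encode (Suc n) \<rho> = bits_col \<rho> @ encode n (\<lambda>j. \<rho> j div 2)"

text \<open>\<open>J s \<rho> \<rho>' f\<close> is to say that from state \<open>s\<close> the
  columns still to come turn the values \<open>\<rho>\<close> into \<open>\<rho>'\<close> and end in
  state \<open>f\<close>; passing one column halves all values. The last clause concerns the moment
  when no input bits are left: either the transducer is quiescent and done, or some result is still
  nonzero. A bound on the results thus bounds the number of fresh columns.\<close>

definition bit_serial :: "transducer \<Rightarrow> (nat \<Rightarrow> bool) \<Rightarrow>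
    (nat \<Rightarrow> (nat \<Rightarrow> nat) \<Rightarrow> (nat \<Rightarrow> nat) \<Rightarrow> nat \<Rightarrow> bool) \<Rightarrow> bool" where
  "bit_serial h qz J \<longleftrightarrow> (\<forall>s \<rho> \<rho>' f. J s \<rho> \<rho>' f \<longrightarrow>
     (case h s (\<lambda>j. j < nregs \<and> odd (\<rho> j)) of (s1, w) \<Rightarrow>
        (\<forall>j<nregs. w j = odd (\<rho>' j)) \<and> J s1 (\<lambda>j. \<rho> j div 2) (\<lambda>j. \<rho>' j div 2) f) \<and>
     ((\<forall>j<nregs. \<rho> j = 0) \<longrightarrow>
        (if qz s then (\<forall>j<nregs. \<rho>' j = 0) \<and> f = s else (\<exists>j<nregs. \<rho>' j \<noteq> 0))))"

lemma length_bits_col [simp]: "length (bits_col \<rho>) = clen"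
  by (simp add: bits_col_def clen_def)

lemma length_encode [simp]: "length (encode U \<rho>) = clen * U"
  by (induction U arbitrary: \<rho>) simp_all

lemma reach_column:
  assumes "wt c = pre @ bs @ post" "wh c = length pre + 1" "length bs = clen"
    and "comp_col h qz (False, bs, k, u) = (s', bs', k', u)" "length bs' = clen"
  shows "reach x (column h qz) ((False, [], k, u), c) (6 * clen + 7)
           ((s', [], k', u), c\<lparr>wt := pre @ bs' @ post, wh := length pre + clen + 1\<rparr>)"
proof -
  let ?c1 = "c\<lparr>wh := length pre + length bs + 1\<rparr>"
  have 1: "reach x (repc clen read_bit) ((False, [], k, u), c) (2 * clen + 1) ((False, bs, k, u), ?c1)"
    using reach_read_bit[of c pre bs post "[]"] assms by simp
  have 2: "reach x (repc clen step_left) ((False, bs, k, u), ?c1) (2 * clen + 1) ((False, bs, k, u), c)"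
    using reach_step_left[of x clen "(False, bs, k, u)" ?c1] assms by (simp add: wh_idem)
  have 3: "reach x (eval_column h qz) ((False, bs, k, u), c) 1 ((s', bs', k', u), c)"
    unfolding eval_column_def by (rule reach_Act[OF _ upd_keep[symmetric]]) (simp add: assms(4) del: comp_col.simps)
  have 4: "reach x (repc clen write_bit) ((s', bs', k', u), c) (2 * clen + 1)
      ((s', [], k', u), c\<lparr>wt := pre @ bs' @ post, wh := length pre + clen + 1\<rparr>)"
    using reach_write_bit[of c pre bs post bs'] assms by simp
  show ?thesis
    unfolding column_def
    by (rule reach_mono[OF reach_Seq[OF 1 reach_Seq[OF 2 reach_Seq[OF 3 4]]]]) simp
qed

text \<open>Induction on \<open>Y\<close>, a bound on the bit lengths of the results: each column
  passed halves \<open>\<rho>'\<close>, so fewer than \<open>Y + 1\<close> columns are rewritten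
  before the one at which the sweep stops. \<open>U\<close> counts the columns in use before the
  sweep, \<open>U'\<close> after it.\<close>

lemma reach_columns:
  assumes bs: "bit_serial h qz J"
  shows "J s \<rho> \<rho>' f \<Longrightarrow> U \<le> Y \<Longrightarrow> \<forall>j<nregs. \<rho> j < 2 ^ U \<Longrightarrow> \<forall>j<nregs. \<rho>' j < 2 ^ Y \<Longrightarrow>
    wt c = pre @ encode U \<rho> @ replicate z False \<Longrightarrow> clen * (Y + 1) \<le> clen * U + z \<Longrightarrow> wh c = length pre + 1 \<Longrightarrow>
    \<exists>U' z'. U' \<le> Y \<and> clen * U' + z' = clen * U + z \<and> (\<forall>j<nregs. \<rho>' j < 2 ^ U') \<and>
      reach x (Loop (\<lambda>(s, _) a b c. \<not> s) (column h qz)) ((False, [], s, u), c) ((Y + 1) * (6 * clen + 8) + 1)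
       ((True, [], f, u), c\<lparr>wt := pre @ encode U' \<rho>' @ replicate z' False, wh := length pre + clen * (U' + 1) + 1\<rparr>)"
proof (induction Y arbitrary: s \<rho> \<rho>' U c pre z)
  case 0
  then have U: "U = 0" and \<rho>: "\<forall>j<nregs. \<rho> j = 0" "\<forall>j<nregs. \<rho>' j = 0" by auto
  have "if qz s then (\<forall>j<nregs. \<rho>' j = 0) \<and> f = s else (\<exists>j<nregs. \<rho>' j \<noteq> 0)"
    using bs 0(1) \<rho>(1) unfolding bit_serial_def by blast
  \<comment> \<open>All results are zero here, so the clause on vanishing registers leaves only the
    quiescent case.\<close>
  then have q: "qz s" "f = s" using \<rho>(2) by (auto split: if_splits)
  obtain z0 where z0: "z = clen + z0" using 0(6) U le_Suc_ex by auto
  let ?bs = "replicate clen False"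
  have c1: "reach x (column h qz) ((False, [], s, u), c) (6 * clen + 7)
           ((True, [], s, u), c\<lparr>wt := pre @ ?bs @ replicate z0 False, wh := length pre + clen + 1\<rparr>)"
    by (rule reach_column) (use 0 U q in \<open>auto simp: z0 replicate_add clen_def\<close>)
  have e: "pre @ ?bs @ replicate z0 False = pre @ replicate z False" by (simp add: z0 replicate_add)
  have "reach x (Loop (\<lambda>(s, _) a b c. \<not> s) (column h qz)) ((False, [], s, u), c) (6 * clen + 7 + 1 + 1)
     ((True, [], s, u), c\<lparr>wt := pre @ replicate z False, wh := length pre + clen + 1\<rparr>)"
    by (rule reach_Loop_True[OF _ c1[unfolded e] reach_Loop_False]) auto
  then show ?case using U q \<rho> by (intro exI[of _ 0] exI[of _ z]) (auto elim!: reach_mono)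
next
  case (Suc Y)
  have J: "case h s (\<lambda>j. j < nregs \<and> odd (\<rho> j)) of (s1, w) \<Rightarrow>
        (\<forall>j<nregs. w j = odd (\<rho>' j)) \<and> J s1 (\<lambda>j. \<rho> j div 2) (\<lambda>j. \<rho>' j div 2) f"
    and Jz: "(\<forall>j<nregs. \<rho> j = 0) \<Longrightarrow>
        (if qz s then (\<forall>j<nregs. \<rho>' j = 0) \<and> f = s else (\<exists>j<nregs. \<rho>' j \<noteq> 0))"
    using bs[unfolded bit_serial_def, rule_format, OF Suc.prems(1)] by auto
  show ?case
  proof (cases "U = 0 \<and> qz s")
    case True
    then have \<rho>: "\<forall>j<nregs. \<rho> j = 0" using Suc.prems by auto
    have q: "f = s" "\<forall>j<nregs. \<rho>' j = 0" using Jz \<rho> True by auto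
    obtain z0 where z0: "z = clen + z0" using Suc.prems(6) True le_Suc_ex[of clen z] by auto
    let ?bs = "replicate clen False"
    have c1: "reach x (column h qz) ((False, [], s, u), c) (6 * clen + 7)
             ((True, [], s, u), c\<lparr>wt := pre @ ?bs @ replicate z0 False, wh := length pre + clen + 1\<rparr>)"
      by (rule reach_column) (use Suc.prems True q in \<open>auto simp: z0 replicate_add clen_def\<close>)
    have e: "pre @ ?bs @ replicate z0 False = pre @ replicate z False" by (simp add: z0 replicate_add)
    have "reach x (Loop (\<lambda>(s, _) a b c. \<not> s) (column h qz)) ((False, [], s, u), c) (6 * clen + 7 + 1 + 1)
       ((True, [], s, u), c\<lparr>wt := pre @ replicate z False, wh := length pre + clen + 1\<rparr>)"
      by (rule reach_Loop_True[OF _ c1[unfolded e] reach_Loop_False]) auto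
    then show ?thesis using True q by (intro exI[of _ 0] exI[of _ z]) (auto elim!: reach_mono)
  next
    case False
    obtain s1 w where w: "h s (\<lambda>j. j < nregs \<and> odd (\<rho> j)) = (s1, w)" by force
    have wj: "\<And>j. j < nregs \<Longrightarrow> w j = odd (\<rho>' j)" and J1: "J s1 (\<lambda>j. \<rho> j div 2) (\<lambda>j. \<rho>' j div 2) f"
      using J w by auto
    have col: "True # map w [0..<nregs] = bits_col \<rho>'" using wj by (simp add: bits_col_def)
    define \<rho>2 where "\<rho>2 = (\<lambda>j. \<rho> j div 2)"
    \<comment> \<open>Used and fresh columns are treated alike from here on. If no column is in use,
      the next one is split off the zeros of the tape and reads as a zero bit of every
      register.\<close>
    obtain bs z0 where bs0: "encode U \<rho> @ replicate z False = bs @ encode (U - 1) \<rho>2 @ replicate z0 False"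
      and lbs: "length bs = clen" and zz: "clen * U + z = clen + clen * (U - 1) + z0"
      and hdbs: "U = 0 \<Longrightarrow> \<not> hd bs" "U \<noteq> 0 \<Longrightarrow> hd bs" and bsj: "\<And>j. j < nregs \<Longrightarrow> bs ! Suc j = odd (\<rho> j)"
    proof (cases U)
      case 0
      obtain z0 where z0: "z = clen + z0" using Suc.prems(6) 0 le_Suc_ex[of clen z] by auto
      show ?thesis
        by (rule that[of "replicate clen False" z0])
          (use 0 Suc.prems(3) in \<open>auto simp: z0 replicate_add clen_def\<close>)
    next
      case (Suc U0)
      show ?thesis
        by (rule that[of "bits_col \<rho>" z]) (use Suc in \<open>auto simp: \<rho>2_def bits_col_def clen_def\<close>)
    qed
    have e1: "(\<lambda>j. j < nregs \<and> bs ! Suc j) = (\<lambda>j. j < nregs \<and> odd (\<rho> j))" using bsj by auto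
    let ?c = "c\<lparr>wt := pre @ bits_col \<rho>' @ encode (U - 1) \<rho>2 @ replicate z0 False, wh := length pre + clen + 1\<rparr>"
    have c1: "reach x (column h qz) ((False, [], s, u), c) (6 * clen + 7) ((False, [], s1, u), ?c)"
      by (rule reach_column)
        (use Suc.prems bs0 lbs hdbs False e1 w col in \<open>auto\<close>)
    have "\<exists>U' z'. U' \<le> Y \<and> clen * U' + z' = clen * (U - 1) + z0 \<and> (\<forall>j<nregs. \<rho>' j div 2 < 2 ^ U') \<and>
      reach x (Loop (\<lambda>(s, _) a b c. \<not> s) (column h qz)) ((False, [], s1, u), ?c) ((Y + 1) * (6 * clen + 8) + 1)
       ((True, [], f, u), ?c\<lparr>wt := (pre @ bits_col \<rho>') @ encode U' (\<lambda>j. \<rho>' j div 2) @ replicate z' False,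
           wh := length (pre @ bits_col \<rho>') + clen * (U' + 1) + 1\<rparr>)"
    proof (rule Suc.IH)
      show "J s1 \<rho>2 (\<lambda>j. \<rho>' j div 2) f" using J1 by (simp add: \<rho>2_def)
      show "U - 1 \<le> Y" using Suc.prems by simp
      show "\<forall>j<nregs. \<rho>2 j < 2 ^ (U - 1)" using Suc.prems(3) by (cases U) (auto simp: \<rho>2_def)
      show "\<forall>j<nregs. \<rho>' j div 2 < 2 ^ Y" using Suc.prems(4) by auto
      show "wt ?c = (pre @ bits_col \<rho>') @ encode (U - 1) \<rho>2 @ replicate z0 False" by simp
      show "clen * (Y + 1) \<le> clen * (U - 1) + z0" using Suc.prems(6) zz by simp
      show "wh ?c = length (pre @ bits_col \<rho>') + 1" by simp
    qed
    then obtain U' z' where IH: "U' \<le> Y" "clen * U' + z' = clen * (U - 1) + z0"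
      "\<forall>j<nregs. \<rho>' j div 2 < 2 ^ U'"
      "reach x (Loop (\<lambda>(s, _) a b c. \<not> s) (column h qz)) ((False, [], s1, u), ?c) ((Y + 1) * (6 * clen + 8) + 1)
       ((True, [], f, u), ?c\<lparr>wt := (pre @ bits_col \<rho>') @ encode U' (\<lambda>j. \<rho>' j div 2) @ replicate z' False,
           wh := length (pre @ bits_col \<rho>') + clen * (U' + 1) + 1\<rparr>)" by blast
    have "reach x (Loop (\<lambda>(s, _) a b c. \<not> s) (column h qz)) ((False, [], s, u), c)
       ((6 * clen + 7) + ((Y + 1) * (6 * clen + 8) + 1) + 1)
       ((True, [], f, u), ?c\<lparr>wt := (pre @ bits_col \<rho>') @ encode U' (\<lambda>j. \<rho>' j div 2) @ replicate z' False,
           wh := length (pre @ bits_col \<rho>') + clen * (U' + 1) + 1\<rparr>)"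
      by (rule reach_Loop_True[OF _ c1 IH(4)]) simp
    then have "reach x (Loop (\<lambda>(s, _) a b c. \<not> s) (column h qz)) ((False, [], s, u), c)
       ((Suc Y + 1) * (6 * clen + 8) + 1)
       ((True, [], f, u), c\<lparr>wt := pre @ encode (Suc U') \<rho>' @ replicate z' False,
           wh := length pre + clen * (Suc U' + 1) + 1\<rparr>)"
      by (simp add: algebra_simps)
    moreover have "\<forall>j<nregs. \<rho>' j < 2 ^ Suc U'"
      using IH(3) by (auto simp: div_less_iff_less_mult mult.commute)
    moreover have "clen * Suc U' + z' = clen * U + z" using IH(2) zz by simp
    ultimately show ?thesis using IH(1) by (intro exI[of _ "Suc U'"] exI[of _ z']) auto
  qed
qed

section \<open>Total correctness with time bounds, stated on abstract register contents\<close>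

record 'u ast =
  hs :: nat
  us :: 'u
  rg :: "nat \<Rightarrow> nat"
  ip :: nat
  cp :: nat
  cc :: "bool list"

text \<open>There is room for \<open>X + 1\<close> columns: at most \<open>X\<close> in use and one
  more at which a sweep can stop. Between operations the work head rests on the left endmarker and
  the buffer is empty.\<close>

definition rep :: "nat \<Rightarrow> 'u ast \<Rightarrow> 'u sf \<times> cfg \<Rightarrow> bool" where
  "rep X a = (\<lambda>(f, c). \<exists>stop U z. f = (stop, [], hs a, us a) \<and> wt c = encode U (rg a) @ replicate z False \<and>
     clen * (X + 1) \<le> clen * U + z \<and> U \<le> X \<and> (\<forall>j<nregs. rg a j < 2 ^ U) \<and>
     wh c = 0 \<and> ih c = ip a \<and> ch c = cp a \<and> ct c = cc a)"

definition bounded_regs :: "nat \<Rightarrow> 'u ast \<Rightarrow> bool" where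
  "bounded_regs X a \<longleftrightarrow> (\<forall>j<nregs. rg a j < 2 ^ X)"

text \<open>A precondition in the sense of total correctness. The postcondition speaks of abstract
  states only, so the treatment of a sequence nests one \<open>wp\<close> inside the postcondition
  of another.\<close>

definition wp :: "bool list \<Rightarrow> nat \<Rightarrow> 'u sf com \<Rightarrow> nat \<Rightarrow> ('u ast \<Rightarrow> bool) \<Rightarrow> 'u ast \<Rightarrow> bool" where
  "wp x X p T Q a \<longleftrightarrow> (\<forall>s. rep X a s \<longrightarrow> (\<exists>a' s'. Q a' \<and> rep X a' s' \<and> reach x p s T s'))"

text \<open>A column costs \<open>6 * clen + 8\<close> steps on the way out and
  \<open>2 * clen\<close> on the way back; the factor is rounded up to absorb the constant
  overhead.\<close>

definition sweep_time :: "nat \<Rightarrow> nat" where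
  "sweep_time X = (X + 2) * (10 * clen + 30)"

lemma rep_bounded: "rep X a s \<Longrightarrow> bounded_regs X a"
  unfolding rep_def bounded_regs_def
  by (auto intro: less_le_trans[OF _ power_increasing])

text \<open>A state with a register of more than \<open>X\<close> bits has no concrete
  representation, so bounds on the registers come for free wherever an overflow has to be
  excluded.\<close>

lemma wp_bounded: "(bounded_regs X a \<Longrightarrow> wp x X p T Q a) \<Longrightarrow> wp x X p T Q a"
  unfolding wp_def using rep_bounded by blast

lemma wp_sweep:
  assumes bs: "bit_serial h qz J"
    and J: "bounded_regs X a \<Longrightarrow> J s0 (rg a) \<rho>' f"
    and b: "bounded_regs X a \<Longrightarrow> \<forall>j<nregs. \<rho>' j < 2 ^ X"
    and Q: "bounded_regs X a \<Longrightarrow> Q (a\<lparr>hs := f, rg := \<rho>'\<rparr>)"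
  shows "wp x X (sweep h qz s0) (sweep_time X) Q a"
  unfolding wp_def
proof (intro allI impI)
  fix s :: "'a sf \<times> cfg"
  assume r: "rep X a s"
  note J = J[OF rep_bounded[OF r]] and b = b[OF rep_bounded[OF r]] and Q = Q[OF rep_bounded[OF r]]
  obtain stop U z c where s: "s = ((stop, [], hs a, us a), c)" "wt c = encode U (rg a) @ replicate z False"
    "clen * (X + 1) \<le> clen * U + z" "U \<le> X" "\<forall>j<nregs. rg a j < 2 ^ U"
    "wh c = 0" "ih c = ip a" "ch c = cp a" "ct c = cc a"
    using r by (cases s) (auto simp: rep_def)
  let ?c1 = "c\<lparr>wh := 1\<rparr>"
  have 1: "reach x (Act (\<lambda>(s, buf, k, u) a b c. ((False, [], s0, u), keep b, keep c, Stay, Rgt, Stay))) s 1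
     ((False, [], s0, us a), ?c1)"
    unfolding s(1) by (rule reach_Act) (use s in \<open>auto simp: upd_def mv_def\<close>)
  obtain U' z' where 2: "U' \<le> X" "clen * U' + z' = clen * U + z" "\<forall>j<nregs. \<rho>' j < 2 ^ U'"
      "reach x (Loop (\<lambda>(s, _) a b c. \<not> s) (column h qz)) ((False, [], s0, us a), ?c1) ((X + 1) * (6 * clen + 8) + 1)
       ((True, [], f, us a), ?c1\<lparr>wt := [] @ encode U' \<rho>' @ replicate z' False, wh := length ([]::bool list) + clen * (U' + 1) + 1\<rparr>)"
    using reach_columns[OF bs J s(4,5) b, of ?c1 "[]" z x "us a"] s by auto
  let ?c2 = "?c1\<lparr>wt := encode U' \<rho>' @ replicate z' False, wh := clen * (U' + 1) + 1\<rparr>"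
  let ?c3 = "?c2\<lparr>wh := clen * (U' + 1)\<rparr>"
  let ?F = "(True, [], f, us a)"
  \<comment> \<open>The head may have come to stand on the right endmarker, where the rewinding loop
    would stop at once; one unconditional step to the left avoids this.\<close>
  have 3: "reach x step_left (?F, ?c2) 1 (?F, ?c3)"
    using reach_BK1[of x ?F ?c2] by simp
  have le: "clen * (U' + 1) \<le> clen * (X + 1)" using 2(1) by simp
  have 4: "reach x (Loop (\<lambda>f a b c. b \<noteq> None) step_left) (?F, ?c3) (2 * wh ?c3 + 1) (?F, ?c3\<lparr>wh := 0\<rparr>)"
  proof (rule reach_rewind)
    have "clen * (U' + 1) \<le> clen * U' + z'" using le 2(2) s(3) by linarith
    then show "wh ?c3 \<le> length (wt ?c3)" by simp
  qed
  have "reach x (sweep h qz s0) s (1 + ((X + 1) * (6 * clen + 8) + 1 + (1 + (2 * wh ?c3 + 1) + 1) + 1) + 1) (?F, ?c3\<lparr>wh := 0\<rparr>)"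
    unfolding sweep_def using reach_Seq[OF 1 reach_Seq[OF 2(4) reach_Seq[OF _ 4], of step_left 1]] 3 by simp
  moreover have "1 + ((X + 1) * (6 * clen + 8) + 1 + (1 + (2 * wh ?c3 + 1) + 1) + 1) + 1 \<le> sweep_time X"
  proof -
    have "wh ?c3 \<le> clen * (X + 1)" using le by (simp del: mult_le_cancel1)
    then have "1 + ((X + 1) * (6 * clen + 8) + 1 + (1 + (2 * wh ?c3 + 1) + 1) + 1) + 1
      \<le> 1 + ((X + 1) * (6 * clen + 8) + 1 + (1 + (2 * (clen * (X + 1)) + 1) + 1) + 1) + 1" by linarith
    also have "\<dots> \<le> sweep_time X" by (simp add: sweep_time_def algebra_simps)
    finally show ?thesis .
  qed
  ultimately have "reach x (sweep h qz s0) s (sweep_time X) (?F, ?c3\<lparr>wh := 0\<rparr>)"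
    by (rule reach_mono)
  moreover have "rep X (a\<lparr>hs := f, rg := \<rho>'\<rparr>) (?F, ?c3\<lparr>wh := 0\<rparr>)"
    unfolding rep_def prod.case
    by (rule exI[of _ True], rule exI[of _ U'], rule exI[of _ z']) (use s 2 in auto)
  ultimately show "\<exists>a' s'. Q a' \<and> rep X a' s' \<and> reach x (sweep h qz s0) s (sweep_time X) s'"
    using Q by blast
qed

text \<open>Transducer states are below 2: one carry, borrow or comparison bit suffices for every
  register operation.\<close>

definition flag_set :: "'u set \<Rightarrow> 'u sf set" where
  "flag_set UF = {(s, buf, k, u). length buf \<le> clen \<and> k < 2 \<and> u \<in> UF}"

lemma finite_flag_set:
  assumes "finite UF"
  shows "finite (flag_set UF)"
proof -
  have "finite {buf :: bool list. length buf \<le> clen}"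
    using finite_lists_length_le[of "UNIV :: bool set" clen] by simp
  then have "finite ((UNIV :: bool set) \<times> {buf :: bool list. length buf \<le> clen} \<times> {..<2::nat} \<times> UF)"
    using assms by (intro finite_cartesian_product) auto
  moreover have "flag_set UF = UNIV \<times> {buf. length buf \<le> clen} \<times> {..<2} \<times> UF"
    by (auto simp: flag_set_def)
  ultimately show ?thesis by (simp only:)
qed

lemma closed_sweep:
  assumes "\<And>k col. k < 2 \<Longrightarrow> fst (h k col) < 2" "s0 < 2"
  shows "closed_flags (flag_set UF) (sweep h qz s0)"
proof -
  have "closed_flags (flag_set UF) (eval_column h qz)"
    using assms by (auto simp: eval_column_def flag_set_def clen_def split: prod.splits) (metis fst_conv)+
  moreover have "closed_flags (flag_set UF) read_bit" "closed_flags (flag_set UF) step_left" "closed_flags (flag_set UF) write_bit"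
    by (auto simp: read_bit_def step_left_def write_bit_def flag_set_def)
  ultimately show ?thesis
    using assms(2) by (simp add: sweep_def column_def) (auto simp: flag_set_def)
qed

text \<open>An action away from the work tape: the work head is on the left endmarker, where
  \<open>keep b\<close> writes nothing.\<close>

definition uact :: "(nat \<Rightarrow> 'u \<Rightarrow> sym \<Rightarrow> sym \<Rightarrow> 'u \<times> bool \<times> dir \<times> dir) \<Rightarrow> 'u sf com" where
  "uact g = Act (\<lambda>(s, buf, k, u) a b c. case g k u a c of (u', v, di, dc) \<Rightarrow>
     ((s, buf, k, u'), keep b, v, di, Stay, dc))"

definition utest :: "(nat \<Rightarrow> 'u \<Rightarrow> sym \<Rightarrow> sym \<Rightarrow> bool) \<Rightarrow> 'u sf \<Rightarrow> sym \<Rightarrow> sym \<Rightarrow> sym \<Rightarrow> bool" where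
  "utest t = (\<lambda>(s, buf, k, u) a b c. t k u a c)"

lemma closed_uact:
  assumes "\<And>k u a c. k < 2 \<Longrightarrow> u \<in> UF \<Longrightarrow> fst (g k u a c) \<in> UF"
  shows "closed_flags (flag_set UF) (uact g)"
  using assms by (auto simp: uact_def flag_set_def split: prod.splits) (metis fst_conv)

lemma wp_mono:
  assumes "wp x X p T Q a" "T \<le> T'" "\<And>b. Q b \<Longrightarrow> Q' b"
  shows "wp x X p T' Q' a"
  using assms unfolding wp_def by (meson reach_mono)

lemma wp_weaken: "wp x X p T Q a \<Longrightarrow> T \<le> T' \<Longrightarrow> wp x X p T' Q a"
  using wp_mono by blast

lemma wp_Seq:
  assumes "wp x X p T1 (wp x X q T2 Q) a"
  shows "wp x X (p ;; q) (T1 + T2 + 1) Q a"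
  using assms unfolding wp_def by (meson reach_Seq)

lemma wp_uact:
  assumes "g (hs a) (us a) (rd x (ip a)) (rd (cc a) (cp a)) = (u', v, di, dc)"
    and "Q (a\<lparr>us := u', ip := mv (length x) (ip a) di, cc := wr (cc a) (cp a) v,
          cp := mv (length (cc a)) (cp a) dc\<rparr>)"
  shows "wp x X (uact g) 1 Q a"
  unfolding wp_def
proof (intro allI impI)
  fix s :: "'a sf \<times> cfg"
  assume r: "rep X a s"
  obtain stop U z c where s: "s = ((stop, [], hs a, us a), c)" "wt c = encode U (rg a) @ replicate z False"
    "clen * (X + 1) \<le> clen * U + z" "U \<le> X" "\<forall>j<nregs. rg a j < 2 ^ U"
    "wh c = 0" "ih c = ip a" "ch c = cp a" "ct c = cc a"
    using r by (cases s) (auto simp: rep_def)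
  let ?c = "upd x c (keep (rd (wt c) (wh c))) v di Stay dc"
  let ?a = "a\<lparr>us := u', ip := mv (length x) (ip a) di, cc := wr (cc a) (cp a) v,
          cp := mv (length (cc a)) (cp a) dc\<rparr>"
  have 1: "reach x (uact g) s 1 ((stop, [], hs a, u'), ?c)"
    unfolding s(1) uact_def by (rule reach_Act[OF _ refl]) (use assms(1) s in simp)
  have "rep X ?a ((stop, [], hs a, u'), ?c)"
    unfolding rep_def prod.case
    by (rule exI[of _ stop], rule exI[of _ U], rule exI[of _ z]) (use s in \<open>auto simp: upd_def\<close>)
  then show "\<exists>a' s'. Q a' \<and> rep X a' s' \<and> reach x (uact g) s 1 s'"
    using 1 assms(2) by blast
qed

definition uset :: "(nat \<Rightarrow> 'u \<Rightarrow> sym \<Rightarrow> sym \<Rightarrow> 'u) \<Rightarrow> 'u sf com" where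
  "uset g = uact (\<lambda>k u a c. (g k u a c, keep c, Stay, Stay))"

lemma closed_uset:
  assumes "\<And>k u a c. k < 2 \<Longrightarrow> u \<in> UF \<Longrightarrow> g k u a c \<in> UF"
  shows "closed_flags (flag_set UF) (uset g)"
  unfolding uset_def by (rule closed_uact) (simp add: assms)

lemma wp_uset:
  assumes "Q (a\<lparr>us := g (hs a) (us a) (rd x (ip a)) (rd (cc a) (cp a))\<rparr>)"
  shows "wp x X (uset g) 1 Q a"
  unfolding uset_def
  by (rule wp_uact[OF refl]) (use assms in \<open>cases a; simp\<close>)

lemma tst_utest:
  assumes "rep X a s"
  shows "tst x (utest t) s = t (hs a) (us a) (rd x (ip a)) (rd (cc a) (cp a))"
  using assms by (cases s) (auto simp: rep_def utest_def)

lemma wp_Cond: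
  assumes "wp x X (if t (hs a) (us a) (rd x (ip a)) (rd (cc a) (cp a)) then p else q) T Q a"
  shows "wp x X (Cond (utest t) p q) (T + 1) Q a"
  unfolding wp_def
proof (intro allI impI)
  fix s :: "'a sf \<times> cfg"
  assume r: "rep X a s"
  then obtain a' s' where q: "Q a'" "rep X a' s'"
    and c: "reach x (if t (hs a) (us a) (rd x (ip a)) (rd (cc a) (cp a)) then p else q) s T s'"
    using assms unfolding wp_def by blast
  have "reach x (Cond (utest t) p q) s (T + 1) s'"
    by (rule reach_Cond) (use c in \<open>simp add: tst_utest[OF r]\<close>)
  then show "\<exists>a' s'. Q a' \<and> rep X a' s' \<and> reach x (Cond (utest t) p q) s (T + 1) s'"
    using q by blast
qed

lemma wp_Loop_False:
  assumes "\<not> t (hs a) (us a) (rd x (ip a)) (rd (cc a) (cp a))" "Q a"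
  shows "wp x X (Loop (utest t) p) 1 Q a"
  using assms unfolding wp_def by (metis reach_Loop_False tst_utest)

lemma wp_Loop_True:
  assumes "t (hs a) (us a) (rd x (ip a)) (rd (cc a) (cp a))"
    and "wp x X p T1 (wp x X (Loop (utest t) p) T2 Q) a"
  shows "wp x X (Loop (utest t) p) (T1 + T2 + 1) Q a"
  using assms unfolding wp_def by (meson reach_Loop_True tst_utest)

lemma wp_Loop_count:
  assumes "I 0 a"
    and "\<And>i b. i < N \<Longrightarrow> I i b \<Longrightarrow> t (hs b) (us b) (rd x (ip b)) (rd (cc b) (cp b)) \<and> wp x X p T (I (Suc i)) b"
    and "\<And>b. I N b \<Longrightarrow> \<not> t (hs b) (us b) (rd x (ip b)) (rd (cc b) (cp b))"
  shows "wp x X (Loop (utest t) p) (N * (T + 1) + 1) (I N) a"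
proof -
  have "wp x X (Loop (utest t) p) (j * (T + 1) + 1) (I N) b" if "I (N - j) b" "j \<le> N" for j b
    using that
  proof (induction j arbitrary: b)
    case 0
    then show ?case using assms(3) wp_Loop_False[of t b x] by auto
  next
    case (Suc j)
    have e: "Suc (N - Suc j) = N - j" using Suc.prems by simp
    have "wp x X p T (wp x X (Loop (utest t) p) (j * (T + 1) + 1) (I N)) b"
      by (rule wp_mono[of _ _ _ _ "I (N - j)"]) (use assms(2)[of "N - Suc j" b] Suc e in auto)
    from wp_Loop_True[OF _ this] show ?case
      using assms(2)[of "N - Suc j" b] Suc.prems by (auto elim!: wp_mono)
  qed
  from this[of N] show ?thesis using assms(1) by simp
qed

lemma wp_Skip: "Q a \<Longrightarrow> wp x X Skip 1 Q a"
  unfolding wp_def using reach_Skip by (metis surj_pair)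

lemma wp_repc:
  assumes "I 0 a" and "\<And>i b. i < N \<Longrightarrow> I i b \<Longrightarrow> wp x X p T (I (Suc i)) b"
  shows "wp x X (repc N p) (N * (T + 1) + 1) (I N) a"
proof -
  have "wp x X (repc j p) (j * (T + 1) + 1) (I N) b" if "I (N - j) b" "j \<le> N" for j b
    using that
  proof (induction j arbitrary: b)
    case 0
    then show ?case using wp_Skip[of _ b] by simp
  next
    case (Suc j)
    have e: "Suc (N - Suc j) = N - j" using Suc.prems by simp
    have "wp x X p T (wp x X (repc j p) (j * (T + 1) + 1) (I N)) b"
      by (rule wp_mono[of _ _ _ _ "I (N - j)"]) (use assms(2)[of "N - Suc j" b] Suc e in auto)
    from wp_Seq[OF this] show ?case by (auto elim!: wp_mono)
  qed
  from this[of N] show ?thesis using assms(1) by simp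
qed

section \<open>Arithmetic, comparison and bit access by two-state transducers\<close>

definition ADD :: "nat \<Rightarrow> nat \<Rightarrow> 'u sf com" where
  "ADD i j = sweep (\<lambda>s col. let v = of_bool (col i) + of_bool (col j) + s in (v div 2, col(i := odd v)))
     (\<lambda>s. s = 0) 0"

definition INC :: "nat \<Rightarrow> 'u sf com" where
  "INC i = sweep (\<lambda>s col. let v = of_bool (col i) + s in (v div 2, col(i := odd v))) (\<lambda>s. s = 0) 1"

definition DEC :: "nat \<Rightarrow> 'u sf com" where
  "DEC i = sweep (\<lambda>s col. if s = 0 then (0, col) else (of_bool (\<not> col i), col(i := \<not> col i)))
     (\<lambda>s. s = 0) 1"

definition CLR :: "nat \<Rightarrow> 'u sf com" where
  "CLR i = sweep (\<lambda>s col. (s, col(i := False))) (\<lambda>s. True) 0"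

text \<open>Comparisons leave the registers alone and deliver their truth value as the final
  transducer state, which later tests see as \<open>hs\<close>.\<close>

definition EQ :: "nat \<Rightarrow> nat \<Rightarrow> 'u sf com" where
  "EQ i j = sweep (\<lambda>s col. (if col i = col j then s else 0, col)) (\<lambda>s. True) 1"

text \<open>Low bits come first, so the last column in which the registers differ decides; the
  initial state 1 stands for equality.\<close>

definition LE :: "nat \<Rightarrow> nat \<Rightarrow> 'u sf com" where
  "LE i j = sweep (\<lambda>s col. (if col i = col j then s else of_bool (col j), col)) (\<lambda>s. True) 1"

text \<open>Register \<open>h\<close> holds a power of two and thereby marks the column whose bit of
  \<open>w\<close> is wanted.\<close>

definition GETBIT :: "nat \<Rightarrow> nat \<Rightarrow> 'u sf com" where
  "GETBIT w h = sweep (\<lambda>s col. (if col h then of_bool (col w) else s, col)) (\<lambda>s. True) 0"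

definition SETBIT :: "nat \<Rightarrow> nat \<Rightarrow> bool \<Rightarrow> 'u sf com" where
  "SETBIT w h b = sweep (\<lambda>s col. (s, col(w := (if col h then b else col w)))) (\<lambda>s. True) 0"

lemma closed_ops [simp]:
  "closed_flags (flag_set UF) (ADD i j)" "closed_flags (flag_set UF) (INC i)"
  "closed_flags (flag_set UF) (DEC i)" "closed_flags (flag_set UF) (CLR i)"
  "closed_flags (flag_set UF) (EQ i j)" "closed_flags (flag_set UF) (LE i j)"
  "closed_flags (flag_set UF) (GETBIT i j)" "closed_flags (flag_set UF) (SETBIT i j b)"
  unfolding ADD_def INC_def DEC_def CLR_def EQ_def LE_def GETBIT_def SETBIT_def
  by (intro closed_sweep; auto simp: Let_def)+

primrec put_bit :: "nat \<Rightarrow> bool \<Rightarrow> nat \<Rightarrow> nat" where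
  "put_bit 0 b v = 2 * (v div 2) + of_bool b"
| "put_bit (Suc p) b v = 2 * put_bit p b (v div 2) + v mod 2"

text \<open>In the invariant \<open>s\<close> is the carry into the columns still to come. The case
  \<open>i = j\<close> is included and serves as doubling.\<close>

lemma wp_ADD:
  assumes "i < nregs" "j < nregs" "bounded_regs X a \<Longrightarrow> rg a i + rg a j < 2 ^ X"
    and "bounded_regs X a \<Longrightarrow> Q (a\<lparr>hs := 0, rg := (rg a)(i := rg a i + rg a j)\<rparr>)"
  shows "wp x X (ADD i j) (sweep_time X) Q a"
  unfolding ADD_def
proof (rule wp_sweep[where J = "\<lambda>s \<rho> \<rho>' f. s < 2 \<and> f = 0 \<and> \<rho>' = \<rho>(i := \<rho> i + \<rho> j + s)"])
  have d: "(a + b + s) div 2 = a div 2 + b div 2 + (of_bool (odd a) + of_bool (odd b) + s) div 2" for a b s :: nat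
    by (cases "odd a"; cases "odd b") (auto elim!: oddE evenE)
  have l: "(of_bool p + of_bool q + s) div 2 < 2" if "s < 2" for p q and s :: nat
    using that by auto
  show "bit_serial (\<lambda>s col. let v = of_bool (col i) + of_bool (col j) + s in (v div 2, col(i := odd v)))
     (\<lambda>s. s = 0) (\<lambda>s \<rho> \<rho>' f. s < 2 \<and> f = 0 \<and> \<rho>' = \<rho>(i := \<rho> i + \<rho> j + s))"
    unfolding bit_serial_def
  proof (intro allI impI, elim conjE, intro conjI impI)
    fix s f :: nat and \<rho> \<rho>' :: "nat \<Rightarrow> nat"
    assume h: "s < 2" "f = 0" "\<rho>' = \<rho>(i := \<rho> i + \<rho> j + s)"
    show "case let v = of_bool (i < nregs \<and> odd (\<rho> i)) + of_bool (j < nregs \<and> odd (\<rho> j)) + s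
         in (v div 2, (\<lambda>j. j < nregs \<and> odd (\<rho> j))(i := odd v)) of
      (s1, w) \<Rightarrow> (\<forall>j<nregs. w j = odd (\<rho>' j)) \<and> s1 < 2 \<and> f = 0 \<and>
         (\<lambda>j. \<rho>' j div 2) = (\<lambda>j. \<rho> j div 2)(i := \<rho> i div 2 + \<rho> j div 2 + s1)"
      using h assms(1,2) l[OF h(1)] d[of "\<rho> i" "\<rho> j" s] by (simp add: Let_def fun_eq_iff)
    show "if s = 0 then (\<forall>j<nregs. \<rho>' j = 0) \<and> f = s else \<exists>j<nregs. \<rho>' j \<noteq> 0" if "\<forall>j<nregs. \<rho> j = 0"
      using h that assms(1,2) by auto
  qed
qed (use assms in \<open>auto simp: bounded_regs_def\<close>)

lemma wp_INC:
  assumes "i < nregs" "bounded_regs X a \<Longrightarrow> rg a i + 1 < 2 ^ X"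
    and "bounded_regs X a \<Longrightarrow> Q (a\<lparr>hs := 0, rg := (rg a)(i := rg a i + 1)\<rparr>)"
  shows "wp x X (INC i) (sweep_time X) Q a"
  unfolding INC_def
proof (rule wp_sweep[where J = "\<lambda>s \<rho> \<rho>' f. s < 2 \<and> f = 0 \<and> \<rho>' = \<rho>(i := \<rho> i + s)"])
  have d: "(a + s) div 2 = a div 2 + (of_bool (odd a) + s) div 2" for a s :: nat
    by (cases "odd a") (auto elim!: oddE evenE)
  have l: "(of_bool p + s) div 2 < 2" if "s < 2" for p and s :: nat
    using that by auto
  show "bit_serial (\<lambda>s col. let v = of_bool (col i) + s in (v div 2, col(i := odd v)))
     (\<lambda>s. s = 0) (\<lambda>s \<rho> \<rho>' f. s < 2 \<and> f = 0 \<and> \<rho>' = \<rho>(i := \<rho> i + s))"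
    unfolding bit_serial_def
  proof (intro allI impI, elim conjE, intro conjI impI)
    fix s f :: nat and \<rho> \<rho>' :: "nat \<Rightarrow> nat"
    assume h: "s < 2" "f = 0" "\<rho>' = \<rho>(i := \<rho> i + s)"
    show "case let v = of_bool (i < nregs \<and> odd (\<rho> i)) + s
         in (v div 2, (\<lambda>j. j < nregs \<and> odd (\<rho> j))(i := odd v)) of
      (s1, w) \<Rightarrow> (\<forall>j<nregs. w j = odd (\<rho>' j)) \<and> s1 < 2 \<and> f = 0 \<and>
         (\<lambda>j. \<rho>' j div 2) = (\<lambda>j. \<rho> j div 2)(i := \<rho> i div 2 + s1)"
      using h assms(1) l[OF h(1)] d[of "\<rho> i" s] by (simp add: Let_def fun_eq_iff)
    show "if s = 0 then (\<forall>j<nregs. \<rho>' j = 0) \<and> f = s else \<exists>j<nregs. \<rho>' j \<noteq> 0" if "\<forall>j<nregs. \<rho> j = 0"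
      using h that assms(1) by auto
  qed
qed (use assms in \<open>auto simp: bounded_regs_def\<close>)

text \<open>The conjunct \<open>s \<le> \<rho> i\<close> of the invariant is what keeps a borrow
  from running past the last used column; it holds initially because the register is
  positive.\<close>

lemma wp_DEC:
  assumes "i < nregs" "bounded_regs X a \<Longrightarrow> 0 < rg a i"
    and "bounded_regs X a \<Longrightarrow> Q (a\<lparr>hs := 0, rg := (rg a)(i := rg a i - 1)\<rparr>)"
  shows "wp x X (DEC i) (sweep_time X) Q a"
  unfolding DEC_def
proof (rule wp_sweep[where J = "\<lambda>s \<rho> \<rho>' f. s < 2 \<and> f = 0 \<and> s \<le> \<rho> i \<and> \<rho>' = \<rho>(i := \<rho> i - s)"])
  show "bit_serial (\<lambda>s col. if s = 0 then (0, col) else (of_bool (\<not> col i), col(i := \<not> col i)))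
     (\<lambda>s. s = 0) (\<lambda>s \<rho> \<rho>' f. s < 2 \<and> f = 0 \<and> s \<le> \<rho> i \<and> \<rho>' = \<rho>(i := \<rho> i - s))"
    unfolding bit_serial_def
  proof (intro allI impI conjI)
    fix s f :: nat and \<rho> \<rho>' :: "nat \<Rightarrow> nat"
    assume h: "s < 2 \<and> f = 0 \<and> s \<le> \<rho> i \<and> \<rho>' = \<rho>(i := \<rho> i - s)"
    consider "s = 0" | "s = 1" "odd (\<rho> i)" | "s = 1" "even (\<rho> i)" using h by linarith
    then show "case (if s = 0 then (0, \<lambda>j. j < nregs \<and> odd (\<rho> j))
            else (of_bool (\<not> (i < nregs \<and> odd (\<rho> i))), (\<lambda>j. j < nregs \<and> odd (\<rho> j))(i := \<not> (i < nregs \<and> odd (\<rho> i))))) of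
         (s1, w) \<Rightarrow> (\<forall>j<nregs. w j = odd (\<rho>' j)) \<and> s1 < 2 \<and> f = 0 \<and> s1 \<le> \<rho> i div 2 \<and>
           (\<lambda>j. \<rho>' j div 2) = (\<lambda>j. \<rho> j div 2)(i := \<rho> i div 2 - s1)"
      using h assms(1) by cases (auto simp: fun_eq_iff elim!: oddE evenE)
    show "if s = 0 then (\<forall>j<nregs. \<rho>' j = 0) \<and> f = s else \<exists>j<nregs. \<rho>' j \<noteq> 0" if "\<forall>j<nregs. \<rho> j = 0"
      using h that assms(1) by auto
  qed
qed (use assms in \<open>auto simp: bounded_regs_def intro: le_less_trans[OF diff_le_self]\<close>)

lemma wp_CLR:
  assumes "i < nregs" "bounded_regs X a \<Longrightarrow> Q (a\<lparr>hs := 0, rg := (rg a)(i := 0)\<rparr>)"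
  shows "wp x X (CLR i) (sweep_time X) Q a"
  unfolding CLR_def
proof (rule wp_sweep[where J = "\<lambda>s \<rho> \<rho>' f. f = s \<and> \<rho>' = \<rho>(i := 0)"])
  show "bit_serial (\<lambda>s col. (s, col(i := False))) (\<lambda>s. True) (\<lambda>s \<rho> \<rho>' f. f = s \<and> \<rho>' = \<rho>(i := 0))"
    unfolding bit_serial_def using assms(1) by (auto simp: fun_eq_iff)
qed (use assms in \<open>auto simp: bounded_regs_def\<close>)

lemma eq_parity_half: "(a = b) \<longleftrightarrow> (odd a \<longleftrightarrow> odd b) \<and> a div 2 = (b::nat) div 2"
  by (metis dvd_def even_two_times_div_two odd_two_times_div_two_succ)

lemma wp_EQ:
  assumes "i < nregs" "j < nregs"
    and "bounded_regs X a \<Longrightarrow> Q (a\<lparr>hs := of_bool (rg a i = rg a j)\<rparr>)"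
  shows "wp x X (EQ i j) (sweep_time X) Q a"
  unfolding EQ_def
proof (rule wp_sweep[where J = "\<lambda>s \<rho> \<rho>' f. f = (if \<rho> i = \<rho> j then s else 0) \<and> \<rho>' = \<rho>" and \<rho>' = "rg a"])
  show "bit_serial (\<lambda>s col. (if col i = col j then s else 0, col)) (\<lambda>s. True)
     (\<lambda>s \<rho> \<rho>' f. f = (if \<rho> i = \<rho> j then s else 0) \<and> \<rho>' = \<rho>)"
    unfolding bit_serial_def
  proof (intro allI impI conjI)
    fix s f :: nat and \<rho> \<rho>' :: "nat \<Rightarrow> nat"
    assume h: "f = (if \<rho> i = \<rho> j then s else 0) \<and> \<rho>' = \<rho>"
    show "case (if (i < nregs \<and> odd (\<rho> i)) = (j < nregs \<and> odd (\<rho> j)) then s else 0, \<lambda>j. j < nregs \<and> odd (\<rho> j)) of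
       (s1, w) \<Rightarrow> (\<forall>j<nregs. w j = odd (\<rho>' j)) \<and> f = (if \<rho> i div 2 = \<rho> j div 2 then s1 else 0) \<and>
         (\<lambda>j. \<rho>' j div 2) = (\<lambda>j. \<rho> j div 2)"
      using h assms(1,2) eq_parity_half[of "\<rho> i" "\<rho> j"] by auto
  qed (use assms in auto)
qed (use assms in \<open>auto simp: bounded_regs_def\<close>)

lemma wp_LE:
  assumes "i < nregs" "j < nregs"
    and "bounded_regs X a \<Longrightarrow> Q (a\<lparr>hs := of_bool (rg a i \<le> rg a j)\<rparr>)"
  shows "wp x X (LE i j) (sweep_time X) Q a"
  unfolding LE_def
proof (rule wp_sweep[where J = "\<lambda>s \<rho> \<rho>' f. f = (if \<rho> i = \<rho> j then s else of_bool (\<rho> i < \<rho> j)) \<and> \<rho>' = \<rho>" and \<rho>' = "rg a"])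
  show "bit_serial (\<lambda>s col. (if col i = col j then s else of_bool (col j), col)) (\<lambda>s. True)
     (\<lambda>s \<rho> \<rho>' f. f = (if \<rho> i = \<rho> j then s else of_bool (\<rho> i < \<rho> j)) \<and> \<rho>' = \<rho>)"
    unfolding bit_serial_def
  proof (intro allI impI conjI)
    fix s f :: nat and \<rho> \<rho>' :: "nat \<Rightarrow> nat"
    assume h: "f = (if \<rho> i = \<rho> j then s else of_bool (\<rho> i < \<rho> j)) \<and> \<rho>' = \<rho>"
    have "\<rho> i < \<rho> j \<longleftrightarrow> \<rho> i div 2 < \<rho> j div 2 \<or> \<rho> i div 2 = \<rho> j div 2 \<and> even (\<rho> i) \<and> odd (\<rho> j)"
      by presburger
    then show "case (if (i < nregs \<and> odd (\<rho> i)) = (j < nregs \<and> odd (\<rho> j)) then s else of_bool (j < nregs \<and> odd (\<rho> j)),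
        \<lambda>j. j < nregs \<and> odd (\<rho> j)) of
       (s1, w) \<Rightarrow> (\<forall>j<nregs. w j = odd (\<rho>' j)) \<and>
         f = (if \<rho> i div 2 = \<rho> j div 2 then s1 else of_bool (\<rho> i div 2 < \<rho> j div 2)) \<and>
         (\<lambda>j. \<rho>' j div 2) = (\<lambda>j. \<rho> j div 2)"
      using h assms(1,2) eq_parity_half[of "\<rho> i" "\<rho> j"] by auto
  qed (use assms in auto)
qed (use assms in \<open>auto simp: bounded_regs_def\<close>)

lemma pow2_half:
  assumes "v = 2 ^ p"
  shows "(p = 0 \<and> v = (1::nat)) \<or> (\<exists>p'. p = Suc p' \<and> even v \<and> v div 2 = 2 ^ p')"
  using assms by (cases p) auto

text \<open>Halving keeps the content of \<open>h\<close> a power of two until the marked column has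
  been passed. Afterwards it is zero and the state does not change any more, which is the first
  disjunct of the invariant.\<close>

lemma wp_GETBIT:
  assumes "w < nregs" "h < nregs" "bounded_regs X a \<Longrightarrow> rg a h = 2 ^ p"
    and "bounded_regs X a \<Longrightarrow> Q (a\<lparr>hs := of_bool (odd (rg a w div 2 ^ p))\<rparr>)"
  shows "wp x X (GETBIT w h) (sweep_time X) Q a"
  unfolding GETBIT_def
proof (rule wp_sweep[where J = "\<lambda>s \<rho> \<rho>' f. (\<rho> h = 0 \<and> f = s \<or> (\<exists>p. \<rho> h = 2 ^ p \<and> f = of_bool (odd (\<rho> w div 2 ^ p)))) \<and> \<rho>' = \<rho>"
      and \<rho>' = "rg a"])
  show "bit_serial (\<lambda>s col. (if col h then of_bool (col w) else s, col)) (\<lambda>s. True)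
     (\<lambda>s \<rho> \<rho>' f. (\<rho> h = 0 \<and> f = s \<or> (\<exists>p. \<rho> h = 2 ^ p \<and> f = of_bool (odd (\<rho> w div 2 ^ p)))) \<and> \<rho>' = \<rho>)"
    unfolding bit_serial_def
  proof (intro allI impI conjI)
    fix s f :: nat and \<rho> \<rho>' :: "nat \<Rightarrow> nat"
    assume h: "(\<rho> h = 0 \<and> f = s \<or> (\<exists>p. \<rho> h = 2 ^ p \<and> f = of_bool (odd (\<rho> w div 2 ^ p)))) \<and> \<rho>' = \<rho>"
    then consider "\<rho> h = 0" "f = s" | "\<rho> h = 1" "f = of_bool (odd (\<rho> w))"
      | p where "even (\<rho> h)" "\<rho> h div 2 = 2 ^ p" "f = of_bool (odd (\<rho> w div 2 div 2 ^ p))"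
      using pow2_half[of "\<rho> h"] by (auto simp: div_mult2_eq)
    then show "case (if h < nregs \<and> odd (\<rho> h) then of_bool (w < nregs \<and> odd (\<rho> w)) else s,
        \<lambda>j. j < nregs \<and> odd (\<rho> j)) of
       (s1, c) \<Rightarrow> (\<forall>j<nregs. c j = odd (\<rho>' j)) \<and>
         (\<rho> h div 2 = 0 \<and> f = s1 \<or> (\<exists>p. \<rho> h div 2 = 2 ^ p \<and> f = of_bool (odd (\<rho> w div 2 div 2 ^ p)))) \<and>
         (\<lambda>j. \<rho>' j div 2) = (\<lambda>j. \<rho> j div 2)"
      by cases (use h assms(1,2) in auto)
  qed (use assms in auto)
qed (use assms in \<open>auto simp: bounded_regs_def\<close>)

lemma wp_SETBIT:
  assumes "w < nregs" "h < nregs" "w \<noteq> h" "bounded_regs X a \<Longrightarrow> rg a h = 2 ^ p"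
    and "bounded_regs X a \<Longrightarrow> put_bit p b (rg a w) < 2 ^ X"
    and "bounded_regs X a \<Longrightarrow> Q (a\<lparr>hs := 0, rg := (rg a)(w := put_bit p b (rg a w))\<rparr>)"
  shows "wp x X (SETBIT w h b) (sweep_time X) Q a"
  unfolding SETBIT_def
proof (rule wp_sweep[where J = "\<lambda>s \<rho> \<rho>' f. f = s \<and> (\<rho> h = 0 \<and> \<rho>' = \<rho> \<or> (\<exists>p. \<rho> h = 2 ^ p \<and> \<rho>' = \<rho>(w := put_bit p b (\<rho> w))))"])
  show "bit_serial (\<lambda>s col. (s, col(w := (if col h then b else col w)))) (\<lambda>s. True)
     (\<lambda>s \<rho> \<rho>' f. f = s \<and> (\<rho> h = 0 \<and> \<rho>' = \<rho> \<or> (\<exists>p. \<rho> h = 2 ^ p \<and> \<rho>' = \<rho>(w := put_bit p b (\<rho> w)))))"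
    unfolding bit_serial_def
  proof (intro allI impI conjI)
    fix s f :: nat and \<rho> \<rho>' :: "nat \<Rightarrow> nat"
    assume h: "f = s \<and> (\<rho> h = 0 \<and> \<rho>' = \<rho> \<or> (\<exists>p. \<rho> h = 2 ^ p \<and> \<rho>' = \<rho>(w := put_bit p b (\<rho> w))))"
    then consider "\<rho> h = 0" "\<rho>' = \<rho>" | "\<rho> h = 1" "\<rho>' = \<rho>(w := put_bit 0 b (\<rho> w))"
      | p where "even (\<rho> h)" "\<rho> h div 2 = 2 ^ p" "\<rho>' = \<rho>(w := put_bit (Suc p) b (\<rho> w))"
      using pow2_half[of "\<rho> h"] by (auto simp del: put_bit.simps)
    then show "case (s, (\<lambda>j. j < nregs \<and> odd (\<rho> j))
          (w := if h < nregs \<and> odd (\<rho> h) then b else w < nregs \<and> odd (\<rho> w))) of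
       (s1, c) \<Rightarrow> (\<forall>j<nregs. c j = odd (\<rho>' j)) \<and> f = s1 \<and>
         (\<rho> h div 2 = 0 \<and> (\<lambda>j. \<rho>' j div 2) = (\<lambda>j. \<rho> j div 2) \<or>
          (\<exists>p. \<rho> h div 2 = 2 ^ p \<and> (\<lambda>j. \<rho>' j div 2) = (\<lambda>j. \<rho> j div 2)(w := put_bit p b (\<rho> w div 2))))"
    proof cases
      case (3 p)
      then show ?thesis using h assms(1-3) by (auto simp: fun_eq_iff intro!: exI[of _ p])
    qed (use h assms(1-3) in \<open>auto simp: fun_eq_iff\<close>)
  qed (use assms in auto)
qed (use assms in \<open>auto simp: bounded_regs_def\<close>)

lemmas wp_rules = wp_Seq wp_uset wp_EQ[rotated 2] wp_LE[rotated 2] wp_ADD[rotated 3] wp_INC[rotated 2]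
  wp_DEC[rotated 2] wp_CLR[rotated 1]

section \<open>Simulated tapes\<close>

abbreviation (input) "rI \<equiv> (2::nat)"
abbreviation (input) "rN1 \<equiv> (3::nat)"
abbreviation (input) "rH \<equiv> (4::nat)"
abbreviation (input) "rW \<equiv> (5::nat)"
abbreviation (input) "rE \<equiv> (6::nat)"
abbreviation (input) "rC \<equiv> (7::nat)"
abbreviation (input) "rCE \<equiv> (8::nat)"
abbreviation (input) "rV \<equiv> (9::nat)"
abbreviation (input) "rG \<equiv> (10::nat)"
abbreviation (input) "rG2 \<equiv> (11::nat)"

text \<open>Finite control of the simulations: the simulated state (\<open>uq\<close>), the position in the tour
  (\<open>ulab\<close>) and the answer (\<open>uans\<close>).  For the input, work and catalytic tape (I, W, C), \<open>us\<close> is the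
  symbol seen, \<open>up\<close> tells whether the head is at the left end (0), inside (1) or at the right end (2),
  \<open>ua\<close> is the bit to be written and \<open>ud\<close> the move to be made.\<close>

record uf =
  uq :: nat
  ulab :: nat
  uans :: "bool option"
  usI :: sym
  usW :: sym
  usC :: sym
  upI :: nat
  upW :: nat
  upC :: nat
  uaW :: sym
  uaC :: sym
  udI :: dir
  udW :: dir
  udC :: dir
  umd :: bool

definition uf_set :: "nat \<Rightarrow> nat \<Rightarrow> uf set" where
  "uf_set Q P = {u. uq u < Q \<and> ulab u \<le> P \<and> upI u < 3 \<and> upW u < 3 \<and> upC u < 3}"

lemma finite_uf_set: "finite (uf_set Q P)"
proof -
  let ?D = "UNIV :: dir set"
  have "?D = {Lft, Stay, Rgt}" using dir.exhaust by auto
  then have D: "finite ?D" by (metis finite.emptyI finite_insert)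
  have "uf_set Q P \<subseteq> (\<lambda>(q, l, an, s1, s2, s3, p1, p2, p3, a1, a2, d1, d2, d3, md).
      \<lparr>uq = q, ulab = l, uans = an, usI = s1, usW = s2, usC = s3, upI = p1, upW = p2, upC = p3,
       uaW = a1, uaC = a2, udI = d1, udW = d2, udC = d3, umd = md\<rparr>) `
      ({..<Q} \<times> {..P} \<times> UNIV \<times> UNIV \<times> UNIV \<times> UNIV \<times> {..<3} \<times> {..<3} \<times> {..<3} \<times> UNIV \<times> UNIV \<times> ?D \<times> ?D \<times> ?D \<times> UNIV)"
    (is "_ \<subseteq> ?f ` ?A")
  proof (intro subsetI)
    fix u assume "u \<in> uf_set Q P"
    then show "u \<in> ?f ` ?A" 
      by (intro rev_image_eqI[of "(uq u, ulab u, uans u, usI u, usW u, usC u, upI u, upW u, upC u, uaW u, uaC u, udI u, udW u, udC u, umd u)"])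
        (auto simp: uf_set_def)
  qed
  moreover have "finite ?A" using D by (intro finite_cartesian_product) auto
  ultimately show ?thesis using finite_surj by blast
qed

primrec val :: "bool list \<Rightarrow> nat" where
  "val [] = 0"
| "val (b # bs) = of_bool b + 2 * val bs"

lemma val_less: "val xs < 2 ^ length xs"
  by (induction xs) auto

lemma val_nth: "i < length xs \<Longrightarrow> odd (val xs div 2 ^ i) = xs ! i"
proof (induction xs arbitrary: i)
  case (Cons b xs)
  then show ?case by (cases i) (auto simp: div_mult2_eq)
qed simp

lemma val_update: "i < length xs \<Longrightarrow> put_bit i b (val xs) = val (xs[i := b])"
proof (induction xs arbitrary: i)
  case (Cons a xs)
  then show ?case by (cases i) auto
qed simp

lemma val_replicate_False [simp]: "val (replicate n False) = 0"
  by (induction n) auto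

text \<open>All that the finite control has to know about a head position: it decides whether a move
  is blocked and whether a cell can be written.\<close>

definition pcode :: "nat \<Rightarrow> nat \<Rightarrow> nat" where
  "pcode n p = (if p = 0 then 0 else if p = n + 1 then 2 else 1)"

text \<open>A tape held in registers: \<^term>\<open>2 * val xs\<close> is the content, shifted so that bit \<^term>\<open>p\<close> is
  cell \<^term>\<open>p\<close>, and the head position \<^term>\<open>p\<close> is held in unary as \<^term>\<open>2 ^ p :: nat\<close>.\<close>

definition represents :: "bool \<Rightarrow> bool list \<Rightarrow> bool list \<Rightarrow> bool list \<Rightarrow> cfg \<Rightarrow> uf ast \<Rightarrow> bool" where
  "represents ph x pre post c a \<longleftrightarrow>
     rg a 0 = 0 \<and> rg a 1 = 1 \<and>
     ih c \<le> length x + 1 \<and> wh c \<le> length (wt c) + 1 \<and> ch c \<le> length (ct c) + 1 \<and>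
     ip a = ih c \<and> rg a rI = ih c \<and> rg a rN1 = length x + 1 \<and>
     rg a rH = 2 ^ wh c \<and> rg a rW = 2 * val (wt c) \<and> rg a rE = 2 ^ (length (wt c) + 1) \<and>
     (if ph then rg a rC = ch c \<and> rg a rCE = length (ct c) + 1 \<and>
        cp a = length pre + ch c \<and> cc a = pre @ ct c @ post
      else rg a rC = 2 ^ ch c \<and> rg a rCE = 2 ^ (length (ct c) + 1) \<and> rg a rV = 2 * val (ct c))"

text \<open>Registers from 12 on belong to the callers of the simulation, which keep loop counters
  and precomputed bounds there.\<close>

definition frame :: "uf ast \<Rightarrow> uf ast \<Rightarrow> bool" where
  "frame a b \<longleftrightarrow> (\<forall>j\<ge>12. rg b j = rg a j)"

section \<open>Observing the symbols under the simulated heads\<close>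

definition look_input :: "uf sf com" where
  "look_input = uset (\<lambda>k u a c. u\<lparr>usI := a\<rparr>) ;;
     EQ rI 0 ;; uset (\<lambda>k u a c. u\<lparr>upI := if k = 1 then 0 else 1\<rparr>) ;;
     EQ rI rN1 ;; uset (\<lambda>k u a c. u\<lparr>upI := if k = 1 then 2 else upI u\<rparr>)"

definition look_work :: "uf sf com" where
  "look_work = EQ rH 1 ;; uset (\<lambda>k u a c. u\<lparr>upW := if k = 1 then 0 else 1\<rparr>) ;;
     EQ rH rE ;; uset (\<lambda>k u a c. u\<lparr>upW := if k = 1 then 2 else upW u\<rparr>) ;;
     GETBIT rW rH ;; uset (\<lambda>k u a c. u\<lparr>usW := if upW u = 1 then Some (k = 1) else None\<rparr>)"

text \<open>On the physical tape the simulated tape is only a block. The cells next to it play its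
  endmarkers, so \<open>None\<close> is reported there whatever they contain; the position in the
  block is kept in binary, since a one-hot position would exceed logarithmic space.\<close>

definition look_cat :: "bool \<Rightarrow> uf sf com" where
  "look_cat ph = (if ph then
       EQ rC 0 ;; uset (\<lambda>k u a c. u\<lparr>upC := if k = 1 then 0 else 1\<rparr>) ;;
       EQ rC rCE ;; uset (\<lambda>k u a c. u\<lparr>upC := if k = 1 then 2 else upC u\<rparr>) ;;
       uset (\<lambda>k u a c. u\<lparr>usC := if upC u = 1 then c else None\<rparr>)
     else
       EQ rC 1 ;; uset (\<lambda>k u a c. u\<lparr>upC := if k = 1 then 0 else 1\<rparr>) ;;
       EQ rC rCE ;; uset (\<lambda>k u a c. u\<lparr>upC := if k = 1 then 2 else upC u\<rparr>) ;;
       GETBIT rV rC ;; uset (\<lambda>k u a c. u\<lparr>usC := if upC u = 1 then Some (k = 1) else None\<rparr>))"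

lemma wp_look_input:
  assumes "represents ph x pre post c a"
    and "\<And>b. represents ph x pre post c b \<Longrightarrow> frame a b \<Longrightarrow>
      us b = (us a)\<lparr>usI := rd x (ih c), upI := pcode (length x) (ih c)\<rparr> \<Longrightarrow> Q b"
  shows "wp x X look_input (2 * sweep_time X + 7) Q a"
  unfolding look_input_def
  by (rule wp_weaken, (rule wp_rules)+, rule assms(2))
    (use assms(1) in \<open>auto simp: represents_def frame_def pcode_def nregs_def\<close>)

lemma rd_val:
  assumes "p \<le> length xs + 1"
  shows "rd xs p = (if pcode (length xs) p = 1 then Some (odd (2 * val xs div 2 ^ p)) else None)"
proof (cases p)
  case (Suc i)
  then show ?thesis using assms val_nth[of i xs] by (auto simp: rd_def pcode_def)
qed (auto simp: rd_def pcode_def)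

lemma pow2_eq_Suc [simp]:
  "(2::nat) ^ p = 2 * 2 ^ n \<longleftrightarrow> p = Suc n" "2 * 2 ^ n = (2::nat) ^ p \<longleftrightarrow> p = Suc n"
  using power_inject_exp[of "2::nat" p "Suc n"] by auto

lemma wp_look_work:
  assumes "represents ph x pre post c a"
    and "\<And>b. represents ph x pre post c b \<Longrightarrow> frame a b \<Longrightarrow>
      us b = (us a)\<lparr>upW := pcode (length (wt c)) (wh c), usW := rd (wt c) (wh c)\<rparr> \<Longrightarrow> Q b"
  shows "wp x X look_work (3 * sweep_time X + 8) Q a"
  unfolding look_work_def
  by (rule wp_weaken, (rule wp_rules wp_GETBIT[where p = "wh c", rotated 3])+, rule assms(2))
    (use assms(1) in \<open>auto simp: nregs_def represents_def frame_def rd_val pcode_def\<close>)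

lemma wp_look_cat:
  assumes "represents ph x pre post c a"
    and "\<And>b. represents ph x pre post c b \<Longrightarrow> frame a b \<Longrightarrow>
      us b = (us a)\<lparr>upC := pcode (length (ct c)) (ch c), usC := rd (ct c) (ch c)\<rparr> \<Longrightarrow> Q b"
  shows "wp x X (look_cat ph) (3 * sweep_time X + 8) Q a"
proof (cases ph)
  case True
  have le: "ch c \<le> length (ct c) + 1" using assms(1) by (simp add: represents_def)
  have r: "rd (pre @ ct c @ post) (length pre + ch c) = rd (ct c) (ch c)" if "ch c \<noteq> 0" "ch c \<noteq> Suc (length (ct c))"
    using le that by (cases "ch c") (simp_all add: rd_def nth_append)
  have r0: "rd (ct c) 0 = None" "rd (ct c) (Suc (length (ct c))) = None"
    by (simp_all add: rd_def)
  show ?thesis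
    unfolding look_cat_def if_P[OF True]
    by (rule wp_weaken, (rule wp_rules)+, rule assms(2))
      (use True r r0 assms(1) in \<open>auto simp: nregs_def represents_def frame_def pcode_def\<close>)
next
  case False
  show ?thesis
    unfolding look_cat_def if_not_P[OF False]
    by (rule wp_weaken, (rule wp_rules wp_GETBIT[where p = "ch c", rotated 3])+, rule assms(2))
      (use False assms(1) in \<open>auto simp: nregs_def represents_def frame_def rd_val pcode_def\<close>)
qed

section \<open>Writing and moving on the simulated tapes\<close>

definition shift :: "dir \<Rightarrow> nat \<Rightarrow> nat" where
  "shift d p = (case d of Lft \<Rightarrow> p - 1 | Stay \<Rightarrow> p | Rgt \<Rightarrow> p + 1)"

definition put :: "sym \<Rightarrow> bool list \<Rightarrow> nat \<Rightarrow> bool list" where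
  "put s xs p = (case s of None \<Rightarrow> xs | Some b \<Rightarrow> wr xs p b)"

text \<open>Halving moves each bit to the preceding column, which a sweep from low to high columns
  cannot do. Instead the powers of two are enumerated from 1 on, \<open>rG2\<close> always being
  twice \<open>rG\<close>, until \<open>rG2\<close> equals the register.\<close>

definition halve_pow2 :: "nat \<Rightarrow> uf sf com" where
  "halve_pow2 h = CLR rG ;; INC rG ;; CLR rG2 ;; INC rG2 ;; INC rG2 ;; EQ rG2 h ;;
     Loop (utest (\<lambda>k u a c. k \<noteq> 1)) (CLR rG ;; ADD rG rG2 ;; ADD rG2 rG2 ;; EQ rG2 h) ;;
     CLR h ;; ADD h rG"

definition tape_time :: "nat \<Rightarrow> nat" where
  "tape_time X = (X + 3) * (10 * sweep_time X)"

lemma sweep_time_ge: "560 \<le> sweep_time X"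
  by (simp add: sweep_time_def clen_def nregs_def)

lemma tape_time_ge: "30 * sweep_time X \<le> tape_time X"
  by (simp add: tape_time_def)

lemma wp_Loop_inv:
  assumes "I 0 a"
    and "\<And>b. I N b \<Longrightarrow> Q b"
    and "\<And>i b. i < N \<Longrightarrow> I i b \<Longrightarrow> t (hs b) (us b) (rd x (ip b)) (rd (cc b) (cp b))"
    and "\<And>i b. i < N \<Longrightarrow> I i b \<Longrightarrow> wp x X p T (I (Suc i)) b"
    and "\<And>b. I N b \<Longrightarrow> \<not> t (hs b) (us b) (rd x (ip b)) (rd (cc b) (cp b))"
  shows "wp x X (Loop (utest t) p) (N * (T + 1) + 1) Q a"
  by (rule wp_mono[OF wp_Loop_count[of I a N t x X p T]]) (use assms in auto)

lemma wp_halve_pow2: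
  assumes h: "h < nregs" "h < 10 \<or> 12 \<le> h" and p: "rg a h = 2 ^ Suc p"
    and Q: "\<And>b. us b = us a \<Longrightarrow> ip b = ip a \<Longrightarrow> cp b = cp a \<Longrightarrow> cc b = cc a \<Longrightarrow> rg b h = 2 ^ p \<Longrightarrow>
      (\<forall>j. j \<noteq> h \<and> (j < 10 \<or> 12 \<le> j) \<longrightarrow> rg b j = rg a j) \<Longrightarrow> Q b"
  shows "wp x X (halve_pow2 h) (tape_time X) Q a"
proof (rule wp_bounded)
  assume bd: "bounded_regs X a"
  then have "(2::nat) ^ Suc p < 2 ^ X" using h(1) p by (auto simp: bounded_regs_def)
  then have pX: "Suc p < X" using power_less_imp_less_exp by (metis one_less_numeral_iff semiring_norm(76))
  have lt: "(2::nat) ^ j < 2 ^ X" if "j \<le> Suc p" for j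
    using pX that by simp
  have l1: "Suc 0 < 2 ^ X" "Suc (Suc 0) < 2 ^ X" using lt[of 0] lt[of 1] by auto
  define I where "I i b \<longleftrightarrow> us b = us a \<and> ip b = ip a \<and> cp b = cp a \<and> cc b = cc a \<and>
    (\<forall>j. j < 10 \<or> 12 \<le> j \<longrightarrow> rg b j = rg a j) \<and> rg b rG = 2 ^ i \<and> rg b rG2 = 2 ^ Suc i \<and> hs b = of_bool (i = p)"
    for i and b :: "uf ast"
  have body: "wp x X (CLR rG ;; ADD rG rG2 ;; ADD rG2 rG2 ;; EQ rG2 h) (4 * sweep_time X + 3) (I (Suc i)) b"
    if "i < p" "I i b" for i b
    by (rule wp_weaken, (rule wp_rules)+)
      (use that h p lt[of "Suc i"] lt[of "Suc (Suc i)"] in \<open>auto simp: I_def nregs_def\<close>)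
  \<comment> \<open>For the first test of the loop: \<open>rG2\<close> starts as 2, which is the
    target \<open>2 ^ Suc p\<close> exactly if \<open>p = 0\<close>.\<close>
  have two: "Suc (Suc 0) = 2 * 2 ^ p \<longleftrightarrow> p = 0"
  proof (cases p)
    case (Suc k)
    have "(1::nat) \<le> 2 ^ k" by simp
    then show ?thesis unfolding Suc power_Suc by linarith
  qed simp
  have tail: "wp x X (CLR h ;; ADD h rG) (sweep_time X + sweep_time X + 1) Q b" if "I p b" for b
    by ((rule wp_rules)+, rule Q) (use that h p lt[of p] in \<open>auto simp: I_def nregs_def\<close>)
  have "wp x X (halve_pow2 h) (sweep_time X + (sweep_time X + (sweep_time X + (sweep_time X + (sweep_time X + (sweep_time X +
      (p * (4 * sweep_time X + 3 + 1) + 1 + (sweep_time X + sweep_time X + 1) + 1) + 1) + 1) + 1) + 1) + 1) + 1) Q a"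
    unfolding halve_pow2_def
    by ((rule wp_rules)+, rule wp_Loop_inv[where I = I, OF _ tail])
      (insert h p l1 body two, auto simp: I_def nregs_def)
  then show "wp x X (halve_pow2 h) (tape_time X) Q a"
  proof (rule wp_weaken)
    have V: "560 \<le> sweep_time X" by (rule sweep_time_ge)
    have "p * (4 * sweep_time X + 3 + 1) \<le> X * (5 * sweep_time X)"
      by (rule mult_le_mono) (use pX V in auto)
    moreover have "tape_time X = X * (10 * sweep_time X) + 30 * sweep_time X"
      by (simp add: tape_time_def algebra_simps)
    moreover have "X * (5 * sweep_time X) \<le> X * (10 * sweep_time X)" by simp
    ultimately show "sweep_time X + (sweep_time X + (sweep_time X + (sweep_time X + (sweep_time X + (sweep_time X +
      (p * (4 * sweep_time X + 3 + 1) + 1 + (sweep_time X + sweep_time X + 1) + 1) + 1) + 1) + 1) + 1) + 1) + 1 \<le> tape_time X"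
      using V by linarith
  qed
qed

definition move_input :: "uf sf com" where
  "move_input = Cond (utest (\<lambda>k u a c. udI u = Rgt)) (uact (\<lambda>k u a c. (u, keep c, Rgt, Stay)) ;; INC rI)
     (Cond (utest (\<lambda>k u a c. udI u = Lft)) (uact (\<lambda>k u a c. (u, keep c, Lft, Stay)) ;; DEC rI) Skip)"

definition write_hot :: "(uf \<Rightarrow> sym) \<Rightarrow> nat \<Rightarrow> nat \<Rightarrow> uf sf com" where
  "write_hot f w h = Cond (utest (\<lambda>k u a c. f u = Some True)) (SETBIT w h True)
     (Cond (utest (\<lambda>k u a c. f u = Some False)) (SETBIT w h False) Skip)"

definition move_hot :: "(uf \<Rightarrow> dir) \<Rightarrow> nat \<Rightarrow> uf sf com" where
  "move_hot f h = Cond (utest (\<lambda>k u a c. f u = Rgt)) (ADD h h)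
     (Cond (utest (\<lambda>k u a c. f u = Lft)) (halve_pow2 h) Skip)"

definition act_cat :: "bool \<Rightarrow> uf sf com" where
  "act_cat ph = (if ph then
      uact (\<lambda>k u a c. (u, case uaC u of None \<Rightarrow> keep c | Some b \<Rightarrow> b, Stay, udC u)) ;;
      Cond (utest (\<lambda>k u a c. udC u = Rgt)) (INC rC)
        (Cond (utest (\<lambda>k u a c. udC u = Lft)) (DEC rC) Skip)
    else write_hot uaC rV rC ;; move_hot udC rC)"

text \<open>\<open>shift\<close> does not stop at the right end. Under this condition the move stays
  on the tape, agrees with a real move and is undone by the opposite one.\<close>

definition ok_move :: "dir \<Rightarrow> nat \<Rightarrow> nat \<Rightarrow> bool" where
  "ok_move d n p \<longleftrightarrow> (d = Lft \<longrightarrow> 0 < p) \<and> (d = Rgt \<longrightarrow> p \<le> n)"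

definition ok_write :: "sym \<Rightarrow> nat \<Rightarrow> nat \<Rightarrow> bool" where
  "ok_write s n p \<longleftrightarrow> (s \<noteq> None \<longrightarrow> 1 \<le> p \<and> p \<le> n)"

lemma wp_move_input:
  assumes "represents ph x pre post c a" "ok_move (udI (us a)) (length x) (ih c)"
    and Q: "\<And>b. represents ph x pre post (c\<lparr>ih := shift (udI (us a)) (ih c)\<rparr>) b \<Longrightarrow> frame a b \<Longrightarrow> us b = us a \<Longrightarrow> Q b"
  shows "wp x X move_input (tape_time X) Q a"
proof (rule wp_bounded)
  assume bd: "bounded_regs X a"
  have "rg a rN1 < 2 ^ X" using bd unfolding bounded_regs_def by (simp add: nregs_def)
  then have n1: "length x + 1 < 2 ^ X" using assms(1) by (simp add: represents_def)
  have V: "sweep_time X + 10 \<le> tape_time X"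
    using tape_time_ge[of X] sweep_time_ge[of X] by linarith
  consider "udI (us a) = Rgt" | "udI (us a) = Lft" | "udI (us a) = Stay" by (cases "udI (us a)") auto
  then show "wp x X move_input (tape_time X) Q a"
  proof cases
    case 1
    have "wp x X move_input (1 + sweep_time X + 1 + 1) Q a"
      unfolding move_input_def
      by (rule wp_Cond, simp only: 1 simp_thms if_True, rule wp_Seq, rule wp_uact, rule refl, rule wp_rules, rule Q)
       (use assms(1,2) 1 n1 in \<open>auto simp: nregs_def represents_def frame_def shift_def mv_def ok_move_def\<close>)
    then show ?thesis by (rule wp_weaken) (use V in simp)
  next
    case 2
    have "wp x X move_input (1 + sweep_time X + 1 + 1 + 1) Q a"
      unfolding move_input_def
      by (rule wp_Cond, simp only: 2 dir.distinct simp_thms if_False, rule wp_Cond, simp only: 2 simp_thms if_True,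
          rule wp_Seq, rule wp_uact, rule refl, rule wp_rules, rule Q)
       (use assms(1,2) 2 n1 in \<open>auto simp: nregs_def represents_def frame_def shift_def mv_def ok_move_def\<close>)
    then show ?thesis by (rule wp_weaken) (use V in simp)
  next
    case 3
    have "wp x X move_input (1 + 1 + 1) Q a"
      unfolding move_input_def
      by (rule wp_Cond, simp only: 3 dir.distinct simp_thms if_False, rule wp_Cond,
          simp only: 3 dir.distinct simp_thms if_False, rule wp_Skip, rule Q)
       (use assms(1,2) 3 n1 in \<open>auto simp: nregs_def represents_def frame_def shift_def mv_def ok_move_def\<close>)
    then show ?thesis by (rule wp_weaken) (use V in simp)
  qed
qed

lemma wr_val:
  assumes "1 \<le> p" "p \<le> length xs"
  shows "put_bit p b (2 * val xs) = 2 * val (wr xs p b)"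
  using assms val_update[of "p - 1" xs b] by (cases p) (auto simp: wr_def)

lemma length_wr [simp]: "length (wr xs p b) = length xs"
  by (simp add: wr_def)

lemma length_put [simp]: "length (put s xs p) = length xs"
  by (simp add: put_def split: option.splits)

text \<open>Register \<open>e\<close> holds the end of the tape in one-hot form. Since it is
  representable, the tape content with any bit written is representable too, so that no overflow can
  occur.\<close>

lemma wp_write_hot:
  assumes r: "w < nregs" "h < nregs" "w \<noteq> h" "rg a h = 2 ^ p" "rg a w = 2 * val xs"
    and e: "e < nregs" "rg a e = 2 ^ (length xs + 1)"
    and ok: "ok_write (f (us a)) (length xs) p"
    and Q: "\<And>k. Q (a\<lparr>hs := k, rg := (rg a)(w := 2 * val (put (f (us a)) xs p))\<rparr>)"
  shows "wp x X (write_hot f w h) (tape_time X) Q a"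
proof (rule wp_bounded)
  assume bd: "bounded_regs X a"
  have V: "sweep_time X + 10 \<le> tape_time X"
    using tape_time_ge[of X] sweep_time_ge[of X] by linarith
  have "2 * val (put (f (us a)) xs p) < 2 * 2 ^ length xs" using val_less[of "put (f (us a)) xs p"] by simp
  moreover have "2 * 2 ^ length xs < (2::nat) ^ X" using bd e by (auto simp: bounded_regs_def)
  ultimately have l: "2 * val (put (f (us a)) xs p) < 2 ^ X" by linarith
  consider "f (us a) = Some True" | "f (us a) = Some False" | "f (us a) = None"
    by (cases "f (us a)") auto
  then show "wp x X (write_hot f w h) (tape_time X) Q a"
  proof cases
    case 1
    have "wp x X (write_hot f w h) (sweep_time X + 1) Q a"
      unfolding write_hot_def
      by (rule wp_Cond, simp only: 1 simp_thms if_True, rule wp_SETBIT[where p = p])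
        (use 1 r l ok Q[of 0] in \<open>auto simp: put_def ok_write_def wr_val\<close>)
    then show ?thesis by (rule wp_weaken) (use V in simp)
  next
    case 2
    have "wp x X (write_hot f w h) (sweep_time X + 1 + 1) Q a"
      unfolding write_hot_def
      by (rule wp_Cond, simp only: 2 option.inject bool.distinct simp_thms if_False, rule wp_Cond,
          simp only: 2 simp_thms if_True, rule wp_SETBIT[where p = p])
        (use 2 r l ok Q[of 0] in \<open>auto simp: put_def ok_write_def wr_val\<close>)
    then show ?thesis by (rule wp_weaken) (use V in simp)
  next
    case 3
    have "(rg a)(w := 2 * val xs) = rg a" using r by auto
    then have "Q a" using Q[of "hs a"] 3 by (cases a) (simp add: put_def)
    note Qa = this
    have "wp x X (write_hot f w h) (1 + 1 + 1) Q a"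
      unfolding write_hot_def
      by (rule wp_Cond, simp only: 3 option.distinct simp_thms if_False, rule wp_Cond,
          simp only: 3 option.distinct simp_thms if_False, rule wp_Skip, rule Qa)
    then show ?thesis by (rule wp_weaken) (use V in simp)
  qed
qed

lemma wp_move_hot:
  assumes r: "h < nregs" "h < 10 \<or> 12 \<le> h" "rg a h = 2 ^ p"
    and e: "e < nregs" "rg a e = 2 ^ (n + 1)"
    and ok: "ok_move (f (us a)) n p"
    and Q: "\<And>b. us b = us a \<Longrightarrow> ip b = ip a \<Longrightarrow> cp b = cp a \<Longrightarrow> cc b = cc a \<Longrightarrow>
      rg b h = 2 ^ (shift (f (us a)) p) \<Longrightarrow>
      (\<forall>j. j \<noteq> h \<and> (j < 10 \<or> 12 \<le> j) \<longrightarrow> rg b j = rg a j) \<Longrightarrow> Q b"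
  shows "wp x X (move_hot f h) (2 * tape_time X) Q a"
proof (rule wp_bounded)
  assume bd: "bounded_regs X a"
  have V: "sweep_time X + 10 \<le> tape_time X"
    using tape_time_ge[of X] sweep_time_ge[of X] by linarith
  have E: "(2::nat) ^ (n + 1) < 2 ^ X" using bd e by (auto simp: bounded_regs_def)
  consider "f (us a) = Rgt" | "f (us a) = Lft" | "f (us a) = Stay" by (cases "f (us a)") auto
  then show "wp x X (move_hot f h) (2 * tape_time X) Q a"
  proof cases
    case 1
    then have "p \<le> n" using ok by (simp add: ok_move_def)
    then have "(2::nat) ^ (p + 1) \<le> 2 ^ (n + 1)" by (intro power_increasing) auto
    from le_less_trans[OF this E] have l: "2 * 2 ^ p < (2::nat) ^ X" by simp
    have "wp x X (move_hot f h) (sweep_time X + 1) Q a"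
      unfolding move_hot_def
      by (rule wp_Cond, simp only: 1 simp_thms if_True, rule wp_rules, rule Q) (use r 1 l in \<open>auto simp: shift_def\<close>)
    then show ?thesis by (rule wp_weaken) (use V in simp)
  next
    case 2
    then obtain p' where p': "p = Suc p'" using ok by (cases p) (auto simp: ok_move_def)
    have "wp x X (move_hot f h) (tape_time X + 1 + 1) Q a"
      unfolding move_hot_def
      by (rule wp_Cond, simp only: 2 dir.distinct simp_thms if_False, rule wp_Cond,
          simp only: 2 simp_thms if_True, rule wp_halve_pow2[where p = p'], rule r, rule r, simp add: r p', rule Q)
        (use r 2 p' in \<open>auto simp: shift_def\<close>)
    then show ?thesis by (rule wp_weaken) (use V in simp)
  next
    case 3
    have "Q a" by (rule Q) (use r 3 in \<open>auto simp: shift_def\<close>)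
    note Qa = this
    have "wp x X (move_hot f h) (1 + 1 + 1) Q a"
      unfolding move_hot_def
      by (rule wp_Cond, simp only: 3 dir.distinct simp_thms if_False, rule wp_Cond,
          simp only: 3 dir.distinct simp_thms if_False, rule wp_Skip, rule Qa)
    then show ?thesis by (rule wp_weaken) (use V in simp)
  qed
qed

lemma frame_trans: "frame a b \<Longrightarrow> frame b c \<Longrightarrow> frame a c"
  by (simp add: frame_def)

lemma wr_block:
  assumes "1 \<le> p" "p \<le> length xs"
  shows "wr (pre @ xs @ post) (length pre + p) b = pre @ wr xs p b @ post"
  using assms by (cases p) (auto simp: wr_def list_update_append)

lemma wp_act_cat:
  assumes vr: "represents ph x pre post c a" and om: "ok_move (udC (us a)) (length (ct c)) (ch c)"
    and ow: "ok_write (uaC (us a)) (length (ct c)) (ch c)"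
    and Q: "\<And>b. represents ph x pre post (c\<lparr>ct := put (uaC (us a)) (ct c) (ch c), ch := shift (udC (us a)) (ch c)\<rparr>) b \<Longrightarrow>
      frame a b \<Longrightarrow> us b = us a \<Longrightarrow> Q b"
  shows "wp x X (act_cat ph) (4 * tape_time X) Q a"
proof (cases ph)
  case False
  have "wp x X (write_hot uaC rV rC ;; move_hot udC rC) (tape_time X + 2 * tape_time X + 1) Q a"
    by (rule wp_Seq, rule wp_write_hot[where p = "ch c" and xs = "ct c" and e = rCE],
        simp add: nregs_def, simp add: nregs_def, simp,
        insert vr False, simp add: represents_def, simp add: represents_def, simp add: nregs_def, simp add: represents_def, simp add: ow,
        rule wp_move_hot[where p = "ch c" and n = "length (ct c)" and e = rCE],
        simp add: nregs_def, simp, simp add: represents_def, simp add: nregs_def, simp add: represents_def, simp add: om,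
        rule Q) (use om in \<open>auto simp: represents_def frame_def shift_def ok_move_def split: dir.splits\<close>)
  then show ?thesis
    unfolding act_cat_def if_not_P[OF False]
    by (rule wp_weaken) (use tape_time_ge[of X] sweep_time_ge[of X] in linarith)
next
  case True
  have V: "sweep_time X + 10 \<le> tape_time X"
    using tape_time_ge[of X] sweep_time_ge[of X] by linarith
  \<comment> \<open>Without a bit to write, the physical symbol is written back. At the ends of the
    block the scanned cell may belong to a neighbouring block, and its content has to
    survive.\<close>
  define v where "v = (case uaC (us a) of None \<Rightarrow> keep (rd (cc a) (cp a)) | Some b \<Rightarrow> b)"
  have cc: "wr (cc a) (cp a) v = pre @ put (uaC (us a)) (ct c) (ch c) @ post"
    using vr True ow wr_block by (auto simp: v_def put_def represents_def ok_write_def split: option.splits)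
  have cp: "mv (length (cc a)) (cp a) (udC (us a)) = length pre + shift (udC (us a)) (ch c)"
    using vr True om by (auto simp: represents_def mv_def shift_def ok_move_def split: dir.splits)
  have ch: "shift (udC (us a)) (ch c) \<le> length (ct c) + 1"
    using vr om by (auto simp: represents_def shift_def ok_move_def split: dir.splits)
  define a1 where "a1 = a\<lparr>cc := pre @ put (uaC (us a)) (ct c) (ch c) @ post, cp := length pre + shift (udC (us a)) (ch c)\<rparr>"
  have "wp x X (Cond (utest (\<lambda>k u a c. udC u = Rgt)) (INC rC)
        (Cond (utest (\<lambda>k u a c. udC u = Lft)) (DEC rC) Skip)) (sweep_time X + 5) Q a1"
  proof (rule wp_bounded)
    assume bd: "bounded_regs X a1"
    have "rg a1 rCE < 2 ^ X" using bd unfolding bounded_regs_def by (simp add: nregs_def)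
    then have n1: "length (ct c) + 1 < 2 ^ X" using vr True by (simp add: represents_def a1_def)
    consider "udC (us a) = Rgt" | "udC (us a) = Lft" | "udC (us a) = Stay" by (cases "udC (us a)") auto
    then show "wp x X (Cond (utest (\<lambda>k u a c. udC u = Rgt)) (INC rC)
        (Cond (utest (\<lambda>k u a c. udC u = Lft)) (DEC rC) Skip)) (sweep_time X + 5) Q a1"
    proof cases
      case 1
      then have u: "udC (us a1) = Rgt" by (simp add: a1_def)
      show ?thesis
        by (rule wp_weaken, rule wp_Cond, simp only: u simp_thms if_True, rule wp_rules, rule Q)
         (use vr om True 1 n1 ch in \<open>auto simp: a1_def nregs_def represents_def frame_def shift_def ok_move_def\<close>)
    next
      case 2
      then have u: "udC (us a1) = Lft" by (simp add: a1_def)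
      show ?thesis
        by (rule wp_weaken, rule wp_Cond, simp only: u dir.distinct simp_thms if_False, rule wp_Cond,
            simp only: u simp_thms if_True, rule wp_rules, rule Q)
         (use vr om True 2 n1 ch in \<open>auto simp: a1_def nregs_def represents_def frame_def shift_def ok_move_def\<close>)
    next
      case 3
      then have u: "udC (us a1) = Stay" by (simp add: a1_def)
      show ?thesis
        by (rule wp_weaken, rule wp_Cond, simp only: u dir.distinct simp_thms if_False, rule wp_Cond,
            simp only: u dir.distinct simp_thms if_False, rule wp_Skip, rule Q)
         (use vr om True 3 n1 ch in \<open>auto simp: a1_def nregs_def represents_def frame_def shift_def ok_move_def\<close>)
    qed
  qed
  note A = this
  have e: "a\<lparr>us := us a, ip := mv (length x) (ip a) Stay, cc := wr (cc a) (cp a) v,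
          cp := mv (length (cc a)) (cp a) (udC (us a))\<rparr> = a1"
    unfolding cc cp a1_def by simp
  have "wp x X (act_cat ph) (1 + (sweep_time X + 5) + 1) Q a"
    unfolding act_cat_def if_P[OF True]
    by (rule wp_Seq, rule wp_uact[where v = v], simp add: v_def, unfold e, rule A)
  then show ?thesis by (rule wp_weaken) (use V in simp)
qed

section \<open>Local steps: observe, update the finite control, act\<close>

definition look_all :: "bool \<Rightarrow> uf sf com" where
  "look_all ph = look_input ;; look_work ;; look_cat ph"

definition act_all :: "bool \<Rightarrow> uf sf com" where
  "act_all ph = move_input ;; write_hot uaW rW rH ;; move_hot udW rH ;; act_cat ph"

definition local_step :: "bool \<Rightarrow> (uf \<Rightarrow> uf) \<Rightarrow> uf sf com" where
  "local_step ph g = look_all ph ;; uset (\<lambda>k u a c. g u) ;; act_all ph"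

definition observe :: "bool list \<Rightarrow> cfg \<Rightarrow> uf \<Rightarrow> uf" where
  "observe x c u = u\<lparr>usI := rd x (ih c), upI := pcode (length x) (ih c),
     upW := pcode (length (wt c)) (wh c), usW := rd (wt c) (wh c),
     upC := pcode (length (ct c)) (ch c), usC := rd (ct c) (ch c)\<rparr>"

definition apply_act :: "uf \<Rightarrow> cfg \<Rightarrow> cfg" where
  "apply_act u c = c\<lparr>ih := shift (udI u) (ih c), wt := put (uaW u) (wt c) (wh c), wh := shift (udW u) (wh c),
     ct := put (uaC u) (ct c) (ch c), ch := shift (udC u) (ch c)\<rparr>"

definition ok_act :: "bool list \<Rightarrow> uf \<Rightarrow> cfg \<Rightarrow> bool" where
  "ok_act x u c \<longleftrightarrow> ok_move (udI u) (length x) (ih c) \<and> ok_move (udW u) (length (wt c)) (wh c) \<and>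
     ok_move (udC u) (length (ct c)) (ch c) \<and> ok_write (uaW u) (length (wt c)) (wh c) \<and>
     ok_write (uaC u) (length (ct c)) (ch c)"

lemma wp_look_all:
  assumes "represents ph x pre post c a"
    and Q: "\<And>b. represents ph x pre post c b \<Longrightarrow> frame a b \<Longrightarrow> us b = observe x c (us a) \<Longrightarrow> Q b"
  shows "wp x X (look_all ph) (tape_time X) Q a"
proof -
  have "wp x X (look_all ph) (2 * sweep_time X + 7 + (3 * sweep_time X + 8 + (3 * sweep_time X + 8) + 1) + 1) Q a"
    unfolding look_all_def
    by (rule wp_Seq, rule wp_look_input[OF assms(1)], rule wp_Seq, rule wp_look_work, assumption, rule wp_look_cat, assumption,
        rule Q) (auto simp: observe_def intro: frame_trans)
  then show ?thesis
    by (rule wp_weaken) (use tape_time_ge[of X] sweep_time_ge[of X] in linarith)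
qed

lemma wp_act_all:
  assumes vr: "represents ph x pre post c a" and ok: "ok_act x (us a) c"
    and Q: "\<And>b. represents ph x pre post (apply_act (us a) c) b \<Longrightarrow> frame a b \<Longrightarrow> us b = us a \<Longrightarrow> Q b"
  shows "wp x X (act_all ph) (10 * tape_time X) Q a"
proof -
  let ?u = "us a"
  let ?c1 = "c\<lparr>ih := shift (udI ?u) (ih c)\<rparr>"
  let ?c2 = "?c1\<lparr>wt := put (uaW ?u) (wt c) (wh c), wh := shift (udW ?u) (wh c)\<rparr>"
  have "wp x X (move_input ;; write_hot uaW rW rH ;; move_hot udW rH ;; act_cat ph)
      (tape_time X + (tape_time X + (2 * tape_time X + 4 * tape_time X + 1) + 1) + 1) Q a"
  proof (rule wp_Seq, rule wp_move_input[OF vr])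
    show "ok_move (udI (us a)) (length x) (ih c)" using ok by (simp add: ok_act_def)
    fix b assume b: "represents ph x pre post ?c1 b" "frame a b" "us b = us a"
    have A: "wp x X (act_cat ph) (4 * tape_time X) Q d" if d: "represents ph x pre post ?c2 d" "us d = us a" "frame a d" for d
      by (rule wp_act_cat[OF d(1)])
        (use ok d Q in \<open>auto simp: ok_act_def apply_act_def intro: frame_trans\<close>)
    show "wp x X (write_hot uaW rW rH ;; move_hot udW rH ;; act_cat ph)
       (tape_time X + (2 * tape_time X + 4 * tape_time X + 1) + 1) Q b"
      by (rule wp_Seq, rule wp_write_hot[where p = "wh c" and xs = "wt c" and e = rE],
        simp add: nregs_def, simp add: nregs_def, simp,
        insert b ok, simp add: represents_def, simp add: represents_def, simp add: nregs_def, simp add: represents_def,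
        simp add: ok_act_def,
        rule wp_Seq, rule wp_move_hot[where p = "wh c" and n = "length (wt c)" and e = rE],
        simp add: nregs_def, simp, simp add: represents_def, simp add: nregs_def, simp add: represents_def,
        simp add: ok_act_def,
        rule A) (auto simp: represents_def frame_def shift_def ok_act_def ok_move_def split: dir.splits)
  qed
  then show ?thesis
    unfolding act_all_def
    by (rule wp_weaken) (use tape_time_ge[of X] sweep_time_ge[of X] in linarith)
qed

lemma wp_local_step:
  assumes "represents ph x pre post c a" "ok_act x (g (observe x c (us a))) c"
    and Q: "\<And>b. represents ph x pre post (apply_act (g (observe x c (us a))) c) b \<Longrightarrow> frame a b \<Longrightarrow>
      us b = g (observe x c (us a)) \<Longrightarrow> Q b"
  shows "wp x X (local_step ph g) (12 * tape_time X) Q a"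
proof -
  have V: "represents ph x pre post c (b\<lparr>us := u\<rparr>) = represents ph x pre post c b" "frame a (b\<lparr>us := u\<rparr>) = frame a b"
    "frame (b\<lparr>us := u\<rparr>) d = frame b d" for b u d
    by (auto simp: represents_def frame_def)
  have "wp x X (local_step ph g) (tape_time X + (1 + 10 * tape_time X + 1) + 1) Q a"
    unfolding local_step_def
    by (rule wp_Seq, rule wp_look_all[OF assms(1)], rule wp_Seq, rule wp_uset, rule wp_act_all[where c = c])
      (use assms(2) Q frame_trans in \<open>auto simp: V\<close>)
  then show ?thesis
    by (rule wp_weaken) (use tape_time_ge[of X] sweep_time_ge[of X] in linarith)
qed

section \<open>The reversible tour of the configuration graph\<close>

text \<open>A move that an endmarker blocks is turned into \<open>Stay\<close>. Recorded moves have
  therefore really been made and can be reversed.\<close>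

definition clip :: "nat \<Rightarrow> dir \<Rightarrow> dir" where
  "clip pc d = (if d = Lft \<and> pc = 0 \<or> d = Rgt \<and> pc = 2 then Stay else d)"

primrec opp :: "dir \<Rightarrow> dir" where
  "opp Lft = Rgt" | "opp Stay = Stay" | "opp Rgt = Lft"

definition okp :: "dir \<Rightarrow> nat \<Rightarrow> bool" where
  "okp d pc \<longleftrightarrow> (d = Lft \<longrightarrow> pc \<noteq> 0) \<and> (d = Rgt \<longrightarrow> pc \<noteq> 2)"

lemma mv_clip: "p \<le> n + 1 \<Longrightarrow> mv n p d = shift (clip (pcode n p) d) p"
  by (cases d) (auto simp: mv_def shift_def clip_def pcode_def)

lemma ok_move_clip: "p \<le> n + 1 \<Longrightarrow> ok_move (clip (pcode n p) d) n p"
  by (cases d) (auto simp: ok_move_def clip_def pcode_def)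

lemma okp_pcode: "p \<le> n + 1 \<Longrightarrow> okp d (pcode n p) \<longleftrightarrow> ok_move d n p"
  by (cases d) (auto simp: ok_move_def okp_def pcode_def)

lemma shift_le: "p \<le> n + 1 \<Longrightarrow> ok_move d n p \<Longrightarrow> shift d p \<le> n + 1"
  by (cases d) (auto simp: ok_move_def shift_def)

lemma opp_opp [simp]: "opp (opp d) = d"
  by (cases d) auto

lemma ok_move_opp: "p \<le> n + 1 \<Longrightarrow> ok_move d n p \<Longrightarrow> ok_move (opp d) n (shift d p) \<and> shift (opp d) (shift d p) = p"
  by (cases d) (auto simp: ok_move_def shift_def)

text \<open>\<open>a\<close> is the symbol found before the write. The value \<open>None\<close>
  stands for an endmarker, where nothing was written and nothing has to be restored.\<close>

lemma tape_undo:
  assumes "rd xs p = a"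
  shows "put a (wr xs p v) p = xs" "(rd (wr xs p v) p = None) = (a = None)"
    "a \<noteq> None \<Longrightarrow> rd (wr xs p v) p = Some v"
  using assms by (auto simp: put_def wr_def rd_def split: if_splits)

lemma tape_redo:
  assumes "(rd xs p = None) = (a = None)" "a \<noteq> None \<Longrightarrow> rd xs p = Some v"
  shows "rd (put a xs p) p = a" "wr (put a xs p) p v = xs"
proof -
  show "rd (put a xs p) p = a" using assms by (cases a) (auto simp: put_def wr_def rd_def split: if_splits)
  show "wr (put a xs p) p v = xs"
    using assms by (cases a) (auto simp: put_def wr_def rd_def split: if_splits intro: list_update_id)
qed

text \<open>A label is what a step forgets: the state, the overwritten symbols and the moves that were
  actually made.  A configuration is determined by its successor and its label.\<close>

type_synonym label = "nat \<times> sym \<times> sym \<times> dir \<times> dir \<times> dir"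

text \<open>Their number depends on \<open>Q\<close> alone, so the position of a tour within the
  list of labels fits into the finite control.\<close>

definition labs :: "nat \<Rightarrow> label list" where
  "labs Q = (let S = [None, Some False, Some True]; D = [Lft, Stay, Rgt] in
     List.product [0..<Q] (List.product S (List.product S (List.product D (List.product D D)))))"

definition lidx :: "nat \<Rightarrow> label \<Rightarrow> nat" where
  "lidx Q l = (SOME i. i < length (labs Q) \<and> labs Q ! i = l)"

lemma mem_labs: "l \<in> set (labs Q) \<longleftrightarrow> fst l < Q"
proof -
  have D: "set [Lft, Stay, Rgt] = UNIV" using dir.exhaust by auto
  have S: "set [None, Some False, Some True] = UNIV" using option.exhaust by auto
  show ?thesis unfolding labs_def Let_def set_product D S by (cases l) simp
qed

lemma distinct_labs: "distinct (labs Q)"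
  unfolding labs_def Let_def by (intro distinct_product) simp_all

lemma lidx:
  assumes "fst l < Q"
  shows "lidx Q l < length (labs Q)" "labs Q ! lidx Q l = l"
proof -
  have "\<exists>i. i < length (labs Q) \<and> labs Q ! i = l"
    using assms mem_labs[of l Q] by (auto simp: in_set_conv_nth)
  from someI_ex[OF this] show "lidx Q l < length (labs Q)" "labs Q ! lidx Q l = l"
    by (auto simp: lidx_def)
qed

lemma lidx_nth: "i < length (labs Q) \<Longrightarrow> lidx Q (labs Q ! i) = i"
  using lidx[of "labs Q ! i" Q] mem_labs[of "labs Q ! i" Q] distinct_labs[of Q] nth_eq_iff_index_eq
  by (metis nth_mem)

section \<open>Local rules of the tour and of its inverse\<close>

definition idle :: "uf \<Rightarrow> uf" where
  "idle u = u\<lparr>uaW := None, uaC := None, udI := Stay, udW := Stay, udC := Stay, umd := False\<rparr>"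

definition stepU :: "delta \<Rightarrow> uf \<Rightarrow> uf" where
  "stepU \<delta> u = (case \<delta> (uq u) (usI u) (usW u) (usC u) of Halt b \<Rightarrow> idle u
     | Step q a b di dw dc \<Rightarrow> u\<lparr>uq := q,
         uaW := if upW u = 1 then Some a else None, uaC := if upC u = 1 then Some b else None,
         udI := clip (upI u) di, udW := clip (upW u) dw, udC := clip (upC u) dc, umd := False\<rparr>)"

definition labU :: "delta \<Rightarrow> uf \<Rightarrow> label" where
  "labU \<delta> u = (case \<delta> (uq u) (usI u) (usW u) (usC u) of Halt b \<Rightarrow> (uq u, None, None, Stay, Stay, Stay)
     | Step q a b di dw dc \<Rightarrow> (uq u, usW u, usC u, clip (upI u) di, clip (upW u) dw, clip (upC u) dc))"

definition feasU :: "label \<Rightarrow> uf \<Rightarrow> bool" where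
  "feasU l u = (case l of (q, a, b, dI, dW, dC) \<Rightarrow>
     okp (opp dI) (upI u) \<and> okp (opp dW) (upW u) \<and> okp (opp dC) (upC u))"

text \<open>The cells that a predecessor has overwritten are under its heads, which may be one move
  away from the present ones. A candidate label is hence examined in two local steps: here the heads
  are moved back, then \<open>check_pred\<close> compares the symbols. The flag \<open>umd\<close>
  tells the second step that the heads have been moved.\<close>

definition try_pred :: "label \<Rightarrow> nat \<Rightarrow> uf \<Rightarrow> uf" where
  "try_pred l fl u = (case l of (q, a, b, dI, dW, dC) \<Rightarrow>
     if feasU l u then u\<lparr>uaW := None, uaC := None, udI := opp dI, udW := opp dW, udC := opp dC, umd := True\<rparr>
     else (idle u)\<lparr>ulab := fl\<rparr>)"

text \<open>To be evaluated with the heads already at the positions of the predecessor, but with the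
  state and the tape contents of the successor.\<close>

definition is_pred :: "delta \<Rightarrow> label \<Rightarrow> uf \<Rightarrow> bool" where
  "is_pred \<delta> l u = (case l of (q, a, b, dI, dW, dC) \<Rightarrow>
     (usW u = None) = (a = None) \<and> (usC u = None) = (b = None) \<and>
     (case \<delta> q (usI u) a b of Halt _ \<Rightarrow> False
      | Step q' a' b' di dw dc \<Rightarrow> q' = uq u \<and> (a \<noteq> None \<longrightarrow> usW u = Some a') \<and> (b \<noteq> None \<longrightarrow> usC u = Some b') \<and>
          clip (upI u) di = dI \<and> clip (upW u) dw = dW \<and> clip (upC u) dc = dC))"

definition check_pred :: "delta \<Rightarrow> label \<Rightarrow> nat \<Rightarrow> nat \<Rightarrow> uf \<Rightarrow> uf" where
  "check_pred \<delta> l sc fl u = (case l of (q, a, b, dI, dW, dC) \<Rightarrow>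
     if \<not> umd u then idle u
     else if is_pred \<delta> l u then (idle u)\<lparr>uaW := a, uaC := b, uq := q, ulab := sc\<rparr>
     else (idle u)\<lparr>udI := dI, udW := dW, udC := dC, ulab := fl\<rparr>)"

definition is_Halt :: "act \<Rightarrow> bool" where
  "is_Halt a = (case a of Halt _ \<Rightarrow> True | _ \<Rightarrow> False)"

definition haltU :: "delta \<Rightarrow> uf \<Rightarrow> bool" where
  "haltU \<delta> u = is_Halt (\<delta> (uq u) (usI u) (usW u) (usC u))"

definition bitU :: "delta \<Rightarrow> uf \<Rightarrow> bool" where
  "bitU \<delta> u = (case \<delta> (uq u) (usI u) (usW u) (usC u) of Halt b \<Rightarrow> b | _ \<Rightarrow> False)"

definition fwd1 :: "nat \<Rightarrow> delta \<Rightarrow> uf \<Rightarrow> uf" where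
  "fwd1 Q \<delta> u = (if ulab u = length (labs Q) then
      (if haltU \<delta> u then (idle u)\<lparr>uans := Some (bitU \<delta> u), ulab := 0\<rparr>
       else (stepU \<delta> u)\<lparr>ulab := Suc (lidx Q (labU \<delta> u))\<rparr>)
     else try_pred (labs Q ! ulab u) (Suc (ulab u)) u)"

definition fwd2 :: "nat \<Rightarrow> delta \<Rightarrow> uf \<Rightarrow> uf" where
  "fwd2 Q \<delta> u = (if umd u \<and> ulab u < length (labs Q) then check_pred \<delta> (labs Q ! ulab u) 0 (Suc (ulab u)) u else idle u)"

definition bwd1 :: "nat \<Rightarrow> delta \<Rightarrow> uf \<Rightarrow> uf" where
  "bwd1 Q \<delta> u = (if ulab u = 0 then
      (if haltU \<delta> u then (idle u)\<lparr>ulab := length (labs Q)\<rparr>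
       else (stepU \<delta> u)\<lparr>ulab := lidx Q (labU \<delta> u)\<rparr>)
     else try_pred (labs Q ! (ulab u - 1)) (ulab u - 1) u)"

definition bwd2 :: "nat \<Rightarrow> delta \<Rightarrow> uf \<Rightarrow> uf" where
  "bwd2 Q \<delta> u = (if umd u then check_pred \<delta> (labs Q ! (ulab u - 1)) (length (labs Q)) (ulab u - 1) u else idle u)"

definition tour_forward :: "nat \<Rightarrow> delta \<Rightarrow> uf sf com" where
  "tour_forward Q \<delta> = local_step True (fwd1 Q \<delta>) ;; local_step True (fwd2 Q \<delta>)"

definition tour_backward :: "nat \<Rightarrow> delta \<Rightarrow> uf sf com" where
  "tour_backward Q \<delta> = local_step True (bwd1 Q \<delta>) ;; local_step True (bwd2 Q \<delta>)"

section \<open>The configuration graph and the abstract tour\<close>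

locale tour =
  fixes Q :: nat and \<delta> :: delta and x :: "bool list" and s m :: nat
  assumes valid: "valid Q \<delta>"
begin

definition wf :: "cfg \<Rightarrow> bool" where
  "wf c \<longleftrightarrow> result c = None \<and> st c < Q \<and> ih c \<le> length x + 1 \<and> wh c \<le> s + 1 \<and> ch c \<le> m + 1 \<and>
     length (wt c) = s \<and> length (ct c) = m"

definition dl :: "cfg \<Rightarrow> act" where
  "dl c = \<delta> (st c) (rd x (ih c)) (rd (wt c) (wh c)) (rd (ct c) (ch c))"

definition halting :: "cfg \<Rightarrow> bool" where
  "halting c = is_Halt (dl c)"

definition next_cfg :: "cfg \<Rightarrow> cfg" where
  "next_cfg c = step \<delta> x c"

text \<open>\<open>labU\<close> reads only the state and the observations, so the rest of the
  control record may be \<open>undefined\<close>.\<close>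

definition lab :: "cfg \<Rightarrow> label" where
  "lab c = labU \<delta> (observe x c (undefined\<lparr>uq := st c\<rparr>))"

lemma observe_simps [simp]:
  "uq (observe x c u) = uq u" "ulab (observe x c u) = ulab u" "uans (observe x c u) = uans u" "umd (observe x c u) = umd u"
  "usI (observe x c u) = rd x (ih c)" "usW (observe x c u) = rd (wt c) (wh c)" "usC (observe x c u) = rd (ct c) (ch c)"
  "upI (observe x c u) = pcode (length x) (ih c)" "upW (observe x c u) = pcode (length (wt c)) (wh c)"
  "upC (observe x c u) = pcode (length (ct c)) (ch c)"
  by (simp_all add: observe_def)

lemma labU_observe: "uq u = st c \<Longrightarrow> labU \<delta> (observe x c u) = lab c"
  by (simp add: lab_def labU_def split: act.split)

lemma haltU_observe: "uq u = st c \<Longrightarrow> haltU \<delta> (observe x c u) = halting c"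
  by (simp add: haltU_def halting_def dl_def)

lemma lab_fst: "fst (lab c) = st c"
  by (simp add: lab_def labU_def split: act.splits)

lemma next_cfg_eq:
  assumes "wf c" "dl c = Step q a b di dw dc"
  shows "next_cfg c = c\<lparr>st := q, ih := shift (clip (pcode (length x) (ih c)) di) (ih c),
     wt := wr (wt c) (wh c) a, wh := shift (clip (pcode s (wh c)) dw) (wh c),
     ct := wr (ct c) (ch c) b, ch := shift (clip (pcode m (ch c)) dc) (ch c)\<rparr>"
  using assms by (simp add: next_cfg_def step_def wf_def dl_def mv_clip)

lemma wf_next_cfg:
  assumes "wf c" "\<not> halting c"
  shows "wf (next_cfg c)"
proof -
  obtain q a b di dw dc where d: "dl c = Step q a b di dw dc"
    using assms(2) by (cases "dl c") (auto simp: halting_def is_Halt_def)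
  have "q < Q" using valid assms(1) d unfolding valid_def wf_def dl_def by blast
  then show ?thesis
    unfolding next_cfg_eq[OF assms(1) d] using assms(1) shift_le[OF _ ok_move_clip] by (simp add: wf_def)
qed

lemma pcode_interior: "p \<le> n + 1 \<Longrightarrow> pcode n p = 1 \<longleftrightarrow> 1 \<le> p \<and> p \<le> n"
  by (auto simp: pcode_def)

lemma wr_pcode: "length xs = n \<Longrightarrow> p \<le> n + 1 \<Longrightarrow> put (if pcode n p = 1 then Some a else None) xs p = wr xs p a"
  using pcode_interior[of p n] by (auto simp: put_def wr_def)

lemma stepU_correct:
  assumes "wf c" "\<not> halting c" "uq u = st c" "g = (stepU \<delta> (observe x c u))\<lparr>ulab := l\<rparr>"
  shows "ok_act x g c" "(apply_act g c)\<lparr>st := uq g\<rparr> = next_cfg c" "\<not> umd g" "uans g = uans u" "uq g = st (next_cfg c)"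
proof -
  obtain q a b di dw dc where d: "dl c = Step q a b di dw dc"
    using assms(2) by (cases "dl c") (auto simp: halting_def is_Halt_def)
  have g: "g = (observe x c u)\<lparr>ulab := l, uq := q,
         uaW := if pcode s (wh c) = 1 then Some a else None, uaC := if pcode m (ch c) = 1 then Some b else None,
         udI := clip (pcode (length x) (ih c)) di, udW := clip (pcode s (wh c)) dw,
         udC := clip (pcode m (ch c)) dc, umd := False\<rparr>"
    using assms d by (simp add: stepU_def dl_def wf_def)
  show "ok_act x g c"
    using assms(1) pcode_interior[of "wh c" s] pcode_interior[of "ch c" m]
    by (auto simp: g ok_act_def wf_def ok_move_clip ok_write_def)
  show "(apply_act g c)\<lparr>st := uq g\<rparr> = next_cfg c"
    unfolding next_cfg_eq[OF assms(1) d] apply_act_def g using assms(1)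
    by (simp add: wf_def wr_pcode split del: if_split del: One_nat_def)
  show "\<not> umd g" "uans g = uans u" "uq g = st (next_cfg c)"
    unfolding next_cfg_eq[OF assms(1) d] by (simp_all add: g)
qed

definition is_child :: "cfg \<Rightarrow> nat \<Rightarrow> cfg \<Rightarrow> bool" where
  "is_child c i c' \<longleftrightarrow> wf c' \<and> \<not> halting c' \<and> next_cfg c' = c \<and> lidx Q (lab c') = i"

definition unmove :: "label \<Rightarrow> cfg \<Rightarrow> cfg" where
  "unmove l c = (case l of (q, a, b, dI, dW, dC) \<Rightarrow>
     c\<lparr>ih := shift (opp dI) (ih c), wh := shift (opp dW) (wh c), ch := shift (opp dC) (ch c)\<rparr>)"

definition restore :: "label \<Rightarrow> cfg \<Rightarrow> cfg" where
  "restore l c = (case l of (q, a, b, dI, dW, dC) \<Rightarrow>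
     c\<lparr>st := q, wt := put a (wt c) (wh c), ct := put b (ct c) (ch c)\<rparr>)"

text \<open>The label gives the moves and hence the old head positions; with the old state and the
  old symbols at these positions everything that the step has changed is recovered.\<close>

lemma child_restore:
  assumes c: "wf c'" "\<not> halting c'" and nxc: "next_cfg c' = c" and l: "lab c' = l" and u: "uq u = st c" "uq u' = st c"
  shows "feasU l (observe x c u)" "is_pred \<delta> l (observe x (unmove l c) u')" "restore l (unmove l c) = c'"
proof -
  obtain q a b di dw dc where d: "dl c' = Step q a b di dw dc"
    using c(2) by (cases "dl c'") (auto simp: halting_def is_Halt_def)
  define dI where dI: "dI = clip (pcode (length x) (ih c')) di"
  define dW where dW: "dW = clip (pcode s (wh c')) dw"
  define dC where dC: "dC = clip (pcode m (ch c')) dc"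
  note dd = dI dW dC
  have l': "l = (st c', rd (wt c') (wh c'), rd (ct c') (ch c'), dI, dW, dC)"
    using l d c(1) by (simp add: lab_def labU_def dl_def dd wf_def)
  have cc: "c = c'\<lparr>st := q, ih := shift dI (ih c'), wt := wr (wt c') (wh c') a, wh := shift dW (wh c'),
     ct := wr (ct c') (ch c') b, ch := shift dC (ch c')\<rparr>"
    using nxc next_cfg_eq[OF c(1) d] by (simp add: dd)
  have ok: "ok_move dI (length x) (ih c')" "ok_move dW s (wh c')" "ok_move dC m (ch c')"
    using c(1) by (auto simp: dd wf_def ok_move_clip)
  note oo = ok_move_opp[OF _ ok(1)] ok_move_opp[OF _ ok(2)] ok_move_opp[OF _ ok(3)]
  have w: "ih c' \<le> length x + 1" "wh c' \<le> s + 1" "ch c' \<le> m + 1" "length (wt c') = s" "length (ct c') = m"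
    using c(1) by (auto simp: wf_def)
  show "feasU l (observe x c u)"
    using oo w okp_pcode[OF shift_le[OF w(1) ok(1)]] okp_pcode[OF shift_le[OF w(2) ok(2)]]
      okp_pcode[OF shift_le[OF w(3) ok(3)]] by (simp add: l' feasU_def cc)
  have bk: "unmove l c = c\<lparr>ih := ih c', wh := wh c', ch := ch c'\<rparr>"
    using oo w by (simp add: unmove_def l' cc)
  show "is_pred \<delta> l (observe x (unmove l c) u')"
    unfolding bk using d u w tape_undo[of "wt c'" "wh c'" _ a] tape_undo[of "ct c'" "ch c'" _ b]
    by (auto simp: is_pred_def l' cc dl_def dd)
  show "restore l (unmove l c) = c'"
    unfolding bk unfolding restore_def l' using tape_undo(1)[of "wt c'" "wh c'" _ a] tape_undo(1)[of "ct c'" "ch c'" _ b]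
    by (simp add: cc)
qed

text \<open>The converse: \<open>is_pred\<close> says that the transition of the restored
  configuration writes exactly the present symbols, makes exactly the labelled moves and enters the
  present state. Passing the two local tests thus certifies a genuine predecessor.\<close>

lemma restore_child:
  assumes c: "wf c" and l: "fst l < Q" and u: "uq u = st c" "uq u' = st c"
    and f: "feasU l (observe x c u)" and k: "is_pred \<delta> l (observe x (unmove l c) u')"
  shows "wf (restore l (unmove l c))" "\<not> halting (restore l (unmove l c))" "next_cfg (restore l (unmove l c)) = c"
    "lab (restore l (unmove l c)) = l"
proof -
  obtain q a b dI dW dC where l': "l = (q, a, b, dI, dW, dC)" by (metis prod_cases6)
  have w: "ih c \<le> length x + 1" "wh c \<le> s + 1" "ch c \<le> m + 1" "length (wt c) = s" "length (ct c) = m"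
    using c by (auto simp: wf_def)
  have ok: "ok_move (opp dI) (length x) (ih c)" "ok_move (opp dW) s (wh c)" "ok_move (opp dC) m (ch c)"
    using f w by (auto simp: feasU_def l' okp_pcode)
  note oo = ok_move_opp[OF w(1) ok(1)] ok_move_opp[OF w(2) ok(2)] ok_move_opp[OF w(3) ok(3)]
  note p = shift_le[OF w(1) ok(1)] shift_le[OF w(2) ok(2)] shift_le[OF w(3) ok(3)]
  let ?c = "restore l (unmove l c)"
  have cc: "?c = c\<lparr>st := q, ih := shift (opp dI) (ih c), wt := put a (wt c) (shift (opp dW) (wh c)),
     wh := shift (opp dW) (wh c), ct := put b (ct c) (shift (opp dC) (ch c)), ch := shift (opp dC) (ch c)\<rparr>"
    by (simp add: restore_def unmove_def l')
  show wf: "wf ?c" unfolding cc using c l p by (simp add: wf_def l')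
  obtain a' b' di dw dc where d: "\<delta> q (rd x (shift (opp dI) (ih c))) a b = Step (st c) a' b' di dw dc"
    and ab: "(rd (wt c) (shift (opp dW) (wh c)) = None) = (a = None)" "(rd (ct c) (shift (opp dC) (ch c)) = None) = (b = None)"
      "a \<noteq> None \<Longrightarrow> rd (wt c) (shift (opp dW) (wh c)) = Some a'" "b \<noteq> None \<Longrightarrow> rd (ct c) (shift (opp dC) (ch c)) = Some b'"
    and cl: "clip (pcode (length x) (shift (opp dI) (ih c))) di = dI" "clip (pcode s (shift (opp dW) (wh c))) dw = dW"
      "clip (pcode m (shift (opp dC) (ch c))) dc = dC"
    using k u w by (auto simp: is_pred_def l' unmove_def split: act.splits)
  note ta = tape_redo[OF ab(1,3)] and tb = tape_redo[OF ab(2,4)]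
  have dl: "dl ?c = Step (st c) a' b' di dw dc"
    using d ta tb by (simp add: dl_def cc)
  then show "\<not> halting ?c" by (simp add: halting_def is_Halt_def)
  show "next_cfg ?c = c"
    unfolding next_cfg_eq[OF wf dl] using oo cl ta tb by (simp add: cc)
  show "lab ?c = l"
    unfolding cc using d ta tb cl w by (simp add: lab_def labU_def l')
qed

lemma child_unique:
  assumes "is_child c i c1" "is_child c i c2"
  shows "c1 = c2"
proof -
  note c1 = assms(1)[unfolded is_child_def] and c2 = assms(2)[unfolded is_child_def]
  have "labs Q ! lidx Q (lab c1) = lab c1" "labs Q ! lidx Q (lab c2) = lab c2"
    using lidx(2)[of "lab c1" Q] lidx(2)[of "lab c2" Q] lab_fst[of c1] lab_fst[of c2] c1 c2
    by (auto simp: wf_def)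
  then have l: "lab c1 = lab c2" using c1 c2 by simp
  let ?u = "undefined\<lparr>uq := st c\<rparr>"
  have r1: "restore (lab c1) (unmove (lab c1) c) = c1"
    by (rule child_restore(3)[where u = ?u and u' = ?u]) (use c1 in simp_all)
  have r2: "restore (lab c2) (unmove (lab c2) c) = c2"
    by (rule child_restore(3)[where u = ?u and u' = ?u]) (use c2 in simp_all)
  show ?thesis using r1[unfolded l] r2 by (rule trans[OF sym])
qed

text \<open>\<open>sc\<close> and \<open>fl\<close> are the tour positions after success and
  failure. Descending is common to the tour and its inverse, which differ here only in these two
  values and in the label that they try.\<close>

definition down :: "cfg \<Rightarrow> nat \<Rightarrow> nat \<Rightarrow> nat \<Rightarrow> cfg \<times> nat" where
  "down c i sc fl = (if \<exists>c'. is_child c i c' then (THE c'. is_child c i c', sc) else (c, fl))"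

lemma down_child: "is_child c i c' \<Longrightarrow> down c i sc fl = (c', sc)"
  unfolding down_def using child_unique by (auto intro!: the_equality)

lemma is_child_nth:
  assumes "i < length (labs Q)"
  shows "is_child c i c' \<longleftrightarrow> wf c' \<and> \<not> halting c' \<and> next_cfg c' = c \<and> lab c' = labs Q ! i"
  using lidx(2)[of "lab c'" Q] lab_fst[of c'] lidx_nth[OF assms] by (auto simp: is_child_def wf_def)

text \<open>A tour state \<open>(c, i)\<close> means that the predecessors of \<open>c\<close> with label index below \<open>i\<close> have been
  visited.  At the root the tour starts again, so that it can be undone without knowing where it stopped.\<close>

definition tour_next :: "cfg \<times> nat \<Rightarrow> cfg \<times> nat" where
  "tour_next = (\<lambda>(c, i). if i = length (labs Q) then (if halting c then (c, 0) else (next_cfg c, Suc (lidx Q (lab c))))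
     else down c i 0 (Suc i))"

text \<open>At position \<open>i\<close> the label treated last is \<open>i - 1\<close>. A subtree
  is entered backwards at its last position, with all labels treated.\<close>

definition tour_prev :: "cfg \<times> nat \<Rightarrow> cfg \<times> nat" where
  "tour_prev = (\<lambda>(c, i). if i = 0 then (if halting c then (c, length (labs Q)) else (next_cfg c, lidx Q (lab c)))
     else down c (i - 1) (length (labs Q)) (i - 1))"

definition good :: "cfg \<times> nat \<Rightarrow> bool" where
  "good = (\<lambda>(c, i). wf c \<and> i \<le> length (labs Q))"

lemma tour_next_good: "good z \<Longrightarrow> good (tour_next z)"
proof (cases z)
  case (Pair c i)
  assume g: "good z"
  show ?thesis
  proof (cases "i = length (labs Q)")
    case True
    have "lidx Q (lab c) < length (labs Q)" using lidx(1)[of "lab c" Q] g lab_fst by (auto simp: Pair good_def wf_def)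
    then show ?thesis using g True wf_next_cfg by (auto simp: Pair good_def tour_next_def)
  next
    case False
    show ?thesis
    proof (cases "\<exists>c'. is_child c i c'")
      case True
      then obtain c' where c': "is_child c i c'" by blast
      then show ?thesis using False down_child[OF c'] by (auto simp: Pair good_def tour_next_def is_child_def)
    next
      case f: False
      then show ?thesis using False g by (auto simp: Pair good_def tour_next_def down_def)
    qed
  qed
qed

text \<open>The four kinds of moves have inverses: ascending along an edge is undone by descending
  along it and vice versa, skipping a label without predecessor by skipping it backwards, and the
  restart at the root by the reverse jump.\<close>

lemma tour_prev_tour_next:
  assumes "good z"
  shows "tour_prev (tour_next z) = z"
proof (cases z)
  case (Pair c i)
  have w: "wf c" "i \<le> length (labs Q)" using assms by (auto simp: Pair good_def)
  show ?thesis
  proof (cases "i = length (labs Q)")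
    case True
    show ?thesis
    proof (cases "halting c")
      case h: True
      then show ?thesis using True by (simp add: Pair tour_next_def tour_prev_def)
    next
      case False
      then have "is_child (next_cfg c) (lidx Q (lab c)) c" using w by (simp add: is_child_def)
      then show ?thesis using True False by (simp add: Pair tour_next_def tour_prev_def down_child)
    qed
  next
    case False
    show ?thesis
    proof (cases "\<exists>c'. is_child c i c'")
      case True
      then obtain c' where c': "is_child c i c'" by blast
      then show ?thesis using False by (auto simp: Pair tour_next_def tour_prev_def down_child is_child_def)
    next
      case f: False
      then show ?thesis using False by (simp add: Pair tour_next_def tour_prev_def down_def)
    qed
  qed
qed

lemma tour_prev_tour_next_pow:
  assumes "good z"
  shows "(tour_prev ^^ n) ((tour_next ^^ n) z) = z"
proof -
  have g: "good ((tour_next ^^ n) z)" for n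
    by (induction n) (use assms tour_next_good in auto)
  show ?thesis
  proof (induction n)
    case (Suc n)
    have "(tour_prev ^^ Suc n) ((tour_next ^^ Suc n) z) = (tour_prev ^^ n) (tour_prev (tour_next ((tour_next ^^ n) z)))"
      by (simp add: funpow_swap1)
    then show ?case using Suc tour_prev_tour_next[OF g] by simp
  qed simp
qed

section \<open>The programs perform the abstract tour\<close>

definition represents_tour :: "bool list \<Rightarrow> bool list \<Rightarrow> cfg \<times> nat \<Rightarrow> uf ast \<Rightarrow> bool" where
  "represents_tour pre post z a \<longleftrightarrow> represents True x pre post (fst z) a \<and> uq (us a) = st (fst z) \<and> ulab (us a) = snd z"

lemma represents_st [simp]: "represents ph x pre post (c\<lparr>st := q\<rparr>) a = represents ph x pre post c a"
  by (simp add: represents_def)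

lemma apply_act_idle: "apply_act (idle u) c = c" "ok_act x (idle u) c"
  "apply_act ((idle u)\<lparr>ulab := i\<rparr>) c = c" "ok_act x ((idle u)\<lparr>ulab := i\<rparr>) c"
  "apply_act ((idle u)\<lparr>uans := b, ulab := i\<rparr>) c = c" "ok_act x ((idle u)\<lparr>uans := b, ulab := i\<rparr>) c"
  by (simp_all add: apply_act_def idle_def ok_act_def ok_move_def ok_write_def shift_def put_def)

lemma idle_simps [simp]: "uq (idle u) = uq u" "ulab (idle u) = ulab u" "uans (idle u) = uans u"
  "umd (idle u) = False"
  by (simp_all add: idle_def)

text \<open>Shared by both directions of the tour. If the label is infeasible, both local steps
  leave the configuration as it is; if it is feasible but the symbols do not match, the second step
  returns the heads.\<close>

lemma wp_down:
  assumes ts: "represents_tour pre post (c, j) a" and wf: "wf c" and i: "i < length (labs Q)"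
    and f1: "f1 (observe x c (us a)) = try_pred (labs Q ! i) fl (observe x c (us a))"
    and f2: "\<And>u. ulab u = j \<Longrightarrow> umd u \<Longrightarrow> f2 u = check_pred \<delta> (labs Q ! i) sc fl u" "\<And>u. \<not> umd u \<Longrightarrow> f2 u = idle u"
  shows "wp x X (local_step True f1 ;; local_step True f2) (25 * tape_time X)
    (\<lambda>b. represents_tour pre post (down c i sc fl) b \<and> uans (us b) = uans (us a) \<and> frame a b) a"
proof -
  define l where "l = labs Q ! i"
  obtain q a' b' dI dW dC where l': "l = (q, a', b', dI, dW, dC)" by (metis prod_cases6)
  have lQ: "fst l < Q" using mem_labs[of l Q] i by (simp add: l_def)
  let ?P = "\<lambda>b. represents_tour pre post (down c i sc fl) b \<and> uans (us b) = uans (us a) \<and> frame a b"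
  have vr: "represents True x pre post c a" and uq: "uq (us a) = st c" and ul: "ulab (us a) = j"
    using ts by (auto simp: represents_tour_def)
  have w: "ih c \<le> length x + 1" "wh c \<le> s + 1" "ch c \<le> m + 1" "length (wt c) = s" "length (ct c) = m"
    using wf by (auto simp: wf_def)
  let ?v = "observe x c (us a)"
  have T: "12 * tape_time X + 12 * tape_time X + 1 \<le> 25 * tape_time X"
    using tape_time_ge[of X] sweep_time_ge[of X] by linarith
  \<comment> \<open>The link between graph and program: a predecessor with this label exists exactly
    if both local tests succeed, and it is then the restored configuration.\<close>
  have child: "is_child c i c' \<longleftrightarrow> feasU l ?v \<and> is_pred \<delta> l (observe x (unmove l c) u) \<and> c' = restore l (unmove l c)"
    if "uq u = st c" for c' u
  proof
    assume "is_child c i c'"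
    then have h: "wf c'" "\<not> halting c'" "next_cfg c' = c" "lab c' = l"
      unfolding is_child_nth[OF i] l_def[symmetric] by auto
    note cr = child_restore[OF h uq that]
    show "feasU l ?v \<and> is_pred \<delta> l (observe x (unmove l c) u) \<and> c' = restore l (unmove l c)"
      using cr(1) cr(2) cr(3)[symmetric] by (intro conjI)
  next
    assume h: "feasU l ?v \<and> is_pred \<delta> l (observe x (unmove l c) u) \<and> c' = restore l (unmove l c)"
    note rc = restore_child[OF wf lQ uq that h[THEN conjunct1] h[THEN conjunct2, THEN conjunct1]]
    show "is_child c i c'"
      unfolding is_child_nth[OF i] l_def[symmetric] h[THEN conjunct2, THEN conjunct2]
      using rc by (intro conjI)
  qed
  show ?thesis
  proof (cases "feasU l ?v")
    case False
    have g1: "f1 ?v = (idle ?v)\<lparr>ulab := fl\<rparr>" using False f1 by (simp add: l_def[symmetric] try_pred_def l')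
    have o1: "ok_act x (f1 ?v) c" and v1: "apply_act (f1 ?v) c = c" unfolding g1 by (simp_all add: apply_act_idle)
    have dn: "down c i sc fl = (c, fl)" using False child[OF uq] by (simp add: down_def)
    have 2: "wp x X (local_step True f2) (12 * tape_time X) ?P b"
      if b: "represents True x pre post c b" "frame a b" "us b = f1 ?v" for b
    proof -
      have g2: "f2 (observe x c (us b)) = idle (observe x c (us b))" by (rule f2(2)) (simp add: b g1)
      show ?thesis
        by (rule wp_local_step[where g = f2, OF b(1)], unfold g2 apply_act_idle)
          (use b uq frame_trans in \<open>auto simp: apply_act_idle dn represents_tour_def g1\<close>)
    qed
    show ?thesis
      by (rule wp_weaken[OF wp_Seq T], rule wp_local_step[where g = f1, OF vr o1], unfold v1, rule 2)
  next
    case True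
    have ok: "ok_move (opp dI) (length x) (ih c)" "ok_move (opp dW) s (wh c)" "ok_move (opp dC) m (ch c)"
      using True w okp_pcode[OF w(1)] okp_pcode[OF w(2)] okp_pcode[OF w(3)] by (auto simp: feasU_def l')
    note oo = ok_move_opp[OF w(1) ok(1)] ok_move_opp[OF w(2) ok(2)] ok_move_opp[OF w(3) ok(3)]
    note p = shift_le[OF w(1) ok(1)] shift_le[OF w(2) ok(2)] shift_le[OF w(3) ok(3)]
    have g1: "f1 ?v = ?v\<lparr>uaW := None, uaC := None, udI := opp dI, udW := opp dW, udC := opp dC, umd := True\<rparr>"
      using True f1 by (simp add: l_def[symmetric] try_pred_def l')
    have v1: "apply_act (f1 ?v) c = unmove l c" by (simp add: g1 apply_act_def unmove_def l' put_def)
    have o1: "ok_act x (f1 ?v) c" using ok w by (simp add: g1 ok_act_def ok_write_def)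
    have 2: "wp x X (local_step True f2) (12 * tape_time X) ?P b"
      if b: "represents True x pre post (unmove l c) b" "frame a b" "us b = f1 ?v" for b
    proof -
      let ?w = "observe x (unmove l c) (us b)"
      have u: "uq (us b) = st c" "ulab ?w = j" "umd ?w" "uans ?w = uans (us a)" "uq ?w = st c"
        using b g1 uq ul by simp_all
      have g2: "f2 ?w = check_pred \<delta> l sc fl ?w" using f2(1)[of ?w] u by (simp add: l_def)
      show ?thesis
      proof (cases "is_pred \<delta> l ?w")
        case k: True
        have e: "f2 ?w = (idle ?w)\<lparr>uaW := a', uaC := b', uq := q, ulab := sc\<rparr>"
          using k u(3) g2 by (simp add: check_pred_def l')
        have dn: "down c i sc fl = (restore l (unmove l c), sc)"
          by (rule down_child) (use child[OF u(1)] True k in blast)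
        have v2: "(apply_act (f2 ?w) (unmove l c))\<lparr>st := q\<rparr> = restore l (unmove l c)"
          unfolding e by (simp add: apply_act_def idle_def restore_def l' shift_def)
        have "a' \<noteq> None \<longrightarrow> rd (wt c) (shift (opp dW) (wh c)) \<noteq> None"
          "b' \<noteq> None \<longrightarrow> rd (ct c) (shift (opp dC) (ch c)) \<noteq> None"
          using k by (auto simp: is_pred_def l' unmove_def)
        then have o2: "ok_act x (f2 ?w) (unmove l c)"
          unfolding e by (auto simp: ok_act_def idle_def ok_move_def ok_write_def unmove_def l' rd_def split: if_splits)
        have vv: "represents True x pre post (restore l (unmove l c)) d = represents True x pre post (apply_act (f2 ?w) (unmove l c)) d" for d
          unfolding v2[symmetric] by simp
        have fe: "uq (f2 ?w) = q" "ulab (f2 ?w) = sc" "uans (f2 ?w) = uans (us a)"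
          unfolding e using u by simp_all
        have stq: "st (restore l (unmove l c)) = q" by (simp add: restore_def l')
        show ?thesis
        proof (rule wp_local_step[where g = f2, OF b(1) o2], intro conjI)
          fix d assume d: "represents True x pre post (apply_act (f2 ?w) (unmove l c)) d" "frame b d" "us d = f2 ?w"
          show "represents_tour pre post (down c i sc fl) d"
            unfolding dn represents_tour_def fst_conv snd_conv vv stq d(3) using d(1) fe by (intro conjI)
          show "uans (us d) = uans (us a)" unfolding d(3) by (rule fe)
          show "frame a d" using b(2) d(2) by (rule frame_trans)
        qed
      next
        case k: False
        have e: "f2 ?w = (idle ?w)\<lparr>udI := dI, udW := dW, udC := dC, ulab := fl\<rparr>"
          using k u(3) g2 by (simp add: check_pred_def l')
        have fe: "uq (f2 ?w) = st c" "ulab (f2 ?w) = fl" "uans (f2 ?w) = uans (us a)"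
          unfolding e using u by simp_all
        have dn: "down c i sc fl = (c, fl)" using k child[OF u(1)] by (simp add: down_def)
        have v2: "apply_act (f2 ?w) (unmove l c) = c"
          unfolding e using oo by (simp add: apply_act_def idle_def unmove_def l' put_def)
        have o2: "ok_act x (f2 ?w) (unmove l c)"
          unfolding e using oo w by (simp add: ok_act_def idle_def ok_write_def unmove_def l')
        show ?thesis
          by (rule wp_local_step[where g = f2, OF b(1) o2], unfold v2)
            (use b u fe frame_trans in \<open>auto simp: dn represents_tour_def\<close>)
      qed
    qed
    show ?thesis
      by (rule wp_weaken[OF wp_Seq T], rule wp_local_step[where g = f1, OF vr o1], unfold v1, rule 2)
  qed
qed

text \<open>Moves other than descents are complete after the first local step; \<open>umd\<close> is
  then false and the second step is idle.\<close>

lemma wp_up: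
  assumes ts: "represents_tour pre post (c, j) a" and ok: "ok_act x (f1 (observe x c (us a))) c"
    and c': "\<And>d. represents True x pre post c' d = represents True x pre post (apply_act (f1 (observe x c (us a))) c) d"
    and u: "\<not> umd (f1 (observe x c (us a)))" "uq (f1 (observe x c (us a))) = st c'" "ulab (f1 (observe x c (us a))) = j'"
      "uans (f1 (observe x c (us a))) = an"
    and f2: "\<And>u. \<not> umd u \<Longrightarrow> f2 u = idle u"
  shows "wp x X (local_step True f1 ;; local_step True f2) (25 * tape_time X)
    (\<lambda>b. represents_tour pre post (c', j') b \<and> uans (us b) = an \<and> frame a b) a"
proof -
  have vr: "represents True x pre post c a" using ts by (auto simp: represents_tour_def)
  let ?v = "observe x c (us a)"
  have T: "12 * tape_time X + 12 * tape_time X + 1 \<le> 25 * tape_time X"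
    using tape_time_ge[of X] sweep_time_ge[of X] by linarith
  let ?P = "\<lambda>b. represents_tour pre post (c', j') b \<and> uans (us b) = an \<and> frame a b"
  have 2: "wp x X (local_step True f2) (12 * tape_time X) ?P b"
    if b: "represents True x pre post (apply_act (f1 ?v) c) b" "frame a b" "us b = f1 ?v" for b
  proof -
    let ?w = "observe x (apply_act (f1 ?v) c) (us b)"
    have e: "f2 ?w = idle ?w" by (rule f2) (use u b in simp)
    show ?thesis
      by (rule wp_local_step[where g = f2, OF b(1)], unfold e apply_act_idle)
        (use b u frame_trans in \<open>auto simp: apply_act_idle represents_tour_def c'\<close>)
  qed
  show ?thesis
    by (rule wp_weaken[OF wp_Seq T], rule wp_local_step[where g = f1, OF vr ok], rule 2)
qed

text \<open>The answer is recorded when the tour restarts at the root. The backward tour does not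
  touch it, so that it survives the undoing.\<close>

lemma wp_tour_forward:
  assumes ts: "represents_tour pre post z a" and g: "good z"
  shows "wp x X (tour_forward Q \<delta>) (25 * tape_time X)
    (\<lambda>b. represents_tour pre post (tour_next z) b \<and> frame a b \<and>
       uans (us b) = (if snd z = length (labs Q) \<and> halting (fst z) then Some (bitU \<delta> (observe x (fst z) (us a))) else uans (us a))) a"
proof (cases z)
  case (Pair c i)
  have wf: "wf c" and uq: "uq (us a) = st c" and ul: "ulab (us a) = i" and i: "i \<le> length (labs Q)"
    using ts g by (auto simp: represents_tour_def Pair good_def)
  have fwd2: "\<not> umd u \<Longrightarrow> fwd2 Q \<delta> u = idle u" for u by (simp add: fwd2_def)
  note ts' = ts[unfolded Pair]
  show ?thesis
  proof (cases "i = length (labs Q)")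
    case True
    show ?thesis
    proof (cases "halting c")
      case h: True
      have e: "fwd1 Q \<delta> (observe x c (us a)) = (idle (observe x c (us a)))\<lparr>uans := Some (bitU \<delta> (observe x c (us a))), ulab := 0\<rparr>"
        using True h haltU_observe[OF uq] ul by (simp add: fwd1_def)
      show ?thesis
        unfolding tour_forward_def
        by (rule wp_mono[OF wp_up[where ?f1.0 = "fwd1 Q \<delta>" and c' = c and j' = 0, OF ts' _ _ _ _ _ _ fwd2]])
          (use True h uq in \<open>auto simp: e apply_act_idle Pair tour_next_def\<close>)
    next
      case h: False
      have e: "fwd1 Q \<delta> (observe x c (us a)) = (stepU \<delta> (observe x c (us a)))\<lparr>ulab := Suc (lidx Q (lab c))\<rparr>"
        using True h haltU_observe[OF uq] labU_observe[OF uq] ul by (simp add: fwd1_def)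
      note sc = stepU_correct[OF wf h uq e]
      have vv: "represents True x pre post (next_cfg c) d = represents True x pre post (apply_act (fwd1 Q \<delta> (observe x c (us a))) c) d" for d
        unfolding sc(2)[symmetric] by (rule represents_st)
      have ulf: "ulab (fwd1 Q \<delta> (observe x c (us a))) = Suc (lidx Q (lab c))" unfolding e by simp
      show ?thesis
        unfolding tour_forward_def
        by (rule wp_mono[OF wp_up[where ?f1.0 = "fwd1 Q \<delta>" and ?f2.0 = "fwd2 Q \<delta>", OF ts' sc(1) vv sc(3) sc(5) ulf sc(4) fwd2]])
          (use True h in \<open>auto simp: Pair tour_next_def\<close>)
    qed
  next
    case False
    have "wp x X (local_step True (fwd1 Q \<delta>) ;; local_step True (fwd2 Q \<delta>)) (25 * tape_time X)
      (\<lambda>b. represents_tour pre post (down c i 0 (Suc i)) b \<and> uans (us b) = uans (us a) \<and> frame a b) a"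
      by (rule wp_down[OF ts' wf])
        (use False i ul in \<open>auto simp: fwd1_def fwd2_def\<close>)
    then show ?thesis unfolding tour_forward_def
      by (rule wp_mono) (use False in \<open>auto simp: Pair tour_next_def\<close>)
  qed
qed

lemma wp_tour_backward:
  assumes ts: "represents_tour pre post z a" and g: "good z"
  shows "wp x X (tour_backward Q \<delta>) (25 * tape_time X)
    (\<lambda>b. represents_tour pre post (tour_prev z) b \<and> frame a b \<and> uans (us b) = uans (us a)) a"
proof (cases z)
  case (Pair c i)
  have wf: "wf c" and uq: "uq (us a) = st c" and ul: "ulab (us a) = i" and i: "i \<le> length (labs Q)"
    using ts g by (auto simp: represents_tour_def Pair good_def)
  have bwd2: "\<not> umd u \<Longrightarrow> bwd2 Q \<delta> u = idle u" for u by (simp add: bwd2_def)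
  note ts' = ts[unfolded Pair]
  show ?thesis
  proof (cases "i = 0")
    case True
    show ?thesis
    proof (cases "halting c")
      case h: True
      have e: "bwd1 Q \<delta> (observe x c (us a)) = (idle (observe x c (us a)))\<lparr>ulab := length (labs Q)\<rparr>"
        using True h haltU_observe[OF uq] ul by (simp add: bwd1_def)
      show ?thesis
        unfolding tour_backward_def
        by (rule wp_mono[OF wp_up[where ?f1.0 = "bwd1 Q \<delta>" and c' = c and j' = "length (labs Q)", OF ts' _ _ _ _ _ _ bwd2]])
          (use True h uq in \<open>auto simp: e apply_act_idle Pair tour_prev_def\<close>)
    next
      case h: False
      have e: "bwd1 Q \<delta> (observe x c (us a)) = (stepU \<delta> (observe x c (us a)))\<lparr>ulab := lidx Q (lab c)\<rparr>"
        using True h haltU_observe[OF uq] labU_observe[OF uq] ul by (simp add: bwd1_def)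
      note sc = stepU_correct[OF wf h uq e]
      have vv: "represents True x pre post (next_cfg c) d = represents True x pre post (apply_act (bwd1 Q \<delta> (observe x c (us a))) c) d" for d
        unfolding sc(2)[symmetric] by (rule represents_st)
      have ulf: "ulab (bwd1 Q \<delta> (observe x c (us a))) = lidx Q (lab c)" unfolding e by simp
      show ?thesis
        unfolding tour_backward_def
        by (rule wp_mono[OF wp_up[where ?f1.0 = "bwd1 Q \<delta>" and ?f2.0 = "bwd2 Q \<delta>", OF ts' sc(1) vv sc(3) sc(5) ulf sc(4) bwd2]])
          (use True h in \<open>auto simp: Pair tour_prev_def\<close>)
    qed
  next
    case False
    have "wp x X (local_step True (bwd1 Q \<delta>) ;; local_step True (bwd2 Q \<delta>)) (25 * tape_time X)
      (\<lambda>b. represents_tour pre post (down c (i - 1) (length (labs Q)) (i - 1)) b \<and> uans (us b) = uans (us a) \<and> frame a b) a"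
      by (rule wp_down[OF ts' wf])
        (use False i ul in \<open>auto simp: bwd1_def bwd2_def\<close>)
    then show ?thesis unfolding tour_backward_def
      by (rule wp_mono) (use False in \<open>auto simp: Pair tour_prev_def\<close>)
  qed
qed

end

section \<open>Size of the tour\<close>

text \<open>A word within distance \<open>D + 1\<close> arises from one within distance
  \<open>D\<close> by at most one flip. The additional position \<open>m\<close> in
  \<open>?f\<close> encodes that nothing is flipped, whence the base \<open>m + 1\<close>.\<close>

lemma card_hamming_ball:
  "card {\<tau>. length \<tau> = m \<and> hamming \<tau> \<sigma> \<le> D} \<le> (m + 1) ^ D"
  if "length \<sigma> = m"
proof (induction D)
  case 0
  have "{\<tau>. length \<tau> = m \<and> hamming \<tau> \<sigma> \<le> 0} \<subseteq> {\<sigma>}"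
  proof (intro subsetI, simp only: mem_Collect_eq singleton_iff, elim conjE)
    fix \<tau> :: "bool list" assume h: "hamming \<tau> \<sigma> \<le> 0" "length \<tau> = m"
    then have "{i. i < length \<tau> \<and> \<tau> ! i \<noteq> \<sigma> ! i} = {}" by (simp add: hamming_def)
    then show "\<tau> = \<sigma>" using h that by (auto intro: nth_equalityI)
  qed
  then have "card {\<tau>. length \<tau> = m \<and> hamming \<tau> \<sigma> \<le> 0} \<le> card {\<sigma>}" by (intro card_mono) auto
  then show ?case by simp
next
  case (Suc D)
  let ?B = "\<lambda>D. {\<tau>. length \<tau> = m \<and> hamming \<tau> \<sigma> \<le> D}"
  let ?f = "\<lambda>(p, \<tau>). if p < m then \<tau>[p := \<not> \<tau> ! p] else \<tau>"
  have fin: "finite (?B D)" by (rule finite_subset[OF _ finite_lists_length_eq[of "UNIV :: bool set" m]]) auto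
  have "?B (Suc D) \<subseteq> ?f ` ({..m} \<times> ?B D)"
  proof
    fix \<tau> assume t: "\<tau> \<in> ?B (Suc D)"
    show "\<tau> \<in> ?f ` ({..m} \<times> ?B D)"
    proof (cases "hamming \<tau> \<sigma> \<le> D")
      case True
      then show ?thesis using t by (intro image_eqI[of _ _ "(m, \<tau>)"]) auto
    next
      case False
      then have "{i. i < length \<tau> \<and> \<tau> ! i \<noteq> \<sigma> ! i} \<noteq> {}"
        unfolding hamming_def by (metis card.empty zero_le)
      then obtain p where p: "p < m" "\<tau> ! p \<noteq> \<sigma> ! p" using t by blast
      let ?t = "\<tau>[p := \<not> \<tau> ! p]"
      have "{i. i < length ?t \<and> ?t ! i \<noteq> \<sigma> ! i} = {i. i < length \<tau> \<and> \<tau> ! i \<noteq> \<sigma> ! i} - {p}"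
        using p t by (auto simp: nth_list_update split: if_splits)
      then have "hamming ?t \<sigma> = hamming \<tau> \<sigma> - 1" using p t by (simp add: hamming_def card_Diff_singleton)
      then have m1: "?t \<in> ?B D" using t by auto
      have m2: "\<tau> = ?f (p, ?t)" using p t list_update_id[of \<tau> p] by (simp del: list_update_id)
      show ?thesis by (rule image_eqI[where f = ?f and x = "(p, ?t)", OF m2]) (use p m1 in simp)
    qed
  qed
  then have "card (?B (Suc D)) \<le> card ({..m} \<times> ?B D)" using fin by (intro surj_card_le) auto
  also have "\<dots> = (m + 1) * card (?B D)" by (simp add: card_cartesian_product)
  also have "\<dots> \<le> (m + 1) * (m + 1) ^ D" by (rule mult_le_mono2[OF Suc])
  finally show ?case by simp
qed

section \<open>Trees of halting configurations and the length of a tour\<close>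

context tour
begin

inductive leads :: "cfg \<Rightarrow> nat \<Rightarrow> cfg \<Rightarrow> bool" where
  leads_0: "halting c \<Longrightarrow> leads c 0 c"
| leads_Suc: "\<not> halting c \<Longrightarrow> leads (next_cfg c) n r \<Longrightarrow> leads c (Suc n) r"

lemma leads_unique: "leads c n r \<Longrightarrow> leads c n' r' \<Longrightarrow> n = n' \<and> r = r'"
proof (induction arbitrary: n' r' rule: leads.induct)
  case (leads_0 c)
  then show ?case using leads.cases[of c n' r'] by blast
next
  case (leads_Suc c n r)
  from leads_Suc.prems show ?case
  proof cases
    case leads_0
    then show ?thesis using leads_Suc.hyps(1) by simp
  next
    case l: (leads_Suc m)
    then show ?thesis using leads_Suc.IH[of m r'] by simp
  qed
qed

lemma leads_halting: "leads c n r \<Longrightarrow> halting r"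
  by (induction rule: leads.induct) auto

lemma leads_wf: "leads c n r \<Longrightarrow> wf c \<Longrightarrow> wf r"
  by (induction rule: leads.induct) (auto intro: wf_next_cfg)

definition tree :: "cfg \<Rightarrow> cfg set" where
  "tree r = {c. wf c \<and> (\<exists>n. leads c n r)}"

abbreviation P :: nat where "P \<equiv> length (labs Q)"

lemma card_wf: "finite {c. wf c}" "card {c. wf c} \<le> Q * (length x + 2) * (s + 2) * (m + 2) * 2 ^ s * 2 ^ m"
proof -
  let ?f = "\<lambda>c. (st c, ih c, wh c, ch c, wt c, ct c)"
  let ?L = "\<lambda>k. {xs :: bool list. length xs = k}"
  let ?T = "{..<Q} \<times> {..length x + 1} \<times> {..s + 1} \<times> {..m + 1} \<times> ?L s \<times> ?L m"
  have L: "finite (?L k)" "card (?L k) = 2 ^ k" for k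
    using finite_lists_length_eq[of "UNIV :: bool set" k] card_lists_length_eq[of "UNIV :: bool set" k] by auto
  have inj: "inj_on ?f {c. wf c}" by (auto simp: inj_on_def wf_def intro!: cfg.equality)
  have sub: "?f ` {c. wf c} \<subseteq> ?T" by (auto simp: wf_def)
  have fT: "finite ?T" using L by (intro finite_cartesian_product) auto
  show "finite {c. wf c}" using inj_on_finite[OF inj sub fT] .
  have "card {c. wf c} \<le> card ?T" using card_inj_on_le[OF inj sub fT] .
  also have "card ?T = Q * (length x + 2) * (s + 2) * (m + 2) * 2 ^ s * 2 ^ m"
    by (simp add: card_cartesian_product L algebra_simps)
  finally show "card {c. wf c} \<le> Q * (length x + 2) * (s + 2) * (m + 2) * 2 ^ s * 2 ^ m" .
qed

lemma finite_tree: "finite (tree r)"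
  by (rule finite_subset[OF _ card_wf(1)]) (auto simp: tree_def)

lemma tree_child: "c \<in> tree r \<Longrightarrow> is_child c i c' \<Longrightarrow> c' \<in> tree r"
  by (auto simp: tree_def is_child_def intro: leads_Suc)

lemma tree_next_cfg: "c \<in> tree r \<Longrightarrow> \<not> halting c \<Longrightarrow> next_cfg c \<in> tree r"
  by (auto simp: tree_def wf_next_cfg elim: leads.cases)

lemma tour_next_tree:
  assumes "c \<in> tree r" "i \<le> P"
  shows "tour_next (c, i) \<in> tree r \<times> {..P}"
proof -
  have "snd (tour_next (c, i)) \<le> P"
    using tour_next_good[of "(c, i)"] assms by (cases "tour_next (c, i)") (auto simp: good_def tree_def)
  moreover have "fst (tour_next (c, i)) \<in> tree r"
  proof (cases "\<exists>c'. is_child c i c'")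
    case True
    then obtain c' where c': "is_child c i c'" by blast
    show ?thesis using assms(1) tree_next_cfg tree_child[OF assms(1) c'] down_child[OF c'] by (auto simp: tour_next_def)
  next
    case False
    then show ?thesis using assms(1) tree_next_cfg by (auto simp: tour_next_def down_def)
  qed
  ultimately show ?thesis by (cases "tour_next (c, i)") auto
qed

lemma tour_next_pow_tree:
  assumes "z \<in> tree r \<times> {..P}"
  shows "(tour_next ^^ t) z \<in> tree r \<times> {..P}"
  by (induction t) (use assms tour_next_tree in auto)

text \<open>Two nested inductions. The outer one is on \<open>B - n\<close>, because a predecessor
  of a node at depth \<open>n\<close> has depth \<open>n + 1\<close> and depths are bounded by
  \<open>B\<close>; the inner one is on the number of labels not yet treated.\<close>

lemma tour_subtree:
  assumes B: "\<And>c n. c \<in> tree r \<Longrightarrow> leads c n r \<Longrightarrow> n \<le> B"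
  shows "c \<in> tree r \<Longrightarrow> leads c n r \<Longrightarrow> i \<le> P \<Longrightarrow> \<exists>t. (tour_next ^^ t) (c, i) = (c, P)"
proof (induction "B - n" arbitrary: c n i rule: less_induct)
  case less
  from less.prems(3) show ?case
  proof (induction "P - i" arbitrary: i)
    case 0
    then show ?case by (intro exI[of _ 0]) auto
  next
    case (Suc k)
    have iP: "i < P" using Suc by simp
    obtain t where t: "(tour_next ^^ t) (c, Suc i) = (c, P)" using Suc(1)[of "Suc i"] Suc(2) iP by (metis Suc_diff_Suc Suc_inject Suc_leI)
    have "\<exists>t'. (tour_next ^^ t') (c, i) = (c, Suc i)"
    proof (cases "\<exists>c'. is_child c i c'")
      case True
      then obtain c' where c': "is_child c i c'" by blast
      have l': "leads c' (Suc n) r" using c' less.prems by (auto simp: is_child_def intro: leads_Suc)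
      have "Suc n \<le> B" using B[OF tree_child[OF less.prems(1) c'] l'] .
      then have "\<exists>t. (tour_next ^^ t) (c', 0) = (c', P)"
        by (intro less.hyps[of "Suc n"]) (use tree_child[OF less.prems(1) c'] l' in auto)
      then obtain t1 where t1: "(tour_next ^^ t1) (c', 0) = (c', P)" by blast
      have "tour_next (c, i) = (c', 0)" using iP down_child[OF c'] by (simp add: tour_next_def)
      moreover have "tour_next (c', P) = (c, Suc i)" using c' by (simp add: tour_next_def is_child_def)
      ultimately have "(tour_next ^^ Suc (t1 + 1)) (c, i) = (c, Suc i)"
        using t1 by (simp add: funpow_swap1)
      then show ?thesis by blast
    next
      case False
      then have "tour_next (c, i) = (c, Suc i)" using iP by (simp add: tour_next_def down_def)
      then show ?thesis by (intro exI[of _ 1]) simp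
    qed
    then obtain t' where "(tour_next ^^ t') (c, i) = (c, Suc i)" by blast
    then have "(tour_next ^^ (t + t')) (c, i) = (c, P)" using t by (simp add: funpow_add)
    then show ?case by blast
  qed
qed

text \<open>From \<open>(c, P)\<close> the tour ascends to the successor of \<open>c\<close> and
  then finishes the remaining subtrees there, which leads to position \<open>P\<close> again. This
  repeats along the run of the machine up to the root.\<close>

lemma tour_root:
  assumes "c \<in> tree r"
  shows "\<exists>t. (tour_next ^^ t) (c, P) = (r, P)"
proof -
  define dep where "dep c = (THE n. leads c n r)" for c
  have dep: "leads c n r \<Longrightarrow> dep c = n" for c n
    unfolding dep_def using leads_unique by blast
  have B: "n \<le> Max (dep ` tree r)" if "c \<in> tree r" "leads c n r" for c n
    using that finite_tree[of r] dep[OF that(2)] by (metis Max_ge finite_imageI imageI)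
  obtain n where "leads c n r" using assms by (auto simp: tree_def)
  then show ?thesis using assms
  proof (induction n arbitrary: c)
    case 0
    then have "c = r" by (auto elim: leads.cases)
    then show ?case by (intro exI[of _ 0]) simp
  next
    case (Suc n)
    have c: "\<not> halting c" "leads (next_cfg c) n r" using Suc.prems(1) by (auto elim: leads.cases)
    have n: "next_cfg c \<in> tree r" using tree_next_cfg[OF Suc.prems(2) c(1)] .
    have "Suc (lidx Q (lab c)) \<le> P"
      using lidx(1)[of "lab c" Q] lab_fst[of c] Suc.prems(2) by (auto simp: tree_def wf_def)
    then obtain t1 where t1: "(tour_next ^^ t1) (next_cfg c, Suc (lidx Q (lab c))) = (next_cfg c, P)"
      using tour_subtree[of r "Max (dep ` tree r)" "next_cfg c" n] B n c(2) by blast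
    obtain t2 where t2: "(tour_next ^^ t2) (next_cfg c, P) = (r, P)" using Suc.IH[OF c(2) n] by blast
    have "tour_next (c, P) = (next_cfg c, Suc (lidx Q (lab c)))" using c(1) by (simp add: tour_next_def)
    then have "(tour_next ^^ Suc (t2 + t1)) (c, P) = (r, P)"
      unfolding funpow_Suc_right o_apply using t1 t2 by (simp add: funpow_add)
    then show ?case by blast
  qed
qed

text \<open>Up to the first visit of \<open>(r, P)\<close> all tour states are different: the tour
  is deterministic, so a repetition could be cut out and would yield an earlier visit. There are
  only \<open>(P + 1) * card (tree r)\<close> states over the tree.\<close>

lemma tour_root_bound:
  assumes "c \<in> tree r"
  shows "\<exists>t < (P + 1) * card (tree r). (tour_next ^^ t) (c, P) = (r, P)"
proof -
  define t where "t = (LEAST t. (tour_next ^^ t) (c, P) = (r, P))"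
  have t: "(tour_next ^^ t) (c, P) = (r, P)" unfolding t_def using LeastI_ex[OF tour_root[OF assms]] .
  have min: "(tour_next ^^ k) (c, P) \<noteq> (r, P)" if "k < t" for k using that not_less_Least unfolding t_def by blast
  have "inj_on (\<lambda>k. (tour_next ^^ k) (c, P)) {..t}"
  proof (rule linorder_inj_onI)
    fix k l assume kl: "k < l" "k \<in> {..t}" "l \<in> {..t}"
    show "(tour_next ^^ k) (c, P) \<noteq> (tour_next ^^ l) (c, P)"
    proof
      assume e: "(tour_next ^^ k) (c, P) = (tour_next ^^ l) (c, P)"
      have "(tour_next ^^ (t - l + k)) (c, P) = (tour_next ^^ (t - l + l)) (c, P)" using e by (simp only: funpow_add o_apply)
      then have "(tour_next ^^ (t - l + k)) (c, P) = (r, P)" using kl t by simp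
      moreover have "t - l + k < t" using kl by auto
      ultimately show False using min by blast
    qed
  qed auto
  then have "card {..t} \<le> card (tree r \<times> {..P})"
  proof (rule card_inj_on_le)
    show "(\<lambda>k. (tour_next ^^ k) (c, P)) ` {..t} \<subseteq> tree r \<times> {..P}"
    proof (rule image_subsetI)
      show "(tour_next ^^ k) (c, P) \<in> tree r \<times> {..P}" for k by (rule tour_next_pow_tree) (use assms in auto)
    qed
  qed (use finite_tree in auto)
  then have "t < (P + 1) * card (tree r)" by (simp add: card_cartesian_product mult.commute)
  then show ?thesis using t by blast
qed

lemma run_Suc_front: "run \<delta> x c (Suc t) = run \<delta> x (step \<delta> x c) t"
  by (simp add: run_def funpow_swap1)

lemma run_leads:
  "result (run \<delta> x c t) = Some b \<Longrightarrow> wf c \<Longrightarrow>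
     \<exists>n r. leads c n r \<and> n < t \<and> dl r = Halt b \<and> ct (run \<delta> x c t) = ct r"
proof (induction t arbitrary: c)
  case 0
  then show ?case by (simp add: wf_def)
next
  case (Suc t)
  show ?case
  proof (cases "dl c")
    case (Halt b')
    then have s: "step \<delta> x c = c\<lparr>result := Some b'\<rparr>" using Suc.prems(2) by (simp add: step_def wf_def dl_def)
    then have "run \<delta> x (step \<delta> x c) t = c\<lparr>result := Some b'\<rparr>"
      using run_halted[of \<delta> x "step \<delta> x c" 0 t] by simp
    then have "b' = b" "ct (run \<delta> x c (Suc t)) = ct c" using Suc.prems(1) by (simp_all add: run_Suc_front)
    moreover have "leads c 0 c" by (rule leads_0) (simp add: halting_def Halt is_Halt_def)
    ultimately show ?thesis using Halt by blast
  next
    case Step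
    then have h: "\<not> halting c" by (simp add: halting_def is_Halt_def)
    have "\<exists>n r. leads (next_cfg c) n r \<and> n < t \<and> dl r = Halt b \<and> ct (run \<delta> x (next_cfg c) t) = ct r"
      by (rule Suc.IH) (use Suc.prems wf_next_cfg h in \<open>auto simp: run_Suc_front next_cfg_def\<close>)
    then show ?thesis using leads_Suc[OF h] unfolding run_Suc_front next_cfg_def by (metis Suc_mono)
  qed
qed

lemma wf_init: "length \<tau> = m \<Longrightarrow> wf (init s \<tau>)"
  using valid by (auto simp: wf_def init_def valid_def)

text \<open>By \<open>tour_root_bound\<close>, a tour of \<open>T\<close> steps from the initial
  configuration then passes through the state in which the answer is recorded.\<close>

definition fits :: "nat \<Rightarrow> bool list \<Rightarrow> bool" where
  "fits T \<tau> \<longleftrightarrow> (\<exists>r. init s \<tau> \<in> tree r \<and> (P + 1) * card (tree r) \<le> T)"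

text \<open>\<open>far\<close> is controlled by the expected distance, \<open>near\<close> by
  counting large trees. Each of the two sets contains at most a quarter of all contents.\<close>

lemma card_not_fits:
  assumes H: "\<And>\<tau>. length \<tau> = m \<Longrightarrow> \<exists>t b. result (run \<delta> x (init s \<tau>) t) = Some b"
    and e: "exp_dist \<delta> x s m \<le> e" and D: "4 * e \<le> real D + 1"
    and T: "4 * ((m + 1) ^ D * ((P + 1) * (Q * (length x + 2) * (s + 2) * (m + 2) * 2 ^ s))) \<le> T" "0 < T"
  shows "2 * card {\<tau>. length \<tau> = m \<and> \<not> fits T \<tau>} \<le> 2 ^ m"
proof -
  let ?L = "{\<tau> :: bool list. length \<tau> = m}"
  let ?F = "\<lambda>\<tau>. ct (final \<delta> x (init s \<tau>))"
  define far where "far = {\<tau> \<in> ?L. D < hamming \<tau> (?F \<tau>)}"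
  define near where "near = {\<tau> \<in> ?L. hamming \<tau> (?F \<tau>) \<le> D \<and> \<not> fits T \<tau>}"
  define big where "big = {r. wf r \<and> halting r \<and> T < (P + 1) * card (tree r)}"
  have finL: "finite ?L" using finite_lists_length_eq[of "UNIV :: bool set" m] by simp
  have fin: "finite far" "finite near" "finite big"
    unfolding far_def near_def big_def using finL card_wf(1) by (auto intro: finite_subset[OF _ card_wf(1)])
  \<comment> \<open>Markov's inequality: contents in \<open>far\<close> contribute at least
    \<open>D + 1\<close> each, and \<open>4 * e \<le> real D + 1\<close> makes them at most a
    quarter.\<close>
  have "real (D + 1) * real (card far) = (\<Sum>\<tau>\<in>far. real (D + 1))" by simp
  also have "\<dots> \<le> (\<Sum>\<tau>\<in>far. real (hamming \<tau> (?F \<tau>)))" by (rule sum_mono) (auto simp: far_def)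
  also have "\<dots> \<le> (\<Sum>\<tau>\<in>?L. real (hamming \<tau> (?F \<tau>)))" using finL by (intro sum_mono2) (auto simp: far_def)
  also have "\<dots> \<le> e * 2 ^ m" using e by (simp add: exp_dist_def divide_le_eq)
  finally have "real (D + 1) * real (card far) \<le> e * 2 ^ m" .
  then have "real (D + 1) * (4 * real (card far)) \<le> (4 * e) * 2 ^ m" by simp
  also have "\<dots> \<le> real (D + 1) * 2 ^ m" using D by (intro mult_right_mono) auto
  finally have "real (4 * card far) \<le> real (2 ^ m)" by (simp add: mult_le_cancel_left)
  then have far: "4 * card far \<le> 2 ^ m" by (simp only: of_nat_le_iff)
  have root: "\<exists>r. init s \<tau> \<in> tree r \<and> wf r \<and> halting r \<and> ?F \<tau> = ct r" if len: "length \<tau> = m" for \<tau>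
  proof -
    obtain t b where r: "result (run \<delta> x (init s \<tau>) t) = Some b" using H len by blast
    obtain n r where "leads (init s \<tau>) n r" "ct (run \<delta> x (init s \<tau>) t) = ct r"
      using run_leads[OF r wf_init[OF len]] by blast
    then show ?thesis
      using final_eq_run[of \<delta> x "init s \<tau>" t] r wf_init[OF len] leads_wf leads_halting by (auto simp: tree_def)
  qed
  \<comment> \<open>The root of its tree carries the final content, so a content in
    \<open>near\<close> lies in the Hamming ball of radius \<open>D\<close> around the content of a
    large root. Each root accounts for only polynomially many of them.\<close>
  have "near \<subseteq> (\<Union>r\<in>big. {\<tau>. length \<tau> = m \<and> hamming \<tau> (ct r) \<le> D})"
  proof
    fix \<tau> assume t: "\<tau> \<in> near"
    then obtain r where r: "init s \<tau> \<in> tree r" "wf r" "halting r" "?F \<tau> = ct r" using root by (auto simp: near_def)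
    then have "r \<in> big" using t unfolding near_def fits_def big_def by auto
    then show "\<tau> \<in> (\<Union>r\<in>big. {\<tau>. length \<tau> = m \<and> hamming \<tau> (ct r) \<le> D})" using t r by (auto simp: near_def)
  qed
  then have "card near \<le> card (\<Union>r\<in>big. {\<tau>. length \<tau> = m \<and> hamming \<tau> (ct r) \<le> D})"
    by (rule card_mono[rotated]) (use fin in \<open>auto intro!: finite_UN_I intro: finite_subset[OF _ finL]\<close>)
  also have "\<dots> \<le> (\<Sum>r\<in>big. card {\<tau>. length \<tau> = m \<and> hamming \<tau> (ct r) \<le> D})"
    using fin(3) by (rule card_UN_le)
  also have "\<dots> \<le> (\<Sum>r\<in>big. (m + 1) ^ D)"
    by (rule sum_mono) (auto simp: big_def wf_def intro: card_hamming_ball[unfolded Suc_eq_plus1[symmetric]])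
  finally have near: "card near \<le> card big * (m + 1) ^ D" by simp
  \<comment> \<open>By \<open>leads_unique\<close> trees with different roots are disjoint, so the
    number of all configurations limits how many of them can be large.\<close>
  have "(\<Sum>r\<in>big. card (tree r)) = card (\<Union>r\<in>big. tree r)"
    by (rule card_UN_disjoint[symmetric]) (use fin finite_tree leads_unique in \<open>auto simp: tree_def\<close>)
  also have "\<dots> \<le> card {c. wf c}" by (rule card_mono[OF card_wf(1)]) (auto simp: tree_def)
  also have "\<dots> \<le> Q * (length x + 2) * (s + 2) * (m + 2) * 2 ^ s * 2 ^ m" by (rule card_wf(2))
  finally have S: "(\<Sum>r\<in>big. card (tree r)) \<le> Q * (length x + 2) * (s + 2) * (m + 2) * 2 ^ s * 2 ^ m" .
  have "card big * T = (\<Sum>r\<in>big. T)" by simp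
  also have "\<dots> \<le> (\<Sum>r\<in>big. (P + 1) * card (tree r))" by (rule sum_mono) (auto simp: big_def)
  also have "\<dots> = (P + 1) * (\<Sum>r\<in>big. card (tree r))" by (simp add: sum_distrib_left)
  also have "\<dots> \<le> (P + 1) * (Q * (length x + 2) * (s + 2) * (m + 2) * 2 ^ s * 2 ^ m)" using S by (rule mult_le_mono2)
  finally have bigT: "card big * T \<le> (P + 1) * (Q * (length x + 2) * (s + 2) * (m + 2) * 2 ^ s * 2 ^ m)" .
  have "4 * card near * T \<le> 4 * (card big * (m + 1) ^ D) * T" using near by (intro mult_le_mono) auto
  also have "\<dots> = 4 * (m + 1) ^ D * (card big * T)" by (simp add: mult_ac)
  also have "\<dots> \<le> 4 * (m + 1) ^ D * ((P + 1) * (Q * (length x + 2) * (s + 2) * (m + 2) * 2 ^ s * 2 ^ m))"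
    using bigT by (rule mult_le_mono2)
  also have "\<dots> = 4 * ((m + 1) ^ D * ((P + 1) * (Q * (length x + 2) * (s + 2) * (m + 2) * 2 ^ s))) * 2 ^ m"
    by (simp only: mult_ac)
  also have "\<dots> \<le> T * 2 ^ m" using T(1) by (rule mult_le_mono1)
  finally have "4 * card near \<le> 2 ^ m" using T(2) by (simp add: mult.commute)
  moreover have "card {\<tau>. length \<tau> = m \<and> \<not> fits T \<tau>} \<le> card (far \<union> near)"
    by (rule card_mono) (use fin in \<open>auto simp: far_def near_def\<close>)
  moreover have "card (far \<union> near) \<le> card far + card near" by (rule card_Un_le)
  ultimately show ?thesis using far by linarith
qed

end

section \<open>Programs\<close>

definition same :: "nat set \<Rightarrow> uf ast \<Rightarrow> uf ast \<Rightarrow> bool" where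
  "same R a b \<longleftrightarrow> us b = us a \<and> ip b = ip a \<and> cp b = cp a \<and> cc b = cc a \<and> (\<forall>j. j \<notin> R \<longrightarrow> rg b j = rg a j)"

definition for_loop :: "nat \<Rightarrow> nat \<Rightarrow> uf sf com \<Rightarrow> uf sf com" where
  "for_loop t lm body = CLR t ;; EQ t lm ;;
     Loop (utest (\<lambda>k u a c. k \<noteq> 1)) (body ;; INC t ;; EQ t lm)"

text \<open>The invariant must not depend on the counter or on \<open>hs\<close>, since
  \<open>INC\<close> and \<open>EQ\<close> change them; the body in turn has to leave the counter
  and the limit alone.\<close>

lemma wp_for_loop:
  assumes r: "t < nregs" "lm < nregs" "t \<noteq> lm" "rg a lm = N"
    and st: "\<And>i b k v. I i b \<Longrightarrow> I i (b\<lparr>hs := k, rg := (rg b)(t := v)\<rparr>)"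
    and I0: "I 0 a"
    and Q: "\<And>b. I N b \<Longrightarrow> rg b lm = N \<Longrightarrow> Q b"
    and body: "\<And>i b. i < N \<Longrightarrow> I i b \<Longrightarrow> rg b t = i \<Longrightarrow> rg b lm = N \<Longrightarrow>
      wp x X body T (\<lambda>d. I (Suc i) d \<and> rg d t = i \<and> rg d lm = N) b"
  shows "wp x X (for_loop t lm body) ((N + 1) * (T + 3 * sweep_time X)) Q a"
proof (rule wp_bounded)
  assume bd: "bounded_regs X a"
  have NX: "N < 2 ^ X" using bd r unfolding bounded_regs_def by auto
  define J where "J i b \<longleftrightarrow> I i b \<and> rg b t = i \<and> rg b lm = N \<and> hs b = of_bool (i = N)" for i b
  have st1: "I i (b\<lparr>hs := k\<rparr>)" if "I i b" for i b k
  proof -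
    have "b\<lparr>hs := k, rg := (rg b)(t := rg b t)\<rparr> = b\<lparr>hs := k\<rparr>" by simp
    then show ?thesis using st[OF that, where k = k and v = "rg b t"] by simp
  qed
  have st2: "I i (b\<lparr>rg := (rg b)(t := v), hs := k\<rparr>)" if "I i b" for i b k v
    using st[OF that, where k = k and v = v] by (cases b) simp
  have J: "wp x X (body ;; INC t ;; EQ t lm) (T + (sweep_time X + sweep_time X + 1) + 1) (J (Suc i)) b"
    if i: "i < N" and b: "J i b" for i b
  proof (rule wp_Seq, rule wp_mono[OF body[OF i]])
    show "I i b" "rg b t = i" "rg b lm = N" using b by (auto simp: J_def)
    show "T \<le> T" by simp
    fix d assume d: "I (Suc i) d \<and> rg d t = i \<and> rg d lm = N"
    show "wp x X (INC t ;; EQ t lm) (sweep_time X + sweep_time X + 1) (J (Suc i)) d"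
      by (rule wp_rules)+ (use d r i NX in \<open>auto simp: J_def intro!: st2\<close>)
  qed
  have "wp x X (for_loop t lm body) (sweep_time X + (sweep_time X +
     (N * (T + (sweep_time X + sweep_time X + 1) + 1 + 1) + 1) + 1) + 1) Q a"
    unfolding for_loop_def
    by (rule wp_rules, rule wp_rules, rule wp_rules, rule wp_rules, rule wp_Loop_inv[where I = J])
      (use r J in \<open>auto simp: J_def intro!: st st1 st2 I0 Q\<close>)
  then show "wp x X (for_loop t lm body) ((N + 1) * (T + 3 * sweep_time X)) Q a"
  proof (rule wp_weaken)
    have V: "560 \<le> sweep_time X" by (rule sweep_time_ge)
    have "N * (T + (sweep_time X + sweep_time X + 1) + 1 + 1) \<le> N * (T + 3 * sweep_time X)"
      by (rule mult_le_mono2) (use V in linarith)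
    then show "sweep_time X + (sweep_time X + (N * (T + (sweep_time X + sweep_time X + 1) + 1 + 1) + 1) + 1) + 1
      \<le> (N + 1) * (T + 3 * sweep_time X)" using V by (simp only: add_mult_distrib mult_1)
  qed
qed

section \<open>Computing powers of the input length and the ends of the tapes\<close>

definition mult_by_n :: "nat \<Rightarrow> uf sf com" where
  "mult_by_n r = CLR 18 ;; for_loop 20 16 (ADD 18 r) ;; CLR r ;; ADD r 18"

lemma wp_mult_by_n:
  assumes r: "r < nregs" "r \<noteq> 18" "r \<noteq> 20" "r \<noteq> 16" and n: "rg a 16 = n" and l: "rg a r * n < 2 ^ X"
    and Q: "\<And>b. same {18, 20, r} a b \<Longrightarrow> rg b r = rg a r * n \<Longrightarrow> Q b"
  shows "wp x X (mult_by_n r) ((n + 4) * (5 * sweep_time X)) Q a"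
proof -
  let ?V = "sweep_time X"
  define I where "I i b \<longleftrightarrow> same {18, 20} a b \<and> rg b 18 = rg a r * i" for i b
  have li: "rg a r * Suc i < 2 ^ X" if "i < n" for i
    by (rule le_less_trans[OF mult_le_mono2 l]) (use that in simp)
  have body: "wp x X (ADD 18 r) ?V (\<lambda>d. I (Suc i) d \<and> rg d 20 = i \<and> rg d 16 = n) b"
    if i: "i < n" and b: "I i b" "rg b 20 = i" "rg b 16 = n" for i b
    by (rule wp_rules) (use b r n li[OF i] in \<open>auto simp: I_def same_def nregs_def\<close>)
  have "wp x X (mult_by_n r) (?V + ((n + 1) * (?V + 3 * ?V) + (?V + ?V + 1) + 1) + 1) Q a"
    unfolding mult_by_n_def
    by (rule wp_rules, rule wp_rules, rule wp_rules, rule wp_for_loop[where I = I and N = n], simp add: nregs_def, simp add: nregs_def,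
        simp, simp add: n, (auto simp: I_def same_def)[1], simp add: I_def same_def, (rule wp_rules)+, rule Q)
      (use r n l body in \<open>auto simp: I_def same_def nregs_def\<close>)
  then show ?thesis
    by (rule wp_weaken) (use sweep_time_ge[of X] in \<open>simp add: algebra_simps\<close>)
qed

definition power_of_n :: "nat \<Rightarrow> nat \<Rightarrow> uf sf com" where
  "power_of_n r k = CLR r ;; INC r ;; repc k (mult_by_n r)"

lemma wp_power_of_n:
  assumes r: "r < nregs" "r \<noteq> 18" "r \<noteq> 20" "r \<noteq> 16" and n: "rg a 16 = n" "0 < n" and l: "n ^ k < 2 ^ X" "1 < (2::nat) ^ X"
    and Q: "\<And>b. same {18, 20, r} a b \<Longrightarrow> rg b r = n ^ k \<Longrightarrow> Q b"
  shows "wp x X (power_of_n r k) (sweep_time X + (sweep_time X + (k * ((n + 4) * (5 * sweep_time X) + 1) + 1) + 1) + 1) Q a"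
proof -
  define I where "I i b \<longleftrightarrow> same {18, 20, r} a b \<and> rg b r = n ^ i" for i b
  have step: "wp x X (mult_by_n r) ((n + 4) * (5 * sweep_time X)) (I (Suc i)) b" if i: "i < k" and b: "I i b" for i b
  proof (rule wp_mult_by_n[OF r])
    show "rg b 16 = n" using b n r by (auto simp: I_def same_def)
    have "n ^ Suc i \<le> n ^ k" using i n by (intro power_increasing) auto
    then show "rg b r * n < 2 ^ X" using b l by (simp add: I_def mult.commute)
    show "I (Suc i) d" if "same {18, 20, r} b d" "rg d r = rg b r * n" for d
      using that b by (auto simp: I_def same_def mult.commute)
  qed
  have rep: "wp x X (repc k (mult_by_n r)) (k * ((n + 4) * (5 * sweep_time X) + 1) + 1) Q b" if "I 0 b" for b
    by (rule wp_mono[OF wp_repc[of I b k]]) (use that step Q in \<open>auto simp: I_def\<close>)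
  show ?thesis
    unfolding power_of_n_def by ((rule wp_rules)+, rule rep) (use r l in \<open>auto simp: I_def same_def\<close>)
qed

text \<open>The first move, off the left endmarker, is counted as well. The counter therefore ends
  at \<open>length x + 1\<close>, the position of the right endmarker.\<close>

definition count_input :: "uf sf com" where
  "count_input = uact (\<lambda>k u a c. (u, keep c, Rgt, Stay)) ;; INC rN1 ;;
     Loop (utest (\<lambda>k u a c. a \<noteq> None)) (uact (\<lambda>k u a c. (u, keep c, Rgt, Stay)) ;; INC rN1) ;;
     uact (\<lambda>k u a c. (u, keep c, Lft, Stay)) ;;
     Loop (utest (\<lambda>k u a c. a \<noteq> None)) (uact (\<lambda>k u a c. (u, keep c, Lft, Stay)))"

lemma wp_imove:
  assumes "Q (a\<lparr>ip := mv (length x) (ip a) d\<rparr>)"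
  shows "wp x X (uact (\<lambda>k u a c. (u, keep c, d, Stay))) 1 Q a"
  by (rule wp_uact[OF refl]) (use assms in \<open>cases a; simp\<close>)

lemma wp_cmove:
  assumes "Q (a\<lparr>cp := mv (length (cc a)) (cp a) d\<rparr>)"
  shows "wp x X (uact (\<lambda>k u a c. (u, keep c, Stay, d))) 1 Q a"
  by (rule wp_uact[OF refl]) (use assms in \<open>cases a; simp\<close>)

lemma wp_count_input:
  assumes a: "rg a rN1 = 0" "ip a = 0" and l: "length x + 1 < 2 ^ X"
    and Q: "\<And>b. same {rN1} a b \<Longrightarrow> rg b rN1 = length x + 1 \<Longrightarrow> Q b"
  shows "wp x X count_input (1 + (sweep_time X + ((length x * (1 + sweep_time X + 1 + 1) + 1) +
     (1 + (length x * (1 + 1) + 1) + 1) + 1) + 1) + 1) Q a"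
proof -
  let ?n = "length x"
  define I where "I i b \<longleftrightarrow> us b = us a \<and> cp b = cp a \<and> cc b = cc a \<and> ip b = i + 1 \<and>
     (\<forall>j. j \<noteq> rN1 \<longrightarrow> rg b j = rg a j) \<and> rg b rN1 = i + 1" for i and b :: "uf ast"
  define K where "K i b \<longleftrightarrow> us b = us a \<and> cp b = cp a \<and> cc b = cc a \<and> ip b = ?n - i \<and>
     (\<forall>j. j \<noteq> rN1 \<longrightarrow> rg b j = rg a j) \<and> rg b rN1 = ?n + 1" for i and b :: "uf ast"
  have b1: "wp x X (uact (\<lambda>k u a c. (u, keep c, Rgt, Stay)) ;; INC rN1) (1 + sweep_time X + 1) (I (Suc i)) b"
    if "i < ?n" "I i b" for i b
    by (rule wp_Seq, rule wp_imove, rule wp_rules) (use that l in \<open>auto simp: I_def mv_def nregs_def\<close>)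
  have b2: "wp x X (uact (\<lambda>k u a c. (u, keep c, Lft, Stay))) 1 (K (Suc i)) b" if "i < ?n" "K i b" for i b
    by (rule wp_imove) (use that in \<open>auto simp: K_def mv_def\<close>)
  have L2: "wp x X (Loop (utest (\<lambda>k u a c. a \<noteq> None)) (uact (\<lambda>k u a c. (u, keep c, Lft, Stay))))
     (?n * (1 + 1) + 1) Q b" if "K 0 b" for b
    by (rule wp_Loop_inv[where I = K, OF that])
      (use b2 Q a in \<open>auto simp: K_def same_def rd_def\<close>)
  have L1: "wp x X (Loop (utest (\<lambda>k u a c. a \<noteq> None)) (uact (\<lambda>k u a c. (u, keep c, Rgt, Stay)) ;; INC rN1))
     (?n * (1 + sweep_time X + 1 + 1) + 1)
     (wp x X (uact (\<lambda>k u a c. (u, keep c, Lft, Stay)) ;; Loop (utest (\<lambda>k u a c. a \<noteq> None)) (uact (\<lambda>k u a c. (u, keep c, Lft, Stay))))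
       (1 + (?n * (1 + 1) + 1) + 1) Q) b" if "I 0 b" for b
  proof (rule wp_Loop_inv[where I = I, OF that])
    fix d assume d: "I ?n d"
    show "wp x X (uact (\<lambda>k u a c. (u, keep c, Lft, Stay)) ;; Loop (utest (\<lambda>k u a c. a \<noteq> None)) (uact (\<lambda>k u a c. (u, keep c, Lft, Stay))))
       (1 + (?n * (1 + 1) + 1) + 1) Q d"
      by (rule wp_Seq, rule wp_imove, rule L2) (use d in \<open>auto simp: I_def K_def mv_def\<close>)
    show "\<not> rd x (ip d) \<noteq> None" using d by (simp add: I_def rd_def)
  next
    fix i d assume "i < ?n" "I i d"
    then show "rd x (ip d) \<noteq> None" by (simp add: I_def rd_def)
  qed (rule b1)
  show ?thesis
    unfolding count_input_def
    by (rule wp_Seq, rule wp_imove, rule wp_Seq, rule wp_rules(6), rule wp_Seq, rule L1)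
      (use a l in \<open>auto simp: I_def mv_def nregs_def\<close>)
qed

lemma floorlog2_bounds:
  assumes "0 < n"
  shows "2 ^ (floorlog 2 n - 1) \<le> n" "n < 2 ^ floorlog 2 n" "0 < floorlog 2 n"
proof -
  have f: "floorlog 2 n = nat \<lfloor>log 2 (real n)\<rfloor> + 1" using assms by (simp add: floorlog_def)
  then show "0 < floorlog 2 n" by simp
  have nn: "0 \<le> \<lfloor>log 2 (real n)\<rfloor>" using assms by simp
  have "\<lfloor>log 2 (real n)\<rfloor> = int (floorlog 2 n - 1)" using f nn by simp
  then have "2 powr real (floorlog 2 n - 1) \<le> real n \<and> real n < 2 powr (real (floorlog 2 n - 1) + 1)"
    using assms floor_log_eq_powr_iff[of "real n" 2 "int (floorlog 2 n - 1)"] by simp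
  then have h: "2 ^ (floorlog 2 n - 1) \<le> real n" "real n < 2 * 2 ^ (floorlog 2 n - 1)"
    by (simp_all add: powr_realpow powr_add)
  from h(1) show "2 ^ (floorlog 2 n - 1) \<le> n" by (metis of_nat_le_iff of_nat_numeral of_nat_power)
  have "real n < real (2 ^ (Suc (floorlog 2 n - 1)))" using h(2) by simp
  then have "n < 2 ^ Suc (floorlog 2 n - 1)" by (simp only: of_nat_less_iff)
  then show "n < 2 ^ floorlog 2 n" using f by simp
qed

text \<open>Register 19 runs through the powers of two that do not exceed \<open>n\<close>, which
  makes \<open>floorlog 2 n\<close> rounds. Each round multiplies \<open>rE\<close> by
  \<open>2 ^ k\<close>, starting from 2, so the bit length of the simulated work tape is produced
  without a logarithm.\<close>

definition set_work_end :: "nat \<Rightarrow> uf sf com" where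
  "set_work_end k = INC rE ;; INC rE ;; INC 19 ;; LE 19 16 ;;
     Loop (utest (\<lambda>h u a c. h = 1)) (ADD 19 19 ;; repc k (ADD rE rE) ;; LE 19 16)"

lemma wp_set_work_end:
  assumes a: "rg a rE = 0" "rg a 19 = 0" "rg a 16 = n" "0 < n"
    and l: "2 ^ (k * floorlog 2 n + 1) < (2::nat) ^ X" "2 ^ floorlog 2 n < (2::nat) ^ X"
    and Q: "\<And>b. same {rE, 19} a b \<Longrightarrow> rg b rE = 2 ^ (k * floorlog 2 n + 1) \<Longrightarrow> Q b"
  shows "wp x X (set_work_end k) (sweep_time X + (sweep_time X + (sweep_time X + (sweep_time X +
     (floorlog 2 n * (sweep_time X + (k * (sweep_time X + 1) + 1 + sweep_time X + 1) + 1 + 1) + 1) + 1) + 1) + 1) + 1) Q a"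
proof -
  let ?L = "floorlog 2 n" and ?V = "sweep_time X"
  note fb = floorlog2_bounds[OF a(4)]
  define I where "I i b \<longleftrightarrow> same {rE, 19} a b \<and> rg b rE = 2 ^ (k * i + 1) \<and> rg b 19 = 2 ^ i \<and> hs b = of_bool (i < ?L)" for i b
  have X1: "?L < X" "k * ?L + 1 < X" using l by (simp_all only: power_strict_increasing_iff numeral_less_iff one_less_numeral_iff semiring_norm)
  have le: "2 ^ i \<le> n \<longleftrightarrow> i < ?L" for i
  proof
    assume "2 ^ i \<le> n"
    then have "(2::nat) ^ i < 2 ^ ?L" using fb(2) by linarith
    then show "i < ?L" by simp
  next
    assume "i < ?L"
    then have "(2::nat) ^ i \<le> 2 ^ (?L - 1)" by (intro power_increasing) auto
    then show "2 ^ i \<le> n" using fb(1) by linarith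
  qed
  have body: "wp x X (ADD 19 19 ;; repc k (ADD rE rE) ;; LE 19 16) (?V + (k * (?V + 1) + 1 + ?V + 1) + 1) (I (Suc i)) b"
    if i: "i < ?L" and b: "I i b" for i b
  proof -
    define K where "K j d \<longleftrightarrow> same {rE, 19} a d \<and> rg d rE = 2 ^ (k * i + j + 1) \<and> rg d 19 = 2 ^ Suc i" for j d
    have lt: "(2::nat) ^ j < 2 ^ X" if "j \<le> k * ?L + 1 \<or> j \<le> ?L" for j
      using that X1 by (intro power_strict_increasing) auto
    have ki: "k * i + k \<le> k * ?L" using mult_le_mono2[of "Suc i" ?L k] i by simp
    have s: "wp x X (ADD rE rE) ?V (K (Suc j)) d" if "j < k" "K j d" for j d
      by (rule wp_rules) (use that lt[of "k * i + Suc j + 1"] ki in \<open>auto simp: K_def same_def nregs_def\<close>)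
    have r: "wp x X (repc k (ADD rE rE) ;; LE 19 16) (k * (?V + 1) + 1 + ?V + 1) (I (Suc i)) d" if "K 0 d" for d
    proof (rule wp_Seq, rule wp_mono[OF wp_repc[of K d k]])
      show "wp x X (LE 19 16) ?V (I (Suc i)) e" if "K k e" for e
        by (rule wp_rules) (use that a(3) le[of "Suc i"] in \<open>auto simp: K_def I_def same_def nregs_def algebra_simps\<close>)
    qed (use that s in auto)
    show ?thesis
      by (rule wp_rules, rule wp_rules, rule r) (use b i lt[of "Suc i"] in \<open>auto simp: K_def I_def same_def nregs_def\<close>)
  qed
  have lp: "wp x X (Loop (utest (\<lambda>h u a c. h = 1)) (ADD 19 19 ;; repc k (ADD rE rE) ;; LE 19 16))
     (?L * (?V + (k * (?V + 1) + 1 + ?V + 1) + 1 + 1) + 1) Q b" if "I 0 b" for b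
    by (rule wp_Loop_inv[where I = I, OF that])
      (use body Q in \<open>auto simp: I_def\<close>)
  have two: "Suc (Suc 0) < 2 ^ X" "Suc 0 < 2 ^ X"
  proof -
    have "(2::nat) ^ 1 < 2 ^ X" using X1 by (intro power_strict_increasing) auto
    then show "Suc (Suc 0) < 2 ^ X" "Suc 0 < 2 ^ X" by simp_all
  qed
  show ?thesis
    unfolding set_work_end_def
    by ((rule wp_rules)+, rule lp) (use a fb two in \<open>auto simp: I_def same_def nregs_def\<close>)
qed

section \<open>Direct simulation, the tour on one block, and the fallback\<close>

definition simU :: "delta \<Rightarrow> uf \<Rightarrow> uf" where
  "simU \<delta> u = (if haltU \<delta> u then (idle u)\<lparr>uans := Some (bitU \<delta> u)\<rparr> else stepU \<delta> u)"

definition simulate :: "bool \<Rightarrow> delta \<Rightarrow> uf sf com" where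
  "simulate ph \<delta> = Loop (utest (\<lambda>k u a c. uans u = None)) (local_step ph (simU \<delta>))"

definition cat_right :: "uf sf com" where
  "cat_right = uact (\<lambda>k u a c. (u, keep c, Stay, Rgt))"

definition cat_left :: "uf sf com" where
  "cat_left = uact (\<lambda>k u a c. (u, keep c, Stay, Lft))"

definition process_block :: "nat \<Rightarrow> delta \<Rightarrow> uf sf com" where
  "process_block Q \<delta> = uset (\<lambda>k u a c. u\<lparr>uq := 0, ulab := length (labs Q)\<rparr>) ;;
     for_loop 12 13 (tour_forward Q \<delta>) ;; for_loop 12 13 (tour_backward Q \<delta>) ;; for_loop 12 14 cat_right"

text \<open>The head stands at \<open>i * m\<close>, directly before block \<open>i\<close>: this
  cell, or the left endmarker for \<open>i = 0\<close>, is position 0 of the simulated tape.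
  Registers 13, 14, 16 and 17 hold the tour length, the block length, the input length and the
  length of the fallback tape.\<close>

definition block_start :: "bool list \<Rightarrow> nat \<Rightarrow> nat \<Rightarrow> nat \<Rightarrow> nat \<Rightarrow> bool list \<Rightarrow> nat \<Rightarrow> uf ast \<Rightarrow> bool" where
  "block_start x s m T N \<tau> i b \<longleftrightarrow> cc b = \<tau> \<and> cp b = i * m \<and> ip b = 0 \<and> rg b 0 = 0 \<and> rg b 1 = 1 \<and> rg b rI = 0 \<and>
     rg b rN1 = length x + 1 \<and> rg b rH = 1 \<and> rg b rW = 0 \<and> rg b rE = 2 ^ (s + 1) \<and> rg b rC = 0 \<and>
     rg b rCE = m + 1 \<and> rg b 13 = T \<and> rg b 14 = m \<and> rg b 16 = length x \<and> rg b 17 = N"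

definition block :: "nat \<Rightarrow> bool list \<Rightarrow> nat \<Rightarrow> bool list" where
  "block m \<tau> i = take m (drop (i * m) \<tau>)"

lemma block_split:
  assumes "(i + 1) * m \<le> length \<tau>"
  shows "\<tau> = take (i * m) \<tau> @ block m \<tau> i @ drop ((i + 1) * m) \<tau>" "length (block m \<tau> i) = m"
    "length (take (i * m) \<tau>) = i * m"
proof -
  have "drop ((i + 1) * m) \<tau> = drop m (drop (i * m) \<tau>)" by (simp add: algebra_simps)
  then show "\<tau> = take (i * m) \<tau> @ block m \<tau> i @ drop ((i + 1) * m) \<tau>"
    unfolding block_def by (metis append_take_drop_id)
qed (use assms in \<open>auto simp: block_def algebra_simps\<close>)

context tour
begin

lemma wp_simulate:
  assumes "leads c n r" "dl r = Halt res" "wf c" "represents ph x pre post c a" "uq (us a) = st c" "uans (us a) = None"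
  shows "wp x X (simulate ph \<delta>) ((n + 1) * (12 * tape_time X + 1) + 1) (\<lambda>b. uans (us b) = Some res) a"
  using assms
proof (induction arbitrary: a rule: leads.induct)
  case (leads_0 c)
  let ?v = "observe x c (us a)"
  have g: "simU \<delta> ?v = (idle ?v)\<lparr>uans := Some res\<rparr>"
    using leads_0 haltU_observe[of "us a" c] by (simp add: simU_def bitU_def dl_def)
  have o: "ok_act x ((idle ?v)\<lparr>uans := Some res\<rparr>) c"
    by (simp add: idle_def ok_act_def ok_move_def ok_write_def)
  show ?case
    unfolding simulate_def
    by (rule wp_weaken, rule wp_Loop_True, simp add: leads_0, rule wp_local_step[where g = "simU \<delta>", OF leads_0(4)],
        unfold g, rule o, rule wp_Loop_False) auto
next
  case (leads_Suc c n r)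
  let ?v = "observe x c (us a)"
  have g: "simU \<delta> ?v = stepU \<delta> ?v" using leads_Suc haltU_observe[of "us a" c] by (simp add: simU_def)
  have e: "stepU \<delta> ?v = (stepU \<delta> ?v)\<lparr>ulab := ulab (stepU \<delta> ?v)\<rparr>" by simp
  note sc = stepU_correct[OF leads_Suc.prems(2) leads_Suc.hyps(1) leads_Suc.prems(4) e]
  have IH: "wp x X (simulate ph \<delta>) ((n + 1) * (12 * tape_time X + 1) + 1) (\<lambda>b. uans (us b) = Some res) b"
    if b: "represents ph x pre post (apply_act (stepU \<delta> ?v) c) b" "us b = stepU \<delta> ?v" for b
  proof (rule leads_Suc.IH[OF leads_Suc.prems(1)])
    show "wf (next_cfg c)" using wf_next_cfg leads_Suc by blast
    show "represents ph x pre post (next_cfg c) b" unfolding sc(2)[symmetric] represents_st by (rule b)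
    show "uq (us b) = st (next_cfg c)" unfolding b(2) by (rule sc(5))
    show "uans (us b) = None" unfolding b(2) sc(4) by (rule leads_Suc.prems)
  qed
  have "wp x X (simulate ph \<delta>) (12 * tape_time X + ((n + 1) * (12 * tape_time X + 1) + 1) + 1) (\<lambda>b. uans (us b) = Some res) a"
    unfolding simulate_def
    by (rule wp_Loop_True, simp add: leads_Suc.prems, rule wp_local_step[where g = "simU \<delta>", OF leads_Suc.prems(3)],
        unfold g, rule sc(1), unfold simulate_def[symmetric], rule IH)
  then show ?case by (simp add: algebra_simps)
qed

lemma block_start_represents:
  assumes "block_start x s m T N \<tau> i b" "(i + 1) * m \<le> length \<tau>"
  shows "represents True x (take (i * m) \<tau>) (drop ((i + 1) * m) \<tau>) (init s (block m \<tau> i)) b"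
  using assms(1) block_split[OF assms(2)] by (simp add: block_start_def represents_def init_def)

lemma tree_halting: "c \<in> tree r \<Longrightarrow> halting c \<Longrightarrow> c = r"
  using leads_unique leads_0 unfolding tree_def by blast

text \<open>The tape is restored in any case. If the block does not fit, the tour may or may not
  have met the root, but an answer that was recorded is the right one.\<close>

lemma wp_process_block:
  assumes bs: "block_start x s m T N \<tau> i a" and im: "(i + 1) * m \<le> length \<tau>"
    and ld: "leads (init s (block m \<tau> i)) n0 r" and res: "dl r = Halt res"
  shows "wp x X (process_block Q \<delta>)
     (1 + ((T + 1) * (25 * tape_time X + 3 * sweep_time X) + ((T + 1) * (25 * tape_time X + 3 * sweep_time X) +
        (m + 1) * (1 + 3 * sweep_time X) + 1) + 1) + 1)
     (\<lambda>d. block_start x s m T N \<tau> (i + 1) d \<and> rg d 15 = rg a 15 \<and>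
        (uans (us d) = Some res \<or> \<not> fits T (block m \<tau> i) \<and> uans (us d) = uans (us a))) a"
proof -
  let ?pre = "take (i * m) \<tau>" and ?post = "drop ((i + 1) * m) \<tau>" and ?c = "init s (block m \<tau> i)"
  note sp = block_split[OF im]
  define z where "z = (?c, P)"
  have wfc: "wf ?c" using wf_init sp by blast
  have ct: "?c \<in> tree r" using ld wfc by (auto simp: tree_def)
  have gz: "good z" using wfc by (simp add: z_def good_def)
  have zt: "(tour_next ^^ j) z \<in> tree r \<times> {..P}" for j by (rule tour_next_pow_tree) (use ct in \<open>simp add: z_def\<close>)
  have gzj: "good ((tour_next ^^ j) z)" for j using zt[of j] by (auto simp: good_def tree_def)
  \<comment> \<open>The tree contains no halting configuration other than its root, so every
    recording during the tour, including those after a restart, gives the same answer.\<close>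
  have hit: "snd y = P \<and> halting (fst y) \<longleftrightarrow> y = (r, P)" if "y \<in> tree r \<times> {..P}" for y
    using that tree_halting leads_halting[OF ld] by (cases y) auto
  define u1 where "u1 = uans (us a)"
  define an where "an j = (if \<exists>k<j. (tour_next ^^ k) z = (r, P) then Some res else u1)" for j
  define I1 where "I1 j d \<longleftrightarrow> represents_tour ?pre ?post ((tour_next ^^ j) z) d \<and> (\<forall>k\<ge>13. rg d k = rg a k) \<and> uans (us d) = an j" for j d
  define z1 where "z1 = (tour_next ^^ T) z"
  define I2 where "I2 j d \<longleftrightarrow> represents_tour ?pre ?post ((tour_prev ^^ j) z1) d \<and> (\<forall>k\<ge>13. rg d k = rg a k) \<and> uans (us d) = an T" for j d
  \<comment> \<open>While the head crosses the block only its position differs from the start of the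
    tour; resetting \<open>cp\<close> allows the rest to be described by
    \<open>represents\<close>.\<close>
  define I3 where "I3 j d \<longleftrightarrow> represents True x ?pre ?post ?c (d\<lparr>cp := i * m\<rparr>) \<and> cp d = i * m + j \<and>
     (\<forall>k\<ge>13. rg d k = rg a k) \<and> uans (us d) = an T" for j d
  have stable: "represents_tour ?pre ?post y (d\<lparr>hs := k, rg := (rg d)(12 := v)\<rparr>) = represents_tour ?pre ?post y d" for y d k v
    by (simp add: represents_tour_def represents_def)
  \<comment> \<open>The backward tour passes through the states of the forward tour in reverse
    order, which also shows that the states it meets are \<open>good\<close>.\<close>
  have tgz: "(tour_prev ^^ j) z1 = (tour_next ^^ (T - j)) z" if "j \<le> T" for j
  proof -
    have "z1 = (tour_next ^^ j) ((tour_next ^^ (T - j)) z)" 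
      unfolding z1_def using that funpow_add[of j "T - j" tour_next] by simp
    then show ?thesis using tour_prev_tour_next_pow[OF gzj] by simp
  qed
  have body1: "wp x X (tour_forward Q \<delta>) (25 * tape_time X) (\<lambda>d. I1 (Suc j) d \<and> rg d 12 = j \<and> rg d 13 = T) b"
    if b: "I1 j b" "rg b 12 = j" "rg b 13 = T" for j b
  proof -
    let ?y = "(tour_next ^^ j) z"
    have bit: "bitU \<delta> (observe x r (us b)) = res" if "?y = (r, P)"
      using b(1) that res by (simp add: I1_def represents_tour_def bitU_def dl_def)
    have a1: "an (Suc j) = (if snd ?y = P \<and> halting (fst ?y) then Some (bitU \<delta> (observe x (fst ?y) (us b))) else an j)"
      unfolding hit[OF zt] using bit by (auto simp: an_def less_Suc_eq)
    have ts: "represents_tour ?pre ?post ?y b" using b by (simp add: I1_def)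
    show ?thesis
      by (rule wp_mono[OF wp_tour_forward[OF ts gzj]], simp, use b a1 in \<open>auto simp: I1_def frame_def\<close>)
  qed
  have body2: "wp x X (tour_backward Q \<delta>) (25 * tape_time X) (\<lambda>d. I2 (Suc j) d \<and> rg d 12 = j \<and> rg d 13 = T) b"
    if b: "j < T" "I2 j b" "rg b 12 = j" "rg b 13 = T" for j b
  proof -
    have ts: "represents_tour ?pre ?post ((tour_prev ^^ j) z1) b" using b by (simp add: I2_def)
    have g: "good ((tour_prev ^^ j) z1)" using tgz[of j] gzj b by simp
    show ?thesis
      by (rule wp_mono[OF wp_tour_backward[OF ts g]], simp, use b in \<open>auto simp: I2_def frame_def\<close>)
  qed
  have body3: "wp x X cat_right 1 (\<lambda>d. I3 (Suc j) d \<and> rg d 12 = j \<and> rg d 14 = m) b"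
    if b: "j < m" "I3 j b" "rg b 12 = j" "rg b 14 = m" for j b
  proof -
    have "cc b = \<tau>" using b(2) sp(1) by (simp add: I3_def represents_def init_def)
    then have "mv (length (cc b)) (cp b) Rgt = i * m + Suc j" using b im by (simp add: I3_def mv_def)
    then show ?thesis unfolding cat_right_def by (intro wp_cmove) (use b in \<open>auto simp: I3_def represents_def\<close>)
  qed
  have vr: "represents True x ?pre ?post ?c a" by (rule block_start_represents[OF bs im])
  have fin: "block_start x s m T N \<tau> (i + 1) d \<and> rg d 15 = rg a 15 \<and>
        (uans (us d) = Some res \<or> \<not> fits T (block m \<tau> i) \<and> uans (us d) = uans (us a))" if d: "I3 m d" for d
  proof -
    have v: "represents True x ?pre ?post ?c (d\<lparr>cp := i * m\<rparr>)" and c: "cp d = i * m + m" and k: "\<forall>k\<ge>13. rg d k = rg a k"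
      and u: "uans (us d) = an T" using d by (auto simp: I3_def)
    have "block_start x s m T N \<tau> (i + 1) d"
      using v c k bs sp by (simp add: block_start_def represents_def init_def)
    moreover have "uans (us d) = Some res" if ft: "fits T (block m \<tau> i)"
    proof -
      obtain r' where r': "?c \<in> tree r'" "(P + 1) * card (tree r') \<le> T" using ft unfolding fits_def by blast
      have "r' = r" using r'(1) ct leads_unique unfolding tree_def by blast
      then obtain t where "t < T" "(tour_next ^^ t) z = (r, P)"
        using tour_root_bound[OF ct] r'(2) unfolding z_def by (meson less_le_trans)
      then show ?thesis using u by (auto simp: an_def)
    qed
    moreover have "an T = Some res \<or> an T = uans (us a)" by (simp add: an_def u1_def)
    ultimately show ?thesis using u k by auto
  qed
  have F3: "wp x X (for_loop 12 14 cat_right) ((m + 1) * (1 + 3 * sweep_time X))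
     (\<lambda>d. block_start x s m T N \<tau> (i + 1) d \<and> rg d 15 = rg a 15 \<and>
        (uans (us d) = Some res \<or> \<not> fits T (block m \<tau> i) \<and> uans (us d) = uans (us a))) b" if b: "I3 0 b" for b
  proof (rule wp_for_loop[where I = I3 and N = m])
    show "rg b 14 = m" using b bs by (simp add: I3_def block_start_def)
    show "I3 j (d\<lparr>hs := k, rg := (rg d)(12 := v)\<rparr>)" if "I3 j d" for j d k v
      using that by (auto simp: I3_def represents_def)
  qed (use b fin body3 in \<open>auto simp: nregs_def\<close>)
  have I23: "I3 0 b" if "I2 T b" for b
  proof -
    have "(tour_prev ^^ T) z1 = z" using tgz[of T] by simp
    then have ts: "represents_tour ?pre ?post z b" using that by (simp add: I2_def)
    then have c: "cp b = i * m" "represents True x ?pre ?post ?c b" using sp by (auto simp: represents_tour_def represents_def init_def z_def)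
    then show ?thesis using that by (simp add: I3_def I2_def represents_def)
  qed
  have fwd2: "wp x X (for_loop 12 13 (tour_backward Q \<delta>) ;; for_loop 12 14 cat_right)
     ((T + 1) * (25 * tape_time X + 3 * sweep_time X) + (m + 1) * (1 + 3 * sweep_time X) + 1)
     (\<lambda>d. block_start x s m T N \<tau> (i + 1) d \<and> rg d 15 = rg a 15 \<and>
        (uans (us d) = Some res \<or> \<not> fits T (block m \<tau> i) \<and> uans (us d) = uans (us a))) b" if b: "I2 0 b" for b
  proof (rule wp_Seq, rule wp_for_loop[where I = I2 and N = T])
    show "rg b 13 = T" using b bs by (simp add: I2_def block_start_def)
    show "I2 j (d\<lparr>hs := k, rg := (rg d)(12 := v)\<rparr>)" if "I2 j d" for j d k v
      using that stable by (auto simp: I2_def)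
  qed (use b F3 I23 body2 in \<open>auto simp: nregs_def\<close>)
  have fwd1: "wp x X (for_loop 12 13 (tour_forward Q \<delta>) ;; for_loop 12 13 (tour_backward Q \<delta>) ;; for_loop 12 14 cat_right)
     ((T + 1) * (25 * tape_time X + 3 * sweep_time X) +
       ((T + 1) * (25 * tape_time X + 3 * sweep_time X) + (m + 1) * (1 + 3 * sweep_time X) + 1) + 1)
     (\<lambda>d. block_start x s m T N \<tau> (i + 1) d \<and> rg d 15 = rg a 15 \<and>
        (uans (us d) = Some res \<or> \<not> fits T (block m \<tau> i) \<and> uans (us d) = uans (us a))) b" if b: "I1 0 b" for b
  proof (rule wp_Seq, rule wp_for_loop[where I = I1 and N = T])
    show "rg b 13 = T" using b bs by (simp add: I1_def block_start_def)
    show "I1 j (d\<lparr>hs := k, rg := (rg d)(12 := v)\<rparr>)" if "I1 j d" for j d k v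
      using that stable by (auto simp: I1_def)
    show "wp x X (for_loop 12 13 (tour_backward Q \<delta>) ;; for_loop 12 14 cat_right)
     ((T + 1) * (25 * tape_time X + 3 * sweep_time X) + (m + 1) * (1 + 3 * sweep_time X) + 1)
     (\<lambda>d. block_start x s m T N \<tau> (i + 1) d \<and> rg d 15 = rg a 15 \<and>
        (uans (us d) = Some res \<or> \<not> fits T (block m \<tau> i) \<and> uans (us d) = uans (us a))) d" if "I1 T d" for d
      by (rule fwd2) (use that in \<open>simp add: I1_def I2_def z1_def\<close>)
  qed (use b body1 in \<open>auto simp: nregs_def\<close>)
  show ?thesis
    unfolding process_block_def
    by (rule wp_Seq, rule wp_uset, rule fwd1)
      (use vr in \<open>auto simp: I1_def represents_tour_def z_def represents_def an_def u1_def init_def\<close>)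
qed

end

text \<open>A machine without catalytic tape is run on the catalytic tape alone.\<close>

definition swapm :: "delta \<Rightarrow> delta" where
  "swapm \<delta> q i w c = (case \<delta> q i c None of Halt b \<Rightarrow> Halt b | Step q' a b di dw dc \<Rightarrow> Step q' False a di Stay dw)"

text \<open>The work tape of the given machine takes the place of the catalytic tape. The work head
  of \<open>swapm\<close> never leaves its endmarker, so the bit written there has no
  effect.\<close>

definition embed :: "nat \<Rightarrow> cfg \<Rightarrow> cfg" where
  "embed s d = \<lparr>st = st d, ih = ih d, wh = 0, wt = replicate s False, ch = wh d, ct = wt d, result = result d\<rparr>"

lemma embed_step:
  assumes "ct d = []"
  shows "step (swapm \<delta>) x (embed s d) = embed s (step \<delta> x d)" "ct (step \<delta> x d) = []"
proof -
  have r: "rd [] p = None" for p by (simp add: rd_def)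
  show "step (swapm \<delta>) x (embed s d) = embed s (step \<delta> x d)" "ct (step \<delta> x d) = []"
    using assms by (auto simp: step_def embed_def swapm_def r wr_def split: act.splits)
qed

lemma embed_run:
  assumes "ct d = []"
  shows "run (swapm \<delta>) x (embed s d) t = embed s (run \<delta> x d t) \<and> ct (run \<delta> x d t) = []"
  by (induction t) (use assms embed_step in \<open>auto simp: run_Suc\<close>)

lemma result_swapm:
  "result (run (swapm \<delta>) x (init s (replicate N False)) t) = result (run \<delta> x (init N []) t)"
proof -
  have "embed s (init N []) = init s (replicate N False)" by (simp add: embed_def init_def)
  moreover have "result (embed s d) = result d" for d by (simp add: embed_def)
  ultimately show ?thesis using embed_run[of "init N []" \<delta> x s t] by (simp add: init_def)
qed

definition write_zero :: "uf sf com" where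
  "write_zero = uact (\<lambda>k u a c. (u, False, Stay, Rgt))"

definition rewind_cat :: "uf sf com" where
  "rewind_cat = Loop (utest (\<lambda>k u a c. c \<noteq> None)) cat_left"

text \<open>The first \<open>N\<close> cells are zeroed to form the work tape of the polynomial-time
  machine. The cell behind them acts as its right endmarker, for which the physical tape must be
  longer than \<open>N\<close>.\<close>

definition fallback :: "delta \<Rightarrow> uf sf com" where
  "fallback \<delta> = rewind_cat ;; cat_right ;; for_loop 12 17 write_zero ;; cat_left ;; rewind_cat ;; CLR rCE ;; ADD rCE 17 ;; INC rCE ;;
     uset (\<lambda>k u a c. u\<lparr>uq := 0\<rparr>) ;; simulate True \<delta>"

lemma wp_rewind_cat:
  assumes "cp a \<le> length (cc a)" "Q (a\<lparr>cp := 0\<rparr>)"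
  shows "wp x X rewind_cat (cp a * (1 + 1) + 1) Q a"
  unfolding rewind_cat_def
proof (rule wp_Loop_inv[where I = "\<lambda>i b. b = a\<lparr>cp := cp a - i\<rparr>"])
  fix i b assume "i < cp a" "b = a\<lparr>cp := cp a - i\<rparr>"
  then show "wp x X cat_left 1 (\<lambda>b. b = a\<lparr>cp := cp a - Suc i\<rparr>) b"
    unfolding cat_left_def by (intro wp_cmove) (simp add: mv_def)
qed (use assms in \<open>auto simp: rd_def\<close>)

definition fb_time :: "nat \<Rightarrow> nat \<Rightarrow> nat \<Rightarrow> nat \<Rightarrow> nat" where
  "fb_time X p N t = p * (1 + 1) + 1 + (1 + ((N + 1) * (1 + 3 * sweep_time X) + (1 + (N * (1 + 1) + 1 +
     (sweep_time X + (sweep_time X + (sweep_time X + (1 + ((t + 1) * (12 * tape_time X + 1) + 1) + 1) + 1) + 1) + 1)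
     + 1) + 1) + 1) + 1) + 1"

text \<open>Here the locale stands for the polynomial-time machine with exchanged tapes;
  \<open>m\<close> is the length of its work tape, found in register 17, and not the length of a
  block.\<close>

lemma (in tour) wp_fallback:
  assumes a: "m < length (cc a)" "0 < m" "cp a \<le> length (cc a)" "ip a = 0" "rg a 0 = 0" "rg a 1 = 1" "rg a rI = 0"
      "rg a rN1 = length x + 1" "rg a rH = 1" "rg a rW = 0" "rg a rE = 2 ^ (s + 1)" "rg a rC = 0" "rg a 17 = m"
      "uans (us a) = None"
    and l: "m + 1 < 2 ^ X"
    and ld: "leads (init s (replicate m False)) n0 r" "n0 \<le> t0" and res: "dl r = Halt res"
  shows "wp x X (fallback \<delta>) (fb_time X (cp a) m t0) (\<lambda>b. uans (us b) = Some res) a"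
proof -
  let ?\<tau> = "cc a" and ?V = "sweep_time X"
  define ok where "ok b \<longleftrightarrow> ip b = 0 \<and> rg b 0 = 0 \<and> rg b 1 = 1 \<and> rg b rI = 0 \<and>
      rg b rN1 = length x + 1 \<and> rg b rH = 1 \<and> rg b rW = 0 \<and> rg b rE = 2 ^ (s + 1) \<and> rg b rC = 0 \<and> rg b 17 = m \<and>
      uans (us b) = None" for b :: "uf ast"
  define I where "I j b \<longleftrightarrow> ok b \<and> cp b = j + 1 \<and> cc b = replicate j False @ drop j ?\<tau>" for j b
  have body: "wp x X write_zero 1 (\<lambda>d. I (Suc j) d \<and> rg d 12 = j \<and> rg d 17 = m) b"
    if j: "j < m" and b: "I j b" "rg b 12 = j" "rg b 17 = m" for j b
  proof -
    have d: "drop j ?\<tau> = ?\<tau> ! j # drop (Suc j) ?\<tau>" using j a by (intro Cons_nth_drop_Suc[symmetric]) simp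
    have cc: "wr (cc b) (cp b) False = replicate (Suc j) False @ drop (Suc j) ?\<tau>"
      using b(1) wr_append[of "replicate j False" "?\<tau> ! j" "drop (Suc j) ?\<tau>" False]
      by (simp add: I_def d replicate_append_same[symmetric])
    have cp: "mv (length (cc b)) (cp b) Rgt = Suc j + 1" using b(1) j a by (simp add: I_def mv_def)
    show ?thesis unfolding write_zero_def
      by (rule wp_uact[OF refl]) (use b cc cp in \<open>auto simp: I_def ok_def\<close>)
  qed
  have S: "wp x X (simulate True \<delta>) ((t0 + 1) * (12 * tape_time X + 1) + 1) (\<lambda>b. uans (us b) = Some res) b"
    if b: "ok b" "cp b = 0" "cc b = replicate m False @ drop m ?\<tau>" "rg b rCE = m + 1" "uq (us b) = 0" for b
  proof -
    have "represents True x [] (drop m ?\<tau>) (init s (replicate m False)) b"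
      using b by (simp add: represents_def init_def ok_def)
    then have "wp x X (simulate True \<delta>) ((n0 + 1) * (12 * tape_time X + 1) + 1) (\<lambda>b. uans (us b) = Some res) b"
      by (rule wp_simulate[OF ld(1) res wf_init, rotated]) (use b in \<open>auto simp: ok_def init_def\<close>)
    then show ?thesis
      by (rule wp_weaken) (intro add_le_mono mult_le_mono order_refl ld(2))
  qed
  have S2: "wp x X (CLR rCE ;; ADD rCE 17 ;; INC rCE ;; uset (\<lambda>k u a c. u\<lparr>uq := 0\<rparr>) ;; simulate True \<delta>)
      (?V + (?V + (?V + (1 + ((t0 + 1) * (12 * tape_time X + 1) + 1) + 1) + 1) + 1) + 1) (\<lambda>b. uans (us b) = Some res) b"
    if b: "ok b" "cp b = 0" "cc b = replicate m False @ drop m ?\<tau>" for b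
    by ((rule wp_rules)+, rule S) (use b l in \<open>auto simp: ok_def nregs_def\<close>)
  have S3: "wp x X (cat_left ;; rewind_cat ;; CLR rCE ;; ADD rCE 17 ;; INC rCE ;; uset (\<lambda>k u a c. u\<lparr>uq := 0\<rparr>) ;; simulate True \<delta>)
      (1 + (m * (1 + 1) + 1 + (?V + (?V + (?V + (1 + ((t0 + 1) * (12 * tape_time X + 1) + 1) + 1) + 1) + 1) + 1) + 1) + 1)
      (\<lambda>b. uans (us b) = Some res) b" if b: "I m b" for b
  proof -
    let ?b = "b\<lparr>cp := m\<rparr>"
    have "wp x X (rewind_cat ;; CLR rCE ;; ADD rCE 17 ;; INC rCE ;; uset (\<lambda>k u a c. u\<lparr>uq := 0\<rparr>) ;; simulate True \<delta>)
      (cp ?b * (1 + 1) + 1 + (?V + (?V + (?V + (1 + ((t0 + 1) * (12 * tape_time X + 1) + 1) + 1) + 1) + 1) + 1) + 1)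
      (\<lambda>b. uans (us b) = Some res) ?b"
      by (rule wp_Seq, rule wp_rewind_cat, use b a in \<open>simp add: I_def\<close>, rule S2) (use b in \<open>auto simp: I_def ok_def\<close>)
    then have r: "wp x X (rewind_cat ;; CLR rCE ;; ADD rCE 17 ;; INC rCE ;; uset (\<lambda>k u a c. u\<lparr>uq := 0\<rparr>) ;; simulate True \<delta>)
      (m * (1 + 1) + 1 + (?V + (?V + (?V + (1 + ((t0 + 1) * (12 * tape_time X + 1) + 1) + 1) + 1) + 1) + 1) + 1)
      (\<lambda>b. uans (us b) = Some res) ?b" by simp
    have e: "b\<lparr>cp := mv (length (cc b)) (cp b) Lft\<rparr> = ?b" using b by (simp add: I_def mv_def)
    show ?thesis unfolding cat_left_def
      by (rule wp_Seq, rule wp_cmove, unfold e, rule r[unfolded cat_left_def])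
  qed
  have S4: "wp x X (for_loop 12 17 write_zero ;; cat_left ;; rewind_cat ;; CLR rCE ;; ADD rCE 17 ;; INC rCE ;; uset (\<lambda>k u a c. u\<lparr>uq := 0\<rparr>) ;; simulate True \<delta>)
     ((m + 1) * (1 + 3 * ?V) + (1 + (m * (1 + 1) + 1 + (?V + (?V + (?V + (1 + ((t0 + 1) * (12 * tape_time X + 1) + 1) + 1) + 1) + 1) + 1) + 1) + 1) + 1)
      (\<lambda>b. uans (us b) = Some res) b" if b: "I 0 b" for b
  proof (rule wp_Seq, rule wp_for_loop[where I = I and N = m])
    show "rg b 17 = m" using b by (simp add: I_def ok_def)
    show "I j (d\<lparr>hs := k, rg := (rg d)(12 := v)\<rparr>)" if "I j d" for j d k v
      using that by (auto simp: I_def ok_def)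
  qed (use b S3 body in \<open>auto simp: nregs_def\<close>)
  show ?thesis
    unfolding fallback_def fb_time_def
    by (rule wp_Seq, rule wp_rewind_cat, rule a(3), rule wp_Seq, unfold cat_right_def, rule wp_cmove, rule S4)
      (use a in \<open>auto simp: I_def ok_def mv_def\<close>)
qed

section \<open>Initialization and the two complete programs\<close>

definition init_common :: "nat \<Rightarrow> uf sf com \<Rightarrow> uf sf com" where
  "init_common k p = INC 1 ;; INC rH ;; count_input ;; ADD 16 rN1 ;; DEC 16 ;; set_work_end k ;; power_of_n 14 k ;; p"

definition pow_time :: "nat \<Rightarrow> nat \<Rightarrow> nat \<Rightarrow> nat" where
  "pow_time X n k = sweep_time X + (sweep_time X + (k * ((n + 4) * (5 * sweep_time X) + 1) + 1) + 1) + 1"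

definition init0_time :: "nat \<Rightarrow> nat \<Rightarrow> nat \<Rightarrow> nat" where
  "init0_time X n k = 20 * sweep_time X + (n * (sweep_time X + 5)) +
     (n * (sweep_time X + (k * (sweep_time X + 1) + 1 + sweep_time X + 1) + 1 + 1)) + pow_time X n k"

definition init0_post :: "bool list \<Rightarrow> nat \<Rightarrow> uf ast \<Rightarrow> uf ast \<Rightarrow> bool" where
  "init0_post x k a b \<longleftrightarrow> us b = us a \<and> ip b = 0 \<and> cp b = cp a \<and> cc b = cc a \<and>
     rg b 0 = 0 \<and> rg b 1 = 1 \<and> rg b rI = 0 \<and> rg b rN1 = length x + 1 \<and> rg b rH = 1 \<and> rg b rW = 0 \<and>
     rg b rE = 2 ^ (k * floorlog 2 (length x) + 1) \<and> rg b rC = 0 \<and> rg b rCE = 0 \<and> rg b rV = 0 \<and>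
     rg b 14 = length x ^ k \<and> rg b 16 = length x"

lemma floorlog2_le: "0 < n \<Longrightarrow> floorlog 2 n \<le> n"
proof -
  assume "0 < n"
  from floorlog2_bounds[OF this] have h: "2 ^ (floorlog 2 n - 1) \<le> n" "0 < floorlog 2 n" by auto
  have "floorlog 2 n - 1 < 2 ^ (floorlog 2 n - 1)" by (rule less_exp)
  then show ?thesis using h by linarith
qed

lemma wp_init_common:
  assumes a: "rg a = (\<lambda>_. 0)" "ip a = 0" and n: "0 < length x"
    and l: "length x ^ k < 2 ^ X" "length x + 1 < 2 ^ X" "2 ^ (k * floorlog 2 (length x) + 1) < (2::nat) ^ X"
      "2 ^ floorlog 2 (length x) < (2::nat) ^ X"
    and P: "\<And>b. init0_post x k a b \<Longrightarrow> wp x X p Tp Q b"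
  shows "wp x X (init_common k p) (init0_time X (length x) k + Tp) Q a"
proof -
  let ?n = "length x" and ?V = "sweep_time X" and ?L = "floorlog 2 (length x)"
  let ?tp = "sweep_time X + (sweep_time X + (k * ((?n + 4) * (5 * sweep_time X) + 1) + 1) + 1) + 1"
  let ?te = "?V + (?V + (?V + (?V + (?L * (?V + (k * (?V + 1) + 1 + ?V + 1) + 1 + 1) + 1) + 1) + 1) + 1) + 1"
  let ?tn = "1 + (?V + ((?n * (1 + ?V + 1 + 1) + 1) + (1 + (?n * (1 + 1) + 1) + 1) + 1) + 1) + 1"
  have one: "1 < (2::nat) ^ X" using l(2) n by linarith
  have C: "wp x X (power_of_n 14 k ;; p) (?tp + Tp + 1) Q b"
    if b: "us b = us a" "ip b = 0" "cp b = cp a" "cc b = cc a" "rg b 16 = ?n"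
      "rg b 0 = 0" "rg b 1 = 1" "rg b rI = 0" "rg b rN1 = length x + 1" "rg b rH = 1" "rg b rW = 0"
      "rg b rE = 2 ^ (k * ?L + 1)" "rg b rC = 0" "rg b rCE = 0" "rg b rV = 0" for b
    by (rule wp_Seq, rule wp_power_of_n[OF _ _ _ _ b(5) n l(1) one], simp add: nregs_def, simp, simp, simp, rule P)
      (use b in \<open>auto simp: init0_post_def same_def\<close>)
  have B: "wp x X (ADD 16 rN1 ;; DEC 16 ;; set_work_end k ;; power_of_n 14 k ;; p) (?V + (?V + (?te + (?tp + Tp + 1) + 1) + 1) + 1) Q b"
    if b: "us b = us a" "ip b = 0" "cp b = cp a" "cc b = cc a" "rg b 1 = 1" "rg b rN1 = length x + 1" "rg b rH = 1"
      "\<forall>j. j \<notin> {1, rN1, rH} \<longrightarrow> rg b j = 0" for b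
    by (rule wp_rules, rule wp_rules, rule wp_rules, rule wp_rules, rule wp_Seq, (rule wp_set_work_end[OF _ _ _ n l(3,4)]; (rule C)?))
      (use b n l in \<open>auto simp: nregs_def same_def\<close>)
  have A: "wp x X (init_common k p) (?V + (?V + (?tn + (?V + (?V + (?te + (?tp + Tp + 1) + 1) + 1) + 1) + 1) + 1) + 1) Q a"
    unfolding init_common_def
    by (rule wp_rules, rule wp_rules, rule wp_rules, rule wp_rules, rule wp_Seq, rule wp_count_input[OF _ _ l(2)], simp add: a, simp add: a, rule B)
      (use a one in \<open>auto simp: nregs_def same_def\<close>)
  show ?thesis
  proof (rule wp_weaken[OF A])
    have V: "560 \<le> ?V" by (rule sweep_time_ge)
    have "?L * (?V + (k * (?V + 1) + 1 + ?V + 1) + 1 + 1) \<le> ?n * (?V + (k * (?V + 1) + 1 + ?V + 1) + 1 + 1)"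
      by (rule mult_le_mono1[OF floorlog2_le[OF n]])
    moreover have "?n * (1 + ?V + 1 + 1) + ?n * (1 + 1) = ?n * (?V + 5)" by (simp add: algebra_simps)
    ultimately show "?V + (?V + (?tn + (?V + (?V + (?te + (?tp + Tp + 1) + 1) + 1) + 1) + 1) + 1) + 1
      \<le> init0_time X ?n k + Tp" unfolding init0_time_def pow_time_def using V by linarith
  qed
qed

definition init_AVG :: "nat \<Rightarrow> nat \<Rightarrow> nat \<Rightarrow> uf sf com \<Rightarrow> uf sf com" where
  "init_AVG k kT c p = init_common k (power_of_n 13 kT ;; power_of_n 17 c ;; repc c (INC 17) ;; ADD rCE 14 ;; INC rCE ;; p)"

definition initb_time :: "nat \<Rightarrow> nat \<Rightarrow> nat \<Rightarrow> nat \<Rightarrow> nat \<Rightarrow> nat" where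
  "initb_time X n k kT c = init0_time X n k + (pow_time X n kT + (pow_time X n c + (c * (sweep_time X + 1) + 1 +
     (sweep_time X + sweep_time X + 2) + 1) + 1) + 1)"

lemma wp_init_AVG:
  assumes a: "rg a = (\<lambda>_. 0)" "ip a = 0" "cp a = 0" "cc a = \<tau>" and n: "0 < length x"
    and l: "length x ^ k + 1 < 2 ^ X" "length x + 1 < 2 ^ X" "2 ^ (k * floorlog 2 (length x) + 1) < (2::nat) ^ X"
      "2 ^ floorlog 2 (length x) < (2::nat) ^ X" "length x ^ kT < 2 ^ X" "length x ^ c + c < 2 ^ X"
    and P: "\<And>b. us b = us a \<Longrightarrow> block_start x (k * floorlog 2 (length x)) (length x ^ k) (length x ^ kT) (length x ^ c + c) \<tau> 0 b
       \<Longrightarrow> wp x X p Tp Q b"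
  shows "wp x X (init_AVG k kT c p) (initb_time X (length x) k kT c + Tp) Q a"
proof -
  let ?n = "length x" and ?V = "sweep_time X" and ?L = "floorlog 2 (length x)"
  have one: "1 < (2::nat) ^ X" using l(2) n by linarith
  have nk: "?n ^ k < 2 ^ X" "?n ^ c < 2 ^ X" using l by linarith+
  have T: "wp x X (init_AVG k kT c p) (init0_time X ?n k + (pow_time X ?n kT + (pow_time X ?n c + (c * (?V + 1) + 1 +
     (?V + (?V + Tp + 1) + 1) + 1) + 1) + 1)) Q a"
    unfolding init_AVG_def
  proof (rule wp_init_common[OF a(1,2) n nk(1) l(2-4)])
    fix b assume b: "init0_post x k a b"
    have b16: "rg b 16 = ?n" using b by (simp add: init0_post_def)
    define K where "K i d \<longleftrightarrow> init0_post x k a d \<and> rg d 13 = ?n ^ kT \<and> rg d 17 = ?n ^ c + i" for i d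
    have s: "wp x X (INC 17) ?V (K (Suc i)) d" if "i < c" "K i d" for i d
      by (rule wp_rules) (use that l(6) in \<open>auto simp: K_def init0_post_def nregs_def\<close>)
    have E: "wp x X (ADD rCE 14 ;; INC rCE ;; p) (?V + (?V + Tp + 1) + 1) Q d" if d: "K c d" for d
      by ((rule wp_rules)+, rule P) (use d l(1) a in \<open>auto simp: K_def init0_post_def nregs_def block_start_def\<close>)
    have D: "wp x X (repc c (INC 17) ;; ADD rCE 14 ;; INC rCE ;; p) (c * (?V + 1) + 1 + (?V + (?V + Tp + 1) + 1) + 1) Q d"
      if d: "K 0 d" for d
      by (rule wp_Seq, rule wp_mono[OF wp_repc[of K d c]]) (use d s E in auto)
    have C: "wp x X (power_of_n 17 c ;; repc c (INC 17) ;; ADD rCE 14 ;; INC rCE ;; p)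
       (pow_time X ?n c + (c * (?V + 1) + 1 + (?V + (?V + Tp + 1) + 1) + 1) + 1) Q d"
      if d: "init0_post x k a d" "rg d 13 = ?n ^ kT" for d
      unfolding pow_time_def
      by (rule wp_Seq, rule wp_power_of_n[OF _ _ _ _ _ n nk(2) one], simp add: nregs_def, simp, simp, simp,
          use d in \<open>simp add: init0_post_def\<close>, rule D) (use d in \<open>auto simp: K_def init0_post_def same_def\<close>)
    show "wp x X (power_of_n 13 kT ;; power_of_n 17 c ;; repc c (INC 17) ;; ADD rCE 14 ;; INC rCE ;; p)
       (pow_time X ?n kT + (pow_time X ?n c + (c * (?V + 1) + 1 + (?V + (?V + Tp + 1) + 1) + 1) + 1) + 1) Q b"
      by (rule wp_Seq, rule wp_power_of_n[OF _ _ _ _ b16 n l(5) one, folded pow_time_def], simp add: nregs_def, simp, simp, simp,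
          rule C) (use b in \<open>auto simp: init0_post_def same_def\<close>)
  qed
  show ?thesis by (rule wp_weaken[OF T]) (simp add: initb_time_def)
qed

text \<open>The catalytic tape of the simulated machine is kept in register \<open>rV\<close>, which
  is zero from the start. Its head and its end are one-hot: \<open>rC\<close> becomes
  \<open>2 ^ 0\<close> and \<open>rCE\<close> becomes \<open>2 ^ (n ^ k + 1)\<close>, by repeated
  doubling.\<close>

definition init_P :: "nat \<Rightarrow> uf sf com \<Rightarrow> uf sf com" where
  "init_P k p = init_common k (INC rC ;; INC rCE ;; INC rCE ;; for_loop 12 14 (ADD rCE rCE) ;; p)"

definition inita_time :: "nat \<Rightarrow> nat \<Rightarrow> nat \<Rightarrow> nat" where
  "inita_time X n k = init0_time X n k + (4 * sweep_time X + (n ^ k + 1) * (sweep_time X + 3 * sweep_time X))"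

lemma wp_init_P:
  assumes a: "rg a = (\<lambda>_. 0)" "ip a = 0" and n: "0 < length x"
    and l: "length x ^ k + 1 < X" "length x + 1 < 2 ^ X" "k * floorlog 2 (length x) + 1 < X" "floorlog 2 (length x) < X"
    and P: "\<And>b. us b = us a \<Longrightarrow>
       represents False x [] [] (init (k * floorlog 2 (length x)) (replicate (length x ^ k) False)) b \<Longrightarrow> wp x X p Tp Q b"
  shows "wp x X (init_P k p) (inita_time X (length x) k + Tp) Q a"
proof -
  let ?n = "length x" and ?V = "sweep_time X" and ?L = "floorlog 2 (length x)" and ?m = "length x ^ k"
  have lt: "(2::nat) ^ j < 2 ^ X" if "j < X" for j using that by simp
  have nk: "?n ^ k < 2 ^ X" using l(1) less_exp[of X] by linarith
  have two: "Suc (Suc 0) < 2 ^ X" "Suc 0 < 2 ^ X" using lt[of 1] l(1) by auto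
  define I where "I j d \<longleftrightarrow> init0_post x k a (d\<lparr>rg := (rg d)(rC := 0, rCE := 0)\<rparr>) \<and> rg d rC = 1 \<and> rg d rCE = 2 ^ (j + 1)" for j d
  have body: "wp x X (ADD rCE rCE) ?V (\<lambda>d. I (Suc j) d \<and> rg d 12 = j \<and> rg d 14 = ?m) b"
    if "j < ?m" "I j b" "rg b 12 = j" "rg b 14 = ?m" for j b
    by (rule wp_rules) (use that lt[of "j + 2"] l(1) in \<open>auto simp: I_def init0_post_def nregs_def\<close>)
  have L: "wp x X (for_loop 12 14 (ADD rCE rCE) ;; p) ((?m + 1) * (?V + 3 * ?V) + Tp + 1) Q b" if b: "I 0 b" for b
  proof (rule wp_Seq, rule wp_for_loop[where I = I and N = ?m])
    show "rg b 14 = ?m" using b by (simp add: I_def init0_post_def)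
    show "I j (d\<lparr>hs := k', rg := (rg d)(12 := v)\<rparr>)" if "I j d" for j d k' v
      using that by (auto simp: I_def init0_post_def)
    show "wp x X p Tp Q d" if "I ?m d" for d
      by (rule P) (use that in \<open>auto simp: I_def init0_post_def represents_def init_def\<close>)
  qed (use b body in \<open>auto simp: nregs_def\<close>)
  have "wp x X (init_P k p) (init0_time X ?n k + (?V + (?V + (?V + ((?m + 1) * (?V + 3 * ?V) + Tp + 1) + 1) + 1) + 1)) Q a"
    unfolding init_P_def
  proof (rule wp_init_common[OF a(1,2) n nk l(2) lt[OF l(3)] lt[OF l(4)]])
    fix b assume b: "init0_post x k a b"
    show "wp x X (INC rC ;; INC rCE ;; INC rCE ;; for_loop 12 14 (ADD rCE rCE) ;; p)
      (?V + (?V + (?V + ((?m + 1) * (?V + 3 * ?V) + Tp + 1) + 1) + 1) + 1) Q b"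
      by (rule wp_rules, rule wp_rules, rule wp_rules, rule wp_rules, rule wp_rules, rule wp_rules, rule L)
        (use b two in \<open>auto simp: I_def init0_post_def nregs_def\<close>)
  qed
  then show ?thesis
    by (rule wp_weaken) (use sweep_time_ge[of X] in \<open>simp add: inita_time_def\<close>)
qed

definition main_P :: "nat \<Rightarrow> delta \<Rightarrow> uf sf com" where
  "main_P k \<delta> = init_P k (uset (\<lambda>j u a c. u\<lparr>uq := 0\<rparr>) ;; simulate False \<delta>)"

lemma wp_main_P:
  fixes k :: nat and x :: "bool list"
  defines "L \<equiv> floorlog 2 (length x)" and "m \<equiv> length x ^ k"
  assumes v: "valid Q \<delta>" and a: "rg a = (\<lambda>_. 0)" "ip a = 0" "uans (us a) = None" and n: "0 < length x"
    and l: "m + 1 < X" "length x + 1 < 2 ^ X" "k * L + 1 < X" "L < X"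
    and H: "result (run \<delta> x (init (k * L) (replicate m False)) t) = Some res"
  shows "wp x X (main_P k \<delta>) (inita_time X (length x) k + (1 + ((t + 1) * (12 * tape_time X + 1) + 1) + 1))
     (\<lambda>b. uans (us b) = Some res) a"
proof -
  interpret tour Q \<delta> x "k * L" m by unfold_locales (rule v)
  have wf: "wf (init (k * L) (replicate m False))" by (rule wf_init) simp
  obtain n0 r where ld: "leads (init (k * L) (replicate m False)) n0 r" "n0 < t" "dl r = Halt res"
    using run_leads[OF H wf] by blast
  show ?thesis
    unfolding main_P_def
  proof (rule wp_init_P[OF a(1,2) n l[unfolded L_def m_def]], rule wp_Seq, rule wp_uset)
    fix b assume b: "us b = us a" "represents False x [] [] (init (k * floorlog 2 (length x)) (replicate (length x ^ k) False)) b"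
    let ?b = "b\<lparr>us := (us b)\<lparr>uq := 0\<rparr>\<rparr>"
    have "wp x X (simulate False \<delta>) ((n0 + 1) * (12 * tape_time X + 1) + 1) (\<lambda>b. uans (us b) = Some res) ?b"
    proof (rule wp_simulate[OF ld(1,3) wf])
      show "represents False x [] [] (init (k * L) (replicate m False)) ?b" using b(2) by (simp add: represents_def L_def m_def)
    qed (use b(1) a in \<open>auto simp: init_def\<close>)
    then show "wp x X (simulate False \<delta>) ((t + 1) * (12 * tape_time X + 1) + 1) (\<lambda>b. uans (us b) = Some res) ?b"
      by (rule wp_weaken) (intro add_le_mono mult_le_mono order_refl less_imp_le ld(2))
  qed
qed

definition main_AVG :: "nat \<Rightarrow> nat \<Rightarrow> nat \<Rightarrow> nat \<Rightarrow> delta \<Rightarrow> delta \<Rightarrow> uf sf com" where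
  "main_AVG k kT c Q \<delta> \<delta>' = init_AVG k kT c (for_loop 15 16 (process_block Q \<delta>) ;;
     Cond (utest (\<lambda>j u a c. uans u \<noteq> None)) Skip (fallback \<delta>'))"

definition block_time :: "nat \<Rightarrow> nat \<Rightarrow> nat \<Rightarrow> nat" where
  "block_time X T m = 1 + ((T + 1) * (25 * tape_time X + 3 * sweep_time X) + ((T + 1) * (25 * tape_time X + 3 * sweep_time X) +
        (m + 1) * (1 + 3 * sweep_time X) + 1) + 1) + 1"

text \<open>Both machines give the same answer \<open>res\<close>, so it does not matter which of
  them supplies it. One fitting block is enough to leave an answer, which prevents the
  fallback.\<close>

lemma wp_main_AVG:
  fixes k kT c :: nat and x :: "bool list"
  defines "n \<equiv> length x" and "s \<equiv> k * floorlog 2 (length x)" and "m \<equiv> length x ^ k" and "T \<equiv> length x ^ kT"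
    and "N \<equiv> length x ^ c + c"
  assumes v: "valid Q \<delta>" "valid Q' \<delta>'"
    and a: "rg a = (\<lambda>_. 0)" "ip a = 0" "cp a = 0" "cc a = \<tau>" "uans (us a) = None" and n: "0 < n"
    and l: "m + 1 < 2 ^ X" "n + 1 < 2 ^ X" "2 ^ (s + 1) < (2::nat) ^ X"
      "2 ^ floorlog 2 n < (2::nat) ^ X" "T < 2 ^ X" "N + 1 < 2 ^ X"
    and len: "n * m \<le> length \<tau>" "N < length \<tau>"
    and H1: "\<And>\<sigma>. length \<sigma> = m \<Longrightarrow> \<exists>t. result (run \<delta> x (init s \<sigma>) t) = Some res"
    and H2: "result (run \<delta>' x (init s (replicate N False)) t) = Some res"
  shows "wp x X (main_AVG k kT c Q \<delta> \<delta>')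
     (initb_time X n k kT c + ((n + 1) * (block_time X T m + 3 * sweep_time X) + (fb_time X (n * m) N t + 1) + 1))
     (\<lambda>b. uans (us b) = Some res \<and> ((\<exists>i<n. tour.fits Q \<delta> x s m T (block m \<tau> i)) \<longrightarrow> cc b = \<tau>)) a"
proof -
  interpret M: tour Q \<delta> x s m by unfold_locales (rule v)
  interpret F: tour Q' \<delta>' x s N by unfold_locales (rule v)
  have wfN: "F.wf (init s (replicate N False))" by (rule F.wf_init) simp
  obtain n0 r where ld: "F.leads (init s (replicate N False)) n0 r" "n0 < t" "F.dl r = Halt res"
    using F.run_leads[OF H2 wfN] by blast
  have im: "(i + 1) * m \<le> length \<tau>" if "i < n" for i
  proof -
    have "(i + 1) * m \<le> n * m" using that by (intro mult_le_mono1) simp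
    then show ?thesis using len(1) by linarith
  qed
  let ?Q = "\<lambda>b. uans (us b) = Some res \<and> ((\<exists>i<n. M.fits T (block m \<tau> i)) \<longrightarrow> cc b = \<tau>)"
  \<comment> \<open>Only the absence of an answer has to be informative: it certifies that none of
    the blocks treated so far fits, so the fallback owes nothing to the tape.\<close>
  define I where "I i b \<longleftrightarrow> block_start x s m T N \<tau> i b \<and> (uans (us b) = Some res \<or>
     uans (us b) = None \<and> (\<forall>j<i. \<not> M.fits T (block m \<tau> j)))" for i b
  have body: "wp x X (process_block Q \<delta>) (block_time X T m) (\<lambda>d. I (Suc i) d \<and> rg d 15 = i \<and> rg d 16 = n) b"
    if i: "i < n" and b: "I i b" "rg b 15 = i" "rg b 16 = n" for i b
  proof -
    have bs: "block_start x s m T N \<tau> i b" using b by (simp add: I_def)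
    have bl: "length (block m \<tau> i) = m" using block_split(2)[OF im[OF i]] .
    obtain t1 where t1: "result (run \<delta> x (init s (block m \<tau> i)) t1) = Some res" using H1[OF bl] by blast
    obtain n1 r1 where l1: "M.leads (init s (block m \<tau> i)) n1 r1" "M.dl r1 = Halt res"
      using M.run_leads[OF t1 M.wf_init[OF bl]] by blast
    show ?thesis
      unfolding block_time_def
    proof (rule wp_mono[OF M.wp_process_block[OF bs im[OF i] l1]])
      fix d assume d: "block_start x s m T N \<tau> (i + 1) d \<and> rg d 15 = rg b 15 \<and>
        (uans (us d) = Some res \<or> \<not> M.fits T (block m \<tau> i) \<and> uans (us d) = uans (us b))"
      then have "rg d 16 = n" by (simp add: block_start_def n_def)
      moreover have "I (Suc i) d" using d b(1) by (auto simp: I_def less_Suc_eq)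
      ultimately show "I (Suc i) d \<and> rg d 15 = i \<and> rg d 16 = n" using d b(2) by simp
    qed simp
  qed
  have tail: "wp x X (Cond (utest (\<lambda>j u a c. uans u \<noteq> None)) Skip (fallback \<delta>')) (fb_time X (n * m) N t + 1) ?Q b"
    if b: "I n b" for b
  proof (cases "uans (us b) = None")
    case True
    have bs: "block_start x s m T N \<tau> n b" and nf: "\<forall>j<n. \<not> M.fits T (block m \<tau> j)" using b True by (auto simp: I_def)
    have cp: "cp b = n * m" using bs by (simp add: block_start_def)
    have Np: "0 < N" using n by (simp add: N_def n_def)
    have "wp x X (fallback \<delta>') (fb_time X (cp b) N t) (\<lambda>b. uans (us b) = Some res) b"
      by (rule F.wp_fallback[OF _ Np _ _ _ _ _ _ _ _ _ _ _ _ _ ld(1) less_imp_le[OF ld(2)] ld(3)])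
        (use bs len l(6) True in \<open>auto simp: block_start_def\<close>)
    then have "wp x X (fallback \<delta>') (fb_time X (n * m) N t) ?Q b"
      unfolding cp by (rule wp_mono) (use nf in auto)
    then show ?thesis by (intro wp_Cond) (use True in simp)
  next
    case False
    have "?Q b" using b False by (auto simp: I_def block_start_def)
    then have "wp x X Skip 1 ?Q b" by (rule wp_Skip)
    then have "wp x X Skip (fb_time X (n * m) N t) ?Q b" by (rule wp_weaken) (simp add: fb_time_def)
    then show ?thesis by (intro wp_Cond) (use False in simp)
  qed
  show ?thesis
    unfolding main_AVG_def n_def
  proof (rule wp_init_AVG[OF a(1-4) n[unfolded n_def]], fold n_def)
    show "n ^ k + 1 < 2 ^ X" "n + 1 < 2 ^ X" "2 ^ (k * floorlog 2 n + 1) < (2::nat) ^ X"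
      "2 ^ floorlog 2 n < (2::nat) ^ X" "n ^ kT < 2 ^ X" "n ^ c + c < 2 ^ X"
      using l by (simp_all add: m_def s_def T_def N_def n_def)
    fix b assume b: "us b = us a" "block_start x (k * floorlog 2 n) (n ^ k) (n ^ kT) (n ^ c + c) \<tau> 0 b"
    have bs: "block_start x s m T N \<tau> 0 b" using b(2) by (simp add: m_def s_def T_def N_def n_def)
    show "wp x X (for_loop 15 16 (process_block Q \<delta>) ;; Cond (utest (\<lambda>j u a c. uans u \<noteq> None)) Skip (fallback \<delta>'))
       ((n + 1) * (block_time X T m + 3 * sweep_time X) + (fb_time X (n * m) N t + 1) + 1) ?Q b"
    proof (rule wp_Seq, rule wp_for_loop[where I = I and N = n])
      show "rg b 16 = n" using bs by (simp add: block_start_def n_def)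
      show "I j (d\<lparr>hs := k, rg := (rg d)(15 := v)\<rparr>)" if "I j d" for j d k v
        using that by (auto simp: I_def block_start_def)
      show "I 0 b" using bs b(1) a(5) by (simp add: I_def)
    qed (use body tail in \<open>auto simp: nregs_def\<close>)
  qed
qed

section \<open>Realization by machines\<close>

text \<open>The finite control must be closed under steps from all its values, so the behaviour of a
  machine in states that do not belong to it is made harmless.\<close>

definition strict :: "nat \<Rightarrow> delta \<Rightarrow> bool" where
  "strict Q \<delta> \<longleftrightarrow> (\<forall>q a b c q' u v di dw dc. \<delta> q a b c = Step q' u v di dw dc \<longrightarrow> q < Q \<and> q' < Q)"

definition restrict :: "nat \<Rightarrow> delta \<Rightarrow> delta" where
  "restrict Q \<delta> q a b c = (if q < Q then \<delta> q a b c else Halt False)"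

lemma strict_restrict: "valid Q \<delta> \<Longrightarrow> strict Q (restrict Q \<delta>)"
  unfolding valid_def strict_def restrict_def by (metis act.distinct(1))

lemma strict_valid: "0 < Q \<Longrightarrow> strict Q \<delta> \<Longrightarrow> valid Q \<delta>"
  unfolding valid_def strict_def by blast

lemma strict_swapm: "strict Q \<delta> \<Longrightarrow> strict Q (swapm \<delta>)"
  unfolding strict_def swapm_def by (auto split: act.splits)

lemma run_restrict:
  assumes "valid Q \<delta>" "st c < Q"
  shows "run (restrict Q \<delta>) x c t = run \<delta> x c t \<and> st (run \<delta> x c t) < Q"
proof (induction t)
  case (Suc t)
  let ?c = "run \<delta> x c t"
  have "step (restrict Q \<delta>) x ?c = step \<delta> x ?c" using Suc by (simp add: step_def restrict_def)
  moreover have "st (step \<delta> x ?c) < Q"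
  proof (cases "\<delta> (st ?c) (rd x (ih ?c)) (rd (wt ?c) (wh ?c)) (rd (ct ?c) (ch ?c))")
    case (Step q a b di dw dc)
    then have "q < Q" using Suc assms(1) unfolding valid_def by blast
    then show ?thesis using Suc Step by (simp add: step_def)
  qed (use Suc in \<open>simp add: step_def\<close>)
  ultimately show ?case using Suc by (simp add: run_Suc)
qed (use assms in simp)

lemma uf_set_upd [simp]:
  "u\<lparr>usI := v1\<rparr> \<in> uf_set Q P \<longleftrightarrow> u \<in> uf_set Q P" "u\<lparr>usW := v1\<rparr> \<in> uf_set Q P \<longleftrightarrow> u \<in> uf_set Q P"
  "u\<lparr>usC := v1\<rparr> \<in> uf_set Q P \<longleftrightarrow> u \<in> uf_set Q P" "u\<lparr>uans := v1\<rparr> \<in> uf_set Q P \<longleftrightarrow> u \<in> uf_set Q P"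
  "idle u \<in> uf_set Q P \<longleftrightarrow> u \<in> uf_set Q P"
  by (simp_all add: uf_set_def idle_def)

lemma closed_for_loop: "closed_flags (flag_set UF) p \<Longrightarrow> closed_flags (flag_set UF) (for_loop t l p)"
  by (simp add: for_loop_def)

lemma closed_imove [simp]: "closed_flags (flag_set UF) (uact (\<lambda>k u a c. (u, v k u a c, d k u a c, e k u a c)))"
  by (rule closed_uact) simp

lemma closed_halve_pow2 [simp]: "closed_flags (flag_set UF) (halve_pow2 h)"
  by (simp add: halve_pow2_def)

lemma closed_local_step:
  assumes "\<And>u. u \<in> uf_set Q P \<Longrightarrow> g u \<in> uf_set Q P"
  shows "closed_flags (flag_set (uf_set Q P)) (local_step ph g)"
proof -
  let ?F = "flag_set (uf_set Q P)"
  have "closed_flags ?F look_input" "closed_flags ?F look_work" "closed_flags ?F (look_cat ph)"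
    unfolding look_input_def look_work_def look_cat_def
    by (simp_all, (intro conjI impI closed_uset; simp add: uf_set_def)+)
  moreover have "closed_flags ?F move_input" "closed_flags ?F (write_hot f w h)" "closed_flags ?F (move_hot e h)" "closed_flags ?F (act_cat ph)"
    for f w e h
    by (simp_all add: move_input_def write_hot_def move_hot_def act_cat_def)
  moreover have "closed_flags ?F (uset (\<lambda>k u a c. g u))" by (rule closed_uset) (rule assms)
  ultimately show ?thesis by (simp add: local_step_def look_all_def act_all_def)
qed

lemma stepU_mem:
  assumes "strict Q \<delta>" "Q \<le> Q'" "u \<in> uf_set Q' P"
  shows "stepU \<delta> u \<in> uf_set Q' P"
proof (cases "\<delta> (uq u) (usI u) (usW u) (usC u)")
  case (Step q a b di dw dc)
  then have "q < Q'" using assms(1,2) unfolding strict_def by (meson less_le_trans)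
  then show ?thesis using assms(3) Step by (simp add: stepU_def uf_set_def)
qed (use assms in \<open>simp add: stepU_def\<close>)

lemma closed_simulate:
  assumes "strict Q \<delta>" "Q \<le> Q'"
  shows "closed_flags (flag_set (uf_set Q' P)) (simulate ph \<delta>)"
  unfolding simulate_def
  by (simp, rule closed_local_step) (use stepU_mem[OF assms] in \<open>auto simp: simU_def\<close>)

lemma lidx_labU:
  assumes "strict Q \<delta>" "\<not> haltU \<delta> u"
  shows "lidx Q (labU \<delta> u) < length (labs Q)"
proof -
  obtain q a b di dw dc where d: "\<delta> (uq u) (usI u) (usW u) (usC u) = Step q a b di dw dc"
    using assms(2) by (cases "\<delta> (uq u) (usI u) (usW u) (usC u)") (auto simp: haltU_def is_Halt_def)
  then have "uq u < Q" using assms(1) unfolding strict_def by blast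
  then show ?thesis by (intro lidx) (simp add: labU_def d)
qed

lemma try_pred_mem: "u \<in> uf_set Q' P \<Longrightarrow> fl \<le> P \<Longrightarrow> try_pred l fl u \<in> uf_set Q' P"
  by (auto simp: try_pred_def uf_set_def idle_def split: prod.splits)

lemma check_pred_mem: "u \<in> uf_set Q' P \<Longrightarrow> fl \<le> P \<Longrightarrow> sc \<le> P \<Longrightarrow> fst l < Q' \<Longrightarrow> check_pred \<delta> l sc fl u \<in> uf_set Q' P"
  by (auto simp: check_pred_def uf_set_def idle_def split: prod.splits)

lemma closed_tour_forward:
  assumes "strict Q \<delta>" "Q \<le> Q'" "P = length (labs Q)"
  shows "closed_flags (flag_set (uf_set Q' P)) (tour_forward Q \<delta>)"
proof -
  have lq: "fst (labs Q ! i) < Q'" if "i < P" for i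
    using mem_labs[of "labs Q ! i" Q] that assms(2,3) by (simp add: nth_mem)
  have fwd1: "fwd1 Q \<delta> u \<in> uf_set Q' P" if u: "u \<in> uf_set Q' P" for u
  proof -
    have "(stepU \<delta> u)\<lparr>ulab := Suc (lidx Q (labU \<delta> u))\<rparr> \<in> uf_set Q' P" if "\<not> haltU \<delta> u"
      using stepU_mem[OF assms(1,2) u] lidx_labU[OF assms(1) that] assms(3) by (simp add: uf_set_def)
    moreover have "ulab u \<le> P" using u by (simp add: uf_set_def)
    ultimately show ?thesis using u assms(3) by (auto simp: fwd1_def intro!: try_pred_mem) (auto simp: uf_set_def idle_def)
  qed
  have fwd2: "fwd2 Q \<delta> u \<in> uf_set Q' P" if u: "u \<in> uf_set Q' P" for u
    using u assms(3) lq by (auto simp: fwd2_def intro!: check_pred_mem)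
  show ?thesis unfolding tour_forward_def using closed_local_step fwd1 fwd2 by auto
qed

lemma closed_tour_backward:
  assumes "strict Q \<delta>" "Q \<le> Q'" "P = length (labs Q)" "0 < Q"
  shows "closed_flags (flag_set (uf_set Q' P)) (tour_backward Q \<delta>)"
proof -
  \<comment> \<open>There is at least one label, so \<open>ulab u - 1\<close> is a valid index even
    when \<open>ulab u\<close> is 0.\<close>
  have P0: "0 < P" using lidx(1)[of "(0, None, None, Stay, Stay, Stay)" Q] assms(3,4) by auto
  have lq: "fst (labs Q ! i) < Q'" if "i < P" for i
    using mem_labs[of "labs Q ! i" Q] that assms(2,3) by (simp add: nth_mem)
  have bwd1: "bwd1 Q \<delta> u \<in> uf_set Q' P" if u: "u \<in> uf_set Q' P" for u
  proof -
    have "(stepU \<delta> u)\<lparr>ulab := lidx Q (labU \<delta> u)\<rparr> \<in> uf_set Q' P" if "\<not> haltU \<delta> u"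
      using stepU_mem[OF assms(1,2) u] lidx_labU[OF assms(1) that] assms(3) by (simp add: uf_set_def)
    moreover have "ulab u \<le> P" using u by (simp add: uf_set_def)
    ultimately show ?thesis using u assms(3) by (auto simp: bwd1_def intro!: try_pred_mem) (auto simp: uf_set_def idle_def)
  qed
  have bwd2: "bwd2 Q \<delta> u \<in> uf_set Q' P" if u: "u \<in> uf_set Q' P" for u
  proof -
    have "ulab u \<le> P" using u by (simp add: uf_set_def)
    then have "ulab u - 1 < P" using P0 by linarith
    then show ?thesis using u assms(3) lq by (auto simp: bwd2_def intro!: check_pred_mem)
  qed
  show ?thesis unfolding tour_backward_def using closed_local_step bwd1 bwd2 by auto
qed

lemma closed_power_of_n [simp]: "closed_flags (flag_set UF) (power_of_n r k)"
  by (simp add: power_of_n_def mult_by_n_def closed_for_loop)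

lemma closed_init_common: "closed_flags (flag_set UF) p \<Longrightarrow> closed_flags (flag_set UF) (init_common k p)"
  by (simp add: init_common_def count_input_def set_work_end_def)

lemma closed_main_P:
  assumes "strict Q \<delta>" "0 < Q"
  shows "closed_flags (flag_set (uf_set Q P)) (main_P k \<delta>)"
  unfolding main_P_def init_P_def using assms closed_simulate[OF assms(1) order_refl]
  by (auto intro!: closed_init_common closed_for_loop closed_uset) (auto simp: uf_set_def)

lemma closed_main_AVG:
  assumes "strict Q \<delta>" "strict Q1 \<delta>1" "0 < Q" "Q \<le> Q'" "Q1 \<le> Q'" "P = length (labs Q)"
  shows "closed_flags (flag_set (uf_set Q' P)) (main_AVG k kT c Q \<delta> \<delta>1)"
proof -
  have u0: "u\<lparr>uq := 0\<rparr> \<in> uf_set Q' P" "u\<lparr>uq := 0, ulab := P\<rparr> \<in> uf_set Q' P" if "u \<in> uf_set Q' P" for u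
    using that assms by (auto simp: uf_set_def)
  show ?thesis
    unfolding main_AVG_def init_AVG_def process_block_def fallback_def rewind_cat_def cat_left_def cat_right_def write_zero_def
    using closed_tour_forward[OF assms(1,4,6)] closed_tour_backward[OF assms(1,4,6,3)] closed_simulate[OF assms(2,5)] u0 assms(6)
    by (auto intro!: closed_init_common closed_for_loop closed_uset)
qed

text \<open>For inputs of length at most 1 the space and time bounds do not grow with the exponent; these
  inputs are answered from a table.\<close>

definition with_lookup :: "(sym \<Rightarrow> bool) \<Rightarrow> uf sf com \<Rightarrow> uf sf com" where
  "with_lookup small_table p = uact (\<lambda>k u a c. (u, keep c, Rgt, Stay)) ;; uset (\<lambda>k u a c. u\<lparr>usI := a\<rparr>) ;;
     uact (\<lambda>k u a c. (u, keep c, Rgt, Stay)) ;;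
     Cond (utest (\<lambda>k u a c. a = None)) (uset (\<lambda>k u a c. u\<lparr>uans := Some (small_table (usI u))\<rparr>))
       (uact (\<lambda>k u a c. (u, keep c, Lft, Stay)) ;; uact (\<lambda>k u a c. (u, keep c, Lft, Stay)) ;; p)"

lemma closed_with_lookup:
  "closed_flags (flag_set (uf_set Q P)) p \<Longrightarrow> closed_flags (flag_set (uf_set Q P)) (with_lookup small_table p)"
  by (auto simp: with_lookup_def intro!: closed_uset)

definition u0 :: uf where
  "u0 = \<lparr>uq = 0, ulab = 0, uans = None, usI = None, usW = None, usC = None, upI = 0, upW = 0, upC = 0,
     uaW = None, uaC = None, udI = Stay, udW = Stay, udC = Stay, umd = False\<rparr>"

lemma u0_mem: "0 < Q \<Longrightarrow> u0 \<in> uf_set Q P"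
  by (simp add: u0_def uf_set_def)

definition ast0 :: "bool list \<Rightarrow> uf ast" where
  "ast0 \<tau> = \<lparr>hs = 0, us = u0, rg = (\<lambda>_. 0), ip = 0, cp = 0, cc = \<tau>\<rparr>"

text \<open>A blank tape with no column in use represents registers that are all zero. No pass over
  the tape is made to prepare it, which matters when its length alone exhausts the time
  bound.\<close>

lemma rep_ast0: "clen * (X + 1) \<le> W \<Longrightarrow> rep X (ast0 \<tau>) ((False, [], 0, u0), init W \<tau>)"
  unfolding rep_def prod.case
  by (rule exI[of _ False], rule exI[of _ 0], rule exI[of _ W]) (auto simp: ast0_def init_def)

lemma wp_with_lookup_large:
  assumes n: "2 \<le> length x"
    and p: "\<And>b. rg b = (\<lambda>_. 0) \<Longrightarrow> ip b = 0 \<Longrightarrow> cp b = 0 \<Longrightarrow> cc b = \<tau> \<Longrightarrow> uans (us b) = None \<Longrightarrow> wp x X p T Q b"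
  shows "wp x X (with_lookup small_table p) (T + 12) Q (ast0 \<tau>)"
proof -
  have r: "rd x 2 \<noteq> None" using n by (simp add: rd_def)
  have m: "mv (length x) 0 Rgt = 1" "mv (length x) 1 Rgt = 2" "mv (length x) 2 Lft = 1" "mv (length x) 1 Lft = 0"
    using n by (auto simp: mv_def)
  let ?b = "(ast0 \<tau>)\<lparr>us := u0\<lparr>usI := rd x 1\<rparr>\<rparr>"
  have p0: "wp x X p T Q (?b\<lparr>ip := 0\<rparr>)" by (rule p) (auto simp: ast0_def u0_def)
  have B: "wp x X (uact (\<lambda>k u a c. (u, keep c, Lft, Stay)) ;; uact (\<lambda>k u a c. (u, keep c, Lft, Stay)) ;; p)
      (1 + (1 + T + 1) + 1) Q (?b\<lparr>ip := 2\<rparr>)"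
    by (rule wp_Seq, rule wp_imove, rule wp_Seq, rule wp_imove) (use p0 m in simp)
  have C: "wp x X (Cond (utest (\<lambda>k u a c. a = None)) (uset (\<lambda>k u a c. u\<lparr>uans := Some (small_table (usI u))\<rparr>))
       (uact (\<lambda>k u a c. (u, keep c, Lft, Stay)) ;; uact (\<lambda>k u a c. (u, keep c, Lft, Stay)) ;; p))
     (1 + (1 + T + 1) + 1 + 1) Q (?b\<lparr>ip := 2\<rparr>)"
    by (rule wp_Cond) (use r B in \<open>simp del: not_None_eq\<close>)
  have "wp x X (with_lookup small_table p) (1 + (1 + (1 + (1 + (1 + T + 1) + 1 + 1) + 1) + 1) + 1) Q (ast0 \<tau>)"
    unfolding with_lookup_def
    by (rule wp_Seq, rule wp_imove, rule wp_Seq, rule wp_uset, rule wp_Seq, rule wp_imove)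
      (use C m in \<open>simp add: ast0_def\<close>)
  then show ?thesis by (rule wp_weaken) simp
qed

lemma reach_imove:
  "reach x (uact (\<lambda>k u a c. (u, keep c, d, Stay))) (f, c) 1 (f, c\<lparr>ih := mv (length x) (ih c) d\<rparr>)"
proof (cases f)
  case (fields s b k u)
  show ?thesis unfolding fields uact_def by (rule reach_Act) (auto simp: upd_def)
qed

lemma reach_uset:
  "reach x (uset g) ((s, b, k, u), c) 1 ((s, b, k, g k u (rd x (ih c)) (rd (ct c) (ch c))), c)"
  unfolding uset_def uact_def by (rule reach_Act[OF _ upd_keep[symmetric]]) simp

lemma reach_with_lookup_small:
  assumes n: "length x \<le> 1"
  shows "\<exists>f c. reach x (with_lookup small_table p) ((False, [], 0, u0), init W \<tau>) 8 ((False, [], 0, f), c) \<and> ct c = \<tau> \<and>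
    uans f = Some (small_table (rd x 1))"
proof -
  have m: "mv (length x) 0 Rgt = 1" by (simp add: mv_def)
  let ?c = "(init W \<tau>)\<lparr>ih := 1\<rparr>" and ?u = "u0\<lparr>usI := rd x 1\<rparr>"
  let ?c2 = "?c\<lparr>ih := mv (length x) 1 Rgt\<rparr>"
  have r: "rd x (mv (length x) 1 Rgt) = None" using n by (auto simp: mv_def rd_def)
  have 1: "reach x (uact (\<lambda>k u a c. (u, keep c, Rgt, Stay))) ((False, [], 0, u0), init W \<tau>) 1 ((False, [], 0, u0), ?c)"
    using reach_imove[of x Rgt _ "init W \<tau>"] m by (simp add: init_def)
  have 2: "reach x (uset (\<lambda>k u a c. u\<lparr>usI := a\<rparr>)) ((False, [], 0, u0), ?c) 1 ((False, [], 0, ?u), ?c)"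
    using reach_uset[of x "\<lambda>k u a c. u\<lparr>usI := a\<rparr>" False "[]" 0 u0 ?c] by simp
  have 3: "reach x (uact (\<lambda>k u a c. (u, keep c, Rgt, Stay))) ((False, [], 0, ?u), ?c) 1 ((False, [], 0, ?u), ?c2)"
    using reach_imove[of x Rgt _ ?c] by simp
  have 4: "reach x (uset (\<lambda>k u a c. u\<lparr>uans := Some (small_table (usI u))\<rparr>)) ((False, [], 0, ?u), ?c2) 1
     ((False, [], 0, ?u\<lparr>uans := Some (small_table (rd x 1))\<rparr>), ?c2)"
    using reach_uset[of x "\<lambda>k u a c. u\<lparr>uans := Some (small_table (usI u))\<rparr>" False "[]" 0 ?u ?c2] by simp
  have 5: "reach x (Cond (utest (\<lambda>k u a c. a = None)) (uset (\<lambda>k u a c. u\<lparr>uans := Some (small_table (usI u))\<rparr>)) q)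
     ((False, [], 0, ?u), ?c2) (1 + 1) ((False, [], 0, ?u\<lparr>uans := Some (small_table (rd x 1))\<rparr>), ?c2)" for q
    by (rule reach_Cond) (use 4 r in \<open>simp add: utest_def\<close>)
  have "reach x (with_lookup small_table p) ((False, [], 0, u0), init W \<tau>) (1 + (1 + (1 + (1 + 1) + 1) + 1) + 1)
     ((False, [], 0, ?u\<lparr>uans := Some (small_table (rd x 1))\<rparr>), ?c2)"
    unfolding with_lookup_def by (rule reach_Seq[OF 1 reach_Seq[OF 2 reach_Seq[OF 3 5]]])
  then show ?thesis by (intro exI[of _ "?u\<lparr>uans := Some (small_table (rd x 1))\<rparr>"] exI[of _ ?c2])
      (auto simp: init_def elim!: reach_mono)
qed

definition out :: "uf sf \<Rightarrow> bool" where
  "out = (\<lambda>(s, b, k, u). uans u = Some True)"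

lemma realize:
  assumes cl: "closed_flags (flag_set (uf_set Q P)) p" and Q: "0 < Q"
  obtains Q' \<delta> where "valid Q' \<delta>"
    "\<And>x W \<tau> T s b k u c. reach x p ((False, [], 0, u0), init W \<tau>) T ((s, b, k, u), c) \<Longrightarrow>
       \<exists>t\<le>T + 1. result (run \<delta> x (init W \<tau>) t) = Some (uans u = Some True) \<and> ct (run \<delta> x (init W \<tau>) t) = ct c"
proof -
  have f0: "(False, [], 0, u0) \<in> flag_set (uf_set Q P)" using u0_mem[OF Q] by (simp add: flag_set_def)
  obtain Q' \<delta> where v: "valid Q' \<delta>" and s: "\<And>x c t f' c'. st c = 0 \<Longrightarrow> result c = None \<Longrightarrow>
       (sstep x ^^ t) ([p], (False, [], 0, u0), c) = ([], f', c') \<Longrightarrow>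
       result (run \<delta> x c (Suc t)) = Some (out f') \<and> ct (run \<delta> x c (Suc t)) = ct c'"
    using com_realizable[OF finite_flag_set[OF finite_uf_set] f0 cl, of out] by blast
  show thesis
  proof (rule that[OF v])
    fix x W \<tau> T s' b k u c
    assume "reach x p ((False, [], 0, u0), init W \<tau>) T ((s', b, k, u), c)"
    then obtain t where "t \<le> T" "(sstep x ^^ t) ([p], (False, [], 0, u0), init W \<tau>) = ([], (s', b, k, u), c)"
      unfolding reach_def by blast
    then show "\<exists>t\<le>T + 1. result (run \<delta> x (init W \<tau>) t) = Some (uans u = Some True) \<and> ct (run \<delta> x (init W \<tau>) t) = ct c"
      using s[where x = x and c = "init W \<tau>" and t = t and f' = "(s', b, k, u)" and c' = c] by (intro exI[of _ "Suc t"]) (auto simp: init_def out_def)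
  qed
qed

lemma wp_reach:
  assumes "wp x X p T Q (ast0 \<tau>)" "clen * (X + 1) \<le> W"
  shows "\<exists>s b k u c. reach x p ((False, [], 0, u0), init W \<tau>) T ((s, b, k, u), c) \<and>
    (\<exists>a. Q a \<and> us a = u \<and> cc a = ct c)"
  using assms(1)[unfolded wp_def, rule_format, OF rep_ast0[OF assms(2)]]
  by (fastforce simp: rep_def)

section \<open>Polynomial bounds and the theorem\<close>

text \<open>For \<open>n \<ge> 2\<close> constant factors and summands are absorbed by a larger
  exponent, so a pure power serves as normal form of a polynomial bound.\<close>

definition polyb :: "(nat \<Rightarrow> nat) \<Rightarrow> bool" where
  "polyb f \<longleftrightarrow> (\<exists>k. \<forall>n\<ge>2. f n \<le> n ^ k)"

lemma polyb_mono: "polyb g \<Longrightarrow> (\<And>n. 2 \<le> n \<Longrightarrow> f n \<le> g n) \<Longrightarrow> polyb f"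
  unfolding polyb_def using order_trans by blast

lemma polyb_const: "polyb (\<lambda>n. c)"
proof -
  have "c \<le> n ^ c" if "2 \<le> n" for n
  proof -
    have "c \<le> 2 ^ c" using less_exp[of c] by simp
    also have "\<dots> \<le> n ^ c" using that by (rule power_mono) simp
    finally show ?thesis .
  qed
  then show ?thesis unfolding polyb_def by blast
qed

lemma polyb_id: "polyb (\<lambda>n. n)"
  unfolding polyb_def by (intro exI[of _ 1]) simp

lemma polyb_add:
  assumes "polyb f" "polyb g"
  shows "polyb (\<lambda>n. f n + g n)"
proof -
  obtain a b where ab: "\<And>n. 2 \<le> n \<Longrightarrow> f n \<le> n ^ a" "\<And>n. 2 \<le> n \<Longrightarrow> g n \<le> n ^ b"
    using assms unfolding polyb_def by blast
  have "f n + g n \<le> n ^ (max a b + 1)" if n: "2 \<le> n" for n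
  proof -
    have "n ^ a \<le> n ^ max a b" "n ^ b \<le> n ^ max a b" using n by (auto intro!: power_increasing)
    then have "f n + g n \<le> 2 * n ^ max a b" using ab[OF n] by linarith
    also have "\<dots> \<le> n * n ^ max a b" using n by (rule mult_le_mono1)
    finally show ?thesis by simp
  qed
  then show ?thesis unfolding polyb_def by blast
qed

lemma polyb_mult:
  assumes "polyb f" "polyb g"
  shows "polyb (\<lambda>n. f n * g n)"
proof -
  obtain a b where ab: "\<And>n. 2 \<le> n \<Longrightarrow> f n \<le> n ^ a" "\<And>n. 2 \<le> n \<Longrightarrow> g n \<le> n ^ b"
    using assms unfolding polyb_def by blast
  have "f n * g n \<le> n ^ (a + b)" if "2 \<le> n" for n
    unfolding power_add using ab[OF that] by (rule mult_le_mono)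
  then show ?thesis unfolding polyb_def by blast
qed

lemma polyb_power: "polyb f \<Longrightarrow> polyb (\<lambda>n. f n ^ k)"
  by (induction k) (auto intro: polyb_mult polyb_const)

lemma polyb_floorlog: "polyb (\<lambda>n. floorlog 2 n)"
  by (rule polyb_mono[OF polyb_id]) (rule floorlog2_le, simp)

text \<open>Logarithmic space enters here: a work tape of \<open>k * floorlog 2 n\<close> bits has
  only polynomially many contents, because \<open>2 ^ floorlog 2 n\<close> is at most
  \<open>2 * n\<close>.\<close>

lemma polyb_exp_floorlog: "polyb (\<lambda>n. 2 ^ (k * floorlog 2 n))"
proof (rule polyb_mono)
  show "polyb (\<lambda>n. (2 * n) ^ k)" by (intro polyb_power polyb_mult polyb_const polyb_id)
  fix n :: nat assume "2 \<le> n"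
  then have b: "2 ^ (floorlog 2 n - 1) \<le> n" "0 < floorlog 2 n" using floorlog2_bounds[of n] by auto
  then have "(2::nat) ^ floorlog 2 n \<le> 2 * n" by (cases "floorlog 2 n") auto
  then have "((2::nat) ^ floorlog 2 n) ^ k \<le> (2 * n) ^ k" by (rule power_mono) simp
  then show "2 ^ (k * floorlog 2 n) \<le> (2 * n) ^ k" by (simp add: power_mult[symmetric] mult.commute)
qed

lemmas polyb_intros = polyb_const polyb_id polyb_add polyb_mult polyb_power polyb_floorlog polyb_exp_floorlog

lemma polyb_obtain:
  assumes "polyb f"
  obtains k where "\<And>K n. k \<le> K \<Longrightarrow> 2 \<le> n \<Longrightarrow> f n \<le> n ^ K"
proof -
  obtain k where k: "\<And>n. 2 \<le> n \<Longrightarrow> f n \<le> n ^ k" using assms unfolding polyb_def by blast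
  have "f n \<le> n ^ K" if "k \<le> K" "2 \<le> n" for K n
  proof -
    have "n ^ k \<le> n ^ K" using that by (intro power_increasing) auto
    then show ?thesis using k[OF that(2)] by linarith
  qed
  then show thesis by (rule that)
qed

lemma polyb_sweep_time: "polyb X \<Longrightarrow> polyb (\<lambda>n. sweep_time (X n))"
  unfolding sweep_time_def by (intro polyb_intros)

lemma polyb_tape_time: "polyb X \<Longrightarrow> polyb (\<lambda>n. tape_time (X n))"
  unfolding tape_time_def by (intro polyb_intros polyb_sweep_time)

definition small_table :: "bool list set \<Rightarrow> sym \<Rightarrow> bool" where
  "small_table L s = (case s of None \<Rightarrow> [] \<in> L | Some b \<Rightarrow> [b] \<in> L)"

lemma small_table_correct: "length x \<le> 1 \<Longrightarrow> small_table L (rd x 1) = (x \<in> L)"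
  by (cases x) (auto simp: small_table_def rd_def)

text \<open>\<open>X\<close> exceeds \<open>n ^ k + 1\<close> and
  \<open>k * floorlog 2 n + 1\<close>, the exponents of the one-hot ends of the two simulated tapes.
  The final 13 consists of 12 steps around the lookup and one for halting.\<close>

definition time_P :: "nat \<Rightarrow> nat \<Rightarrow> nat" where
  "time_P k n = (let X = n ^ k + k * n + n + 3 in
     inita_time X n k + (1 + ((n ^ k + k + 1) * (12 * tape_time X + 1) + 1) + 1) + 13)"

lemma polyb_time_P: "polyb (time_P k)"
  unfolding time_P_def Let_def inita_time_def init0_time_def pow_time_def
  by (intro polyb_intros polyb_sweep_time polyb_tape_time)

text \<open>Answer and time bound hold for every initial catalytic content, in particular for zeros.
  That content has polynomial length and fits into one register on the work tape of the simulating
  machine.\<close>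

theorem AVG_LCL_P_subset_P_class: "AVG_LCL_P \<subseteq> P_class"
proof
  fix L assume "L \<in> AVG_LCL_P"
  then obtain k and e :: real and Q \<delta> where v: "valid Q \<delta>" and H: "\<And>x \<tau>. length \<tau> = length x ^ k \<Longrightarrow>
      \<exists>t\<le>length x ^ k + k. result (run \<delta> x (init (work_bits k (length x)) \<tau>) t) = Some (x \<in> L)"
    unfolding AVG_LCL_P_def Let_def mem_Collect_eq by blast
  have Q0: "0 < Q" using v by (simp add: valid_def)
  let ?d = "restrict Q \<delta>"
  have sd: "strict Q ?d" by (rule strict_restrict[OF v])
  have vd: "valid Q ?d" by (rule strict_valid[OF Q0 sd])
  define p where "p = with_lookup (small_table L) (main_P k ?d)"
  have cl: "closed_flags (flag_set (uf_set Q 0)) p"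
    unfolding p_def by (intro closed_with_lookup closed_main_P sd Q0)
  obtain Q' \<delta>' where v': "valid Q' \<delta>'" and R: "\<And>x W \<tau> T s b j u c. reach x p ((False, [], 0, u0), init W \<tau>) T ((s, b, j, u), c) \<Longrightarrow>
       \<exists>t\<le>T + 1. result (run \<delta>' x (init W \<tau>) t) = Some (uans u = Some True) \<and> ct (run \<delta>' x (init W \<tau>) t) = ct c"
    using realize[OF cl Q0] by blast
  let ?X = "\<lambda>n. n ^ k + k * n + n + 3"
  obtain K1 where K1: "\<And>K n. K1 \<le> K \<Longrightarrow> 2 \<le> n \<Longrightarrow> time_P k n \<le> n ^ K" using polyb_obtain[OF polyb_time_P] by blast
  have "polyb (\<lambda>n. clen * (?X n + 1))" by (intro polyb_intros)
  then obtain K2 where K2: "\<And>K n. K2 \<le> K \<Longrightarrow> 2 \<le> n \<Longrightarrow> clen * (?X n + 1) \<le> n ^ K" using polyb_obtain by blast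
  \<comment> \<open>\<open>K1\<close> is for the time and \<open>K2\<close> for the space; 9 pays
    for the table lookup, which takes at most 8 steps and one more for halting.\<close>
  define K where "K = K1 + K2 + 9"
  have "\<exists>t\<le>length x ^ K + K. result (run \<delta>' x (init (length x ^ K + K) []) t) = Some (x \<in> L)" for x
  proof (cases "length x \<le> 1")
    case True
    obtain f c where rc: "reach x p ((False, [], 0, u0), init (length x ^ K + K) []) 8 ((False, [], 0, f), c)"
      and f: "uans f = Some (small_table L (rd x 1))"
      using reach_with_lookup_small[OF True, of "small_table L" "main_P k ?d" "length x ^ K + K" "[]"] unfolding p_def by blast
    obtain t where "t \<le> 8 + 1" "result (run \<delta>' x (init (length x ^ K + K) []) t) = Some (uans f = Some True)"
      using R[OF rc] by blast
    then show ?thesis using f small_table_correct[OF True, of L] by (intro exI[of _ t]) (auto simp: K_def)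
  next
    case False
    let ?n = "length x"
    let ?t = "?n ^ k + k"
    have n: "2 \<le> ?n" using False by simp
    obtain t where t: "t \<le> ?t" "result (run \<delta> x (init (k * floorlog 2 ?n) (replicate (?n ^ k) False)) t) = Some (x \<in> L)"
      using H[of "replicate (?n ^ k) False" x] by (auto simp: work_bits_def)
    have Lle: "floorlog 2 ?n \<le> ?n" by (rule floorlog2_le) (use n in linarith)
    have kL: "k * floorlog 2 ?n + 1 < ?X ?n" using mult_le_mono2[OF Lle, of k] by linarith
    have nX: "?n + 1 < 2 ^ ?X ?n" using less_exp[of "?X ?n"] by linarith
    have Hr: "result (run ?d x (init (k * floorlog 2 ?n) (replicate (?n ^ k) False)) t) = Some (x \<in> L)"
      using t(2) run_restrict[OF v, of "init (k * floorlog 2 ?n) (replicate (?n ^ k) False)" x t] Q0 by (simp add: init_def)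
    have "wp x (?X ?n) p (inita_time (?X ?n) ?n k + (1 + ((t + 1) * (12 * tape_time (?X ?n) + 1) + 1) + 1) + 12)
       (\<lambda>b. uans (us b) = Some (x \<in> L)) (ast0 [])"
      unfolding p_def
      by (rule wp_with_lookup_large[OF n], rule wp_main_P[OF vd]) (use n Lle kL nX Hr in auto)
    moreover have "clen * (?X ?n + 1) \<le> ?n ^ K + K" using K2[of K ?n] n by (simp add: K_def)
    ultimately obtain s b j u c where
      "reach x p ((False, [], 0, u0), init (?n ^ K + K) [])
         (inita_time (?X ?n) ?n k + (1 + ((t + 1) * (12 * tape_time (?X ?n) + 1) + 1) + 1) + 12) ((s, b, j, u), c)"
      "uans u = Some (x \<in> L)" using wp_reach by blast
    from R[OF this(1)] this(2) obtain t' where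
      t': "t' \<le> inita_time (?X ?n) ?n k + (1 + ((t + 1) * (12 * tape_time (?X ?n) + 1) + 1) + 1) + 12 + 1"
        "result (run \<delta>' x (init (?n ^ K + K) []) t') = Some (x \<in> L)" by auto
    have "(t + 1) * (12 * tape_time (?X ?n) + 1) \<le> (?t + 1) * (12 * tape_time (?X ?n) + 1)"
      using t(1) by (intro mult_le_mono1) simp
    then have "t' \<le> time_P k ?n" using t'(1) by (simp add: time_P_def Let_def del: mult_le_cancel2)
    also have "\<dots> \<le> ?n ^ K" by (rule K1[OF _ n]) (simp add: K_def)
    finally show ?thesis using t'(2) by (intro exI[of _ t']) auto
  qed
  then show "L \<in> P_class" unfolding P_class_def using v' by (auto simp: Let_def)
qed

lemma AVG_LCL_P_subset_AVG_LCL: "AVG_LCL_P \<subseteq> AVG_LCL"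
  unfolding AVG_LCL_P_def AVG_LCL_def Let_def by blast

section \<open>Expected distance when only tapes without a fitting block are damaged\<close>

lemma power_le_exp: "\<exists>C. \<forall>n. real n ^ k \<le> C * 2 ^ n"
proof (cases "k = 0")
  case False
  have "n ^ k \<le> k ^ k * 2 ^ n" for n :: nat
  proof -
    \<comment> \<open>Rounding \<open>n\<close> up to a multiple of \<open>k\<close> and using that
      \<open>j + 1\<close> is at most \<open>2 ^ j\<close> for \<open>j = n div k\<close>; the
      \<open>k\<close>-th power of \<open>2 ^ j\<close> is then at most
      \<open>2 ^ n\<close>.\<close>
    have "n = k * (n div k) + n mod k" by simp
    moreover have "n mod k < k" using False by simp
    ultimately have "n \<le> k * (n div k + 1)" unfolding distrib_left by linarith
    also have "\<dots> \<le> k * 2 ^ (n div k)" 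
      by (intro mult_le_mono2) (simp only: Suc_eq_plus1[symmetric] Suc_le_eq less_exp)
    finally have "n ^ k \<le> (k * 2 ^ (n div k)) ^ k" by (rule power_mono) simp
    also have "\<dots> = k ^ k * 2 ^ (n div k * k)" by (simp add: power_mult_distrib power_mult)
    also have "\<dots> \<le> k ^ k * 2 ^ n" by (intro mult_le_mono2 power_increasing) auto
    finally show ?thesis .
  qed
  then have "real (n ^ k) \<le> real (k ^ k * 2 ^ n)" for n by (rule of_nat_mono)
  then show ?thesis by (intro exI[of _ "real (k ^ k)"]) simp
next
  case True
  have "(1::real) \<le> 2 ^ n" for n :: nat by simp
  then show ?thesis using True by (intro exI[of _ 1]) simp
qed

text \<open>The blocks occupy disjoint parts of the tape: a tape all of whose blocks are in
  \<open>B\<close> splits into a first block in \<open>B\<close> and a rest of the same kind. Each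
  block halves the proportion, and cells behind the last block are free.\<close>

lemma card_all_blocks:
  assumes B: "2 * card B \<le> 2 ^ m" "B \<subseteq> {\<sigma>. length \<sigma> = m}"
  shows "n * m \<le> M \<Longrightarrow> 2 ^ n * card {\<tau>. length \<tau> = M \<and> (\<forall>i<n. block m \<tau> i \<in> B)} \<le> 2 ^ M"
proof (induction n arbitrary: M)
  case 0
  have "card {xs :: bool list. length xs = M} = 2 ^ M" using card_lists_length_eq[of "UNIV :: bool set" M] by simp
  then show ?case by simp
next
  case (Suc n)
  have fin: "finite {xs :: bool list. length xs = j}" for j using finite_lists_length_eq[of "UNIV :: bool set" j] by simp
  let ?S = "\<lambda>n M. {\<tau>. length \<tau> = M \<and> (\<forall>i<n. block m \<tau> i \<in> B)}"
  have "?S (Suc n) M \<subseteq> (\<lambda>(a, b). a @ b) ` (B \<times> ?S n (M - m))"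
  proof
    fix \<tau> assume t: "\<tau> \<in> ?S (Suc n) M"
    have b: "block m (drop m \<tau>) i = block m \<tau> (Suc i)" for i by (simp add: block_def add.commute)
    have "take m \<tau> \<in> B" using t by (auto simp: block_def dest: spec[of _ 0])
    moreover have "drop m \<tau> \<in> ?S n (M - m)" using t b by auto
    ultimately show "\<tau> \<in> (\<lambda>(a, b). a @ b) ` (B \<times> ?S n (M - m))"
      by (intro image_eqI[of _ _ "(take m \<tau>, drop m \<tau>)"]) auto
  qed
  moreover have "finite (B \<times> ?S n (M - m))"
    using finite_subset[OF B(2) fin] finite_subset[OF _ fin[of "M - m"], of "?S n (M - m)"] by auto
  ultimately have "card (?S (Suc n) M) \<le> card (B \<times> ?S n (M - m))" by (rule surj_card_le[rotated])
  also have "\<dots> = card B * card (?S n (M - m))" by (rule card_cartesian_product)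
  finally have "2 ^ Suc n * card (?S (Suc n) M) \<le> 2 ^ Suc n * (card B * card (?S n (M - m)))" by (rule mult_le_mono2)
  also have "\<dots> = (2 * card B) * (2 ^ n * card (?S n (M - m)))" by simp
  also have "\<dots> \<le> 2 ^ m * 2 ^ (M - m)" using B(1) Suc.IH[of "M - m"] Suc.prems by (intro mult_le_mono) auto
  also have "\<dots> = 2 ^ M" using Suc.prems by (simp flip: power_add)
  finally show ?case .
qed

text \<open>Tapes outside \<open>B\<close> contribute nothing, those in \<open>B\<close> at most
  their length \<open>M\<close>, and \<open>B\<close> makes up at most one part in
  \<open>2 ^ n\<close> of all tapes.\<close>

lemma exp_dist_le:
  assumes B: "2 ^ n * card B \<le> 2 ^ M" "B \<subseteq> {\<tau>. length \<tau> = M}"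
    and F: "\<And>\<tau>. length \<tau> = M \<Longrightarrow> \<tau> \<notin> B \<Longrightarrow> ct (final \<delta> x (init s \<tau>)) = \<tau>"
  shows "exp_dist \<delta> x s M \<le> real M / 2 ^ n"
proof -
  let ?L = "{\<tau> :: bool list. length \<tau> = M}"
  let ?h = "\<lambda>\<tau>. real (hamming \<tau> (ct (final \<delta> x (init s \<tau>))))"
  have fin: "finite ?L" using finite_lists_length_eq[of "UNIV :: bool set" M] by simp
  have "(\<Sum>\<tau>\<in>?L. ?h \<tau>) = (\<Sum>\<tau>\<in>B. ?h \<tau>)"
    using B(2) F by (intro sum.mono_neutral_right fin) (auto simp: hamming_def)
  also have "\<dots> \<le> (\<Sum>\<tau>\<in>B. real M)"
  proof (rule sum_mono)
    fix \<tau> assume "\<tau> \<in> B"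
    then have "length \<tau> = M" using B(2) by auto
    then have "hamming \<tau> (ct (final \<delta> x (init s \<tau>))) \<le> card {..<M}"
      unfolding hamming_def by (intro card_mono) auto
    then show "?h \<tau> \<le> real M" by simp
  qed
  also have "\<dots> = real (card B) * real M" by simp
  finally have 1: "(\<Sum>\<tau>\<in>?L. ?h \<tau>) \<le> real (card B) * real M" .
  have "real (2 ^ n * card B) \<le> real (2 ^ M)" using B(1) by (simp only: of_nat_le_iff)
  then have "2 ^ n * real (card B) * real M \<le> 2 ^ M * real M" by (intro mult_right_mono) auto
  then have "real (card B) * real M \<le> real M / 2 ^ n * 2 ^ M" by (simp add: field_simps)
  then have "(\<Sum>\<tau>\<in>?L. ?h \<tau>) \<le> real M / 2 ^ n * 2 ^ M" using 1 by linarith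
  then show ?thesis unfolding exp_dist_def by (simp add: pos_divide_le_eq)
qed

definition time_AVG :: "nat \<Rightarrow> nat \<Rightarrow> nat \<Rightarrow> nat \<Rightarrow> nat" where
  "time_AVG k kT c n = (let X = floorlog 2 n * (k + kT + 2 * c + 4) in
     initb_time X n k kT c + ((n + 1) * (block_time X (n ^ kT) (n ^ k) + 3 * sweep_time X) +
       (fb_time X (n * n ^ k) (n ^ c + c) (n ^ c + c) + 1) + 1) + 13)"

lemma polyb_time_AVG: "polyb (time_AVG k kT c)"
  unfolding time_AVG_def Let_def initb_time_def init0_time_def pow_time_def block_time_def fb_time_def
  by (intro polyb_intros polyb_sweep_time polyb_tape_time)

lemma fb_time_mono: "t \<le> t' \<Longrightarrow> fb_time X p N t \<le> fb_time X p N t'"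
  unfolding fb_time_def by (intro add_le_mono mult_le_mono order_refl)

text \<open>Everything is reduced to \<open>n < 2 ^ floorlog 2 n\<close>, which turns a power
  \<open>n ^ j\<close> into \<open>j * floorlog 2 n\<close> bits. The second multiple of
  \<open>c\<close> in \<open>X\<close> pays for the summand \<open>c\<close> in
  \<open>n ^ c + c\<close>.\<close>

lemma register_bounds:
  fixes n k kT c :: nat
  defines "X \<equiv> floorlog 2 n * (k + kT + 2 * c + 4)"
  assumes n: "2 \<le> n"
  shows "n ^ k + 1 < 2 ^ X" "n + 1 < 2 ^ X" "2 ^ (k * floorlog 2 n + 1) < (2::nat) ^ X" "2 ^ floorlog 2 n < (2::nat) ^ X"
    "n ^ kT < 2 ^ X" "n ^ c + c + 1 < 2 ^ X"
proof -
  let ?L = "floorlog 2 n"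
  have L: "n < 2 ^ ?L" "0 < ?L" using floorlog2_bounds[of n] n by auto
  have X: "X = k * ?L + kT * ?L + 2 * (c * ?L) + 4 * ?L" by (simp add: X_def algebra_simps)
  have put: "n ^ j \<le> 2 ^ (j * ?L)" for j
    using power_mono[of n "2 ^ ?L" j] L by (simp add: power_mult[symmetric] mult.commute)
  have lt: "(2::nat) ^ j < 2 ^ X" if "j < X" for j using that by simp
  show "2 ^ (k * ?L + 1) < (2::nat) ^ X" by (rule lt) (use X L in linarith)
  show "2 ^ ?L < (2::nat) ^ X" by (rule lt) (use X L in linarith)
  then show "n + 1 < 2 ^ X" using L by linarith
  show "n ^ kT < 2 ^ X" by (rule le_less_trans[OF put lt]) (use X L in linarith)
  have "(2::nat) ^ (k * ?L + 1) < 2 ^ X" by (rule lt) (use X L in linarith)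
  moreover have "n ^ k + 1 \<le> 2 ^ (k * ?L + 1)"
  proof -
    have "(1::nat) \<le> 2 ^ (k * ?L)" by simp
    then show ?thesis using put[of k] unfolding power_add power_one_right by linarith
  qed
  ultimately show "n ^ k + 1 < 2 ^ X" by linarith
  have "c \<le> c * ?L" using L by simp
  then have "(2::nat) ^ (c * ?L + c + 2) < 2 ^ X" by (intro lt) (use X L in linarith)
  moreover have "n ^ c + c + 1 \<le> 2 ^ (c * ?L + c + 2)"
  proof -
    have "c + 1 < 2 ^ (c + 1)" by (rule less_exp)
    moreover have "(2::nat) ^ (c + 1) \<le> 2 ^ (c * ?L + c + 1)" "(2::nat) ^ (c * ?L) \<le> 2 ^ (c * ?L + c + 1)"
      by (intro power_increasing; simp)+
    moreover have "(2::nat) ^ (c * ?L + c + 2) = 2 ^ (c * ?L + c + 1) + 2 ^ (c * ?L + c + 1)" by simp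
    ultimately show ?thesis using put[of c] by linarith
  qed
  ultimately show "n ^ c + c + 1 < 2 ^ X" by linarith
qed

text \<open>The constants are fixed in the order \<open>D\<close>, \<open>kT\<close>,
  \<open>K\<close>, \<open>C\<close>: the radius depends on the old error bound, the tour length on
  the radius, the new space exponent on both machines and the tour, and the new error bound on this
  exponent alone.\<close>

theorem AVG_LCL_Int_P_class_subset: "AVG_LCL \<inter> P_class \<subseteq> AVG_LCL_P"
proof
  fix L assume L: "L \<in> AVG_LCL \<inter> P_class"
  obtain k and e :: real and Q \<delta> where v: "valid Q \<delta>" and H: "\<And>x \<tau>. length \<tau> = length x ^ k \<Longrightarrow>
      \<exists>t. result (run \<delta> x (init (work_bits k (length x)) \<tau>) t) = Some (x \<in> L)"
    and ex: "\<And>x. exp_dist \<delta> x (work_bits k (length x)) (length x ^ k) \<le> e"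
    using L unfolding AVG_LCL_def Let_def Int_iff mem_Collect_eq by blast
  obtain c Q1 \<delta>1 where v1: "valid Q1 \<delta>1" and H1: "\<And>x. \<exists>t\<le>length x ^ c + c.
      result (run \<delta>1 x (init (length x ^ c + c) []) t) = Some (x \<in> L)"
    using L unfolding P_class_def Let_def Int_iff mem_Collect_eq by blast
  have Q0: "0 < Q" "0 < Q1" using v v1 by (auto simp: valid_def)
  let ?d = "restrict Q \<delta>" and ?f = "swapm (restrict Q1 \<delta>1)"
  have sd: "strict Q ?d" "strict Q1 ?f" using strict_restrict v v1 strict_swapm by auto
  have vd: "valid Q ?d" "valid Q1 ?f" using strict_valid Q0 sd by auto
  define P where "P = length (labs Q)"
  define D where "D = nat \<lceil>4 * e\<rceil>"
  have D: "4 * e \<le> real D + 1" using real_nat_ceiling_ge[of "4 * e"] by (simp add: D_def)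
  have "polyb (\<lambda>n. 4 * ((n ^ k + 1) ^ D * ((P + 1) * (Q * (n + 2) * (k * floorlog 2 n + 2) * (n ^ k + 2) * 2 ^ (k * floorlog 2 n)))))"
    by (intro polyb_intros)
  \<comment> \<open>The tour length \<open>n ^ kT\<close> is chosen above the threshold in
    \<open>card_not_fits\<close>; it is polynomial because the work space is logarithmic and
    \<open>D\<close> is constant.\<close>
  then obtain kT where kT: "\<And>n. 2 \<le> n \<Longrightarrow>
     4 * ((n ^ k + 1) ^ D * ((P + 1) * (Q * (n + 2) * (k * floorlog 2 n + 2) * (n ^ k + 2) * 2 ^ (k * floorlog 2 n)))) \<le> n ^ kT"
    using polyb_obtain by (metis (no_types, lifting) order_refl)
  define p where "p = with_lookup (small_table L) (main_AVG k kT c Q ?d ?f)"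
  \<comment> \<open>The two simulated machines share one finite control, so its state component has
    to range over the states of both.\<close>
  have cl: "closed_flags (flag_set (uf_set (max Q Q1) P)) p"
    unfolding p_def by (rule closed_with_lookup, rule closed_main_AVG[OF sd Q0(1)]) (auto simp: P_def)
  have Qm: "0 < max Q Q1" using Q0 by simp
  obtain Q' \<delta>' where v': "valid Q' \<delta>'" and R: "\<And>x W \<tau> T s b j u c. reach x p ((False, [], 0, u0), init W \<tau>) T ((s, b, j, u), c) \<Longrightarrow>
       \<exists>t\<le>T + 1. result (run \<delta>' x (init W \<tau>) t) = Some (uans u = Some True) \<and> ct (run \<delta>' x (init W \<tau>) t) = ct c"
    using realize[OF cl Qm] by blast
  obtain K1 where K1: "\<And>K n. K1 \<le> K \<Longrightarrow> 2 \<le> n \<Longrightarrow> time_AVG k kT c n \<le> n ^ K" using polyb_obtain[OF polyb_time_AVG] by blast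
  have "polyb (\<lambda>n. n * n ^ k + (n ^ c + c + 1))" by (intro polyb_intros)
  then obtain K2 where K2: "\<And>K n. K2 \<le> K \<Longrightarrow> 2 \<le> n \<Longrightarrow> n * n ^ k + (n ^ c + c + 1) \<le> n ^ K" using polyb_obtain by blast
  \<comment> \<open>\<open>K1\<close> bounds the time, \<open>K2\<close> the blocks and the fallback
    tape, and 9 the lookup. The last summand makes \<open>K * floorlog 2 n\<close> work bits hold
    the \<open>X + 1\<close> columns of \<open>clen\<close> bits.\<close>
  define K where "K = K1 + K2 + 9 + clen * (k + kT + 2 * c + 5)"
  \<comment> \<open>The new error bound: the tape length \<open>n ^ K\<close>, divided by the
    \<open>2 ^ n\<close> of the failure probability, is bounded uniformly in
    \<open>n\<close>.\<close>
  obtain C where C: "\<And>n. real n ^ K \<le> C * 2 ^ n" using power_le_exp[of K] by blast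
  have C': "real (n ^ K) / 2 ^ n \<le> C" for n using C[of n] by (simp add: divide_le_eq)
  have main: "(\<forall>\<tau>. length \<tau> = length x ^ K \<longrightarrow> (\<exists>t\<le>length x ^ K + K.
        result (run \<delta>' x (init (work_bits K (length x)) \<tau>) t) = Some (x \<in> L))) \<and>
      exp_dist \<delta>' x (work_bits K (length x)) (length x ^ K) \<le> C" for x
  proof (cases "length x \<le> 1")
    case True
    let ?W = "work_bits K (length x)"
    have r: "\<exists>t\<le>length x ^ K + K. result (run \<delta>' x (init ?W \<tau>) t) = Some (x \<in> L) \<and> ct (run \<delta>' x (init ?W \<tau>) t) = \<tau>" for \<tau>
    proof -
      obtain f c where rc: "reach x p ((False, [], 0, u0), init ?W \<tau>) 8 ((False, [], 0, f), c)" and ct: "ct c = \<tau>"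
        and f: "uans f = Some (small_table L (rd x 1))"
        using reach_with_lookup_small[OF True, of "small_table L" "main_AVG k kT c Q ?d ?f" ?W \<tau>] unfolding p_def by blast
      obtain t where "t \<le> 8 + 1" "result (run \<delta>' x (init ?W \<tau>) t) = Some (uans f = Some True)"
        "ct (run \<delta>' x (init ?W \<tau>) t) = ct c" using R[OF rc] by blast
      then show ?thesis using f ct small_table_correct[OF True, of L] by (intro exI[of _ t]) (auto simp: K_def)
    qed
    have "exp_dist \<delta>' x ?W (length x ^ K) \<le> real (length x ^ K) / 2 ^ length x"
    \<comment> \<open>Inputs answered from the table leave the catalytic tape untouched, so no
      content is exceptional.\<close>
    proof (rule exp_dist_le[where B = "{}"])
      fix \<tau>
      obtain t where "result (run \<delta>' x (init ?W \<tau>) t) = Some (x \<in> L)" "ct (run \<delta>' x (init ?W \<tau>) t) = \<tau>" using r by blast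
      then show "ct (final \<delta>' x (init ?W \<tau>)) = \<tau>" using final_eq_run[of \<delta>' x "init ?W \<tau>" t] by simp
    qed auto
    then show ?thesis using r C'[of "length x"] by (meson order_trans)
  next
    case False
    define n where "n = length x"
    have n: "2 \<le> n" using False by (simp add: n_def)
    define X where "X = floorlog 2 n * (k + kT + 2 * c + 4)"
    let ?s = "k * floorlog 2 n" and ?m = "n ^ k" and ?T = "n ^ kT" and ?N = "n ^ c + c" and ?W = "work_bits K n"
    interpret M: tour Q ?d x ?s ?m by unfold_locales (rule vd)
    have Lp: "0 < floorlog 2 n" using floorlog2_bounds[of n] n by simp
    have W: "clen * (X + 1) \<le> ?W"
    proof -
      have "X + 1 \<le> (k + kT + 2 * c + 5) * floorlog 2 n" using Lp by (simp add: X_def algebra_simps)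
      then have "clen * (X + 1) \<le> clen * ((k + kT + 2 * c + 5) * floorlog 2 n)" by (rule mult_le_mono2)
      also have "\<dots> = (clen * (k + kT + 2 * c + 5)) * floorlog 2 n" by (simp only: mult.assoc)
      also have "\<dots> \<le> K * floorlog 2 n" by (rule mult_le_mono1) (simp add: K_def)
      finally show ?thesis by (simp add: work_bits_def)
    qed
    have len: "n * ?m + (?N + 1) \<le> n ^ K" using K2[of K n] n by (simp add: K_def)
    have rM: "\<exists>t. result (run ?d x (init ?s \<sigma>) t) = Some (x \<in> L)" if "length \<sigma> = ?m" for \<sigma>
      using H[of \<sigma> x] that run_restrict[OF v, of "init ?s \<sigma>" x] Q0 by (auto simp: work_bits_def n_def init_def)
    obtain t1 where t1: "t1 \<le> ?N" "result (run ?f x (init ?s (replicate ?N False)) t1) = Some (x \<in> L)"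
      using H1[of x] run_restrict[OF v1, of "init ?N []" x] Q0 unfolding result_swapm by (auto simp: n_def init_def)
    have fin_M: "final ?d x (init ?s \<sigma>) = final \<delta> x (init ?s \<sigma>)" for \<sigma>
      using run_restrict[OF v, of "init ?s \<sigma>" x] Q0 by (simp add: final_def halting_time_def init_def)
    have "2 * card {\<sigma>. length \<sigma> = ?m \<and> \<not> M.fits ?T \<sigma>} \<le> 2 ^ ?m"
    proof (rule M.card_not_fits[OF _ _ D])
      show "\<exists>t b. result (run ?d x (init ?s \<sigma>) t) = Some b" if "length \<sigma> = ?m" for \<sigma> using rM[OF that] by blast
      show "exp_dist ?d x ?s ?m \<le> e" 
        unfolding exp_dist_def fin_M using ex[of x] by (simp add: exp_dist_def work_bits_def n_def)
      show "4 * ((?m + 1) ^ D * ((length (labs Q) + 1) * (Q * (length x + 2) * (?s + 2) * (?m + 2) * 2 ^ ?s))) \<le> ?T"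
        using kT[OF n] by (simp only: P_def n_def)
      show "0 < ?T" using n by simp
    qed
    then have bad: "2 ^ n * card {\<tau>. length \<tau> = n ^ K \<and> (\<forall>i<n. block ?m \<tau> i \<in> {\<sigma>. length \<sigma> = ?m \<and> \<not> M.fits ?T \<sigma>})} \<le> 2 ^ (n ^ K)"
      by (rule card_all_blocks) (use len in auto)
    let ?B = "{\<tau>. length \<tau> = n ^ K \<and> (\<forall>i<n. block ?m \<tau> i \<in> {\<sigma>. length \<sigma> = ?m \<and> \<not> M.fits ?T \<sigma>})}"
    have r: "\<exists>t\<le>n ^ K + K. result (run \<delta>' x (init ?W \<tau>) t) = Some (x \<in> L) \<and>
       (\<tau> \<notin> ?B \<longrightarrow> ct (run \<delta>' x (init ?W \<tau>) t) = \<tau>)" if t: "length \<tau> = n ^ K" for \<tau>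
    proof -
      define R' where "R' b \<longleftrightarrow> uans (us b) = Some (x \<in> L) \<and> ((\<exists>i<n. M.fits ?T (block ?m \<tau> i)) \<longrightarrow> cc b = \<tau>)"
        for b :: "uf ast"
      let ?t = "initb_time X n k kT c + ((n + 1) * (block_time X ?T ?m + 3 * sweep_time X) + (fb_time X (n * ?m) ?N t1 + 1) + 1)"
      have wpp: "wp x X p (?t + 12) R' (ast0 \<tau>)"
        unfolding p_def
      proof (rule wp_with_lookup_large)
        show "2 \<le> length x" using n by (simp add: n_def)
        fix b :: "uf ast"
        assume b: "rg b = (\<lambda>_. 0)" "ip b = 0" "cp b = 0" "cc b = \<tau>" "uans (us b) = None"
        note rb = register_bounds[OF n, where k = k and kT = kT and c = c, folded X_def]
        show "wp x X (main_AVG k kT c Q ?d ?f) ?t R' b"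
          unfolding n_def R'_def
          by (rule wp_main_AVG[OF vd b], fold n_def) (use n rb len t rM t1(2) in auto)
      qed
      obtain s b j u c' a where rc: "reach x p ((False, [], 0, u0), init ?W \<tau>) (?t + 12) ((s, b, j, u), c')"
        and a: "R' a" "us a = u" "cc a = ct c'" using wp_reach[OF wpp W] by blast
      obtain t' where t': "t' \<le> ?t + 12 + 1" "result (run \<delta>' x (init ?W \<tau>) t') = Some (x \<in> L)"
        "ct (run \<delta>' x (init ?W \<tau>) t') = ct c'" using R[OF rc] a(1,2) by (auto simp: R'_def)
      have "t' \<le> time_AVG k kT c n"
        using t'(1) fb_time_mono[OF t1(1), of X "n * ?m" ?N] by (simp add: time_AVG_def Let_def X_def)
      also have "\<dots> \<le> n ^ K" by (rule K1[OF _ n]) (simp add: K_def)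
      finally have "t' \<le> n ^ K + K" by simp
      moreover have "ct c' = \<tau>" if nb: "\<tau> \<notin> ?B"
      proof -
        have "length (block ?m \<tau> i) = ?m" if "i < n" for i
        proof (rule block_split(2))
          have "(i + 1) * ?m \<le> n * ?m" using that by (intro mult_le_mono1) simp
          then show "(i + 1) * ?m \<le> length \<tau>" using len t by linarith
        qed
        then have "\<exists>i<n. M.fits ?T (block ?m \<tau> i)" using nb t by auto
        then show ?thesis using a by (simp add: R'_def)
      qed
      ultimately show ?thesis using t' by auto
    qed
    have "exp_dist \<delta>' x ?W (n ^ K) \<le> real (n ^ K) / 2 ^ n"
    proof (rule exp_dist_le[OF bad])
      fix \<tau> assume t: "length \<tau> = n ^ K" "\<tau> \<notin> ?B"
      obtain t' where "result (run \<delta>' x (init ?W \<tau>) t') = Some (x \<in> L)" "ct (run \<delta>' x (init ?W \<tau>) t') = \<tau>"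
        using r[OF t(1)] t(2) by blast
      then show "ct (final \<delta>' x (init ?W \<tau>)) = \<tau>" using final_eq_run[of \<delta>' x "init ?W \<tau>" t'] by simp
    qed auto
    then have "exp_dist \<delta>' x ?W (n ^ K) \<le> C" using C'[of n] by linarith
    then show ?thesis using r unfolding n_def by blast
  qed
  show "L \<in> AVG_LCL_P"
    unfolding AVG_LCL_P_def Let_def mem_Collect_eq using v' main by blast
qed

theorem theorem6p9:
  shows "AVG_LCL_P = AVG_LCL \<inter> P_class"
  using AVG_LCL_P_subset_P_class AVG_LCL_P_subset_AVG_LCL AVG_LCL_Int_P_class_subset by blast

end
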